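(* Let $q$ be a positive integer and $\boldsymbol\ell$ a tuple of nonnegative integers indexed by the Dirichlet characters modulo $q$ with $|\boldsymbol\ell|=k$. Suppose the Splitting Hypothesis and the Random Matrix Hypothesis (defined in the context) both hold for $\boldsymbol\ell$. Then for $s=1/2+it$, as $T\to\infty$, $$\frac1T\int_T^{2T}|\mathcal L^{\boldsymbol\ell}(s)|^2\,dt=(c_{\boldsymbol\ell}(q)+o_{q,k}(1))\prod_\chi(\log q^*(\chi)T)^{\ell_\chi^2},$$ where $$c_{\boldsymbol\ell}(q)=\prod_p\left\{\Big(1-\frac1p\Big)^{\lambda}\sum_{m=0}^\infty\frac{|d_{\boldsymbol\ell}(p^m)|^2}{p^m}\right\}\prod_\chi\frac{G(\ell_\chi+1)^2}{G(2\ell_\chi+1)}.$$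
   Context: Sums and products over $\chi$ run over all Dirichlet characters modulo $q$; $q^*(\chi)$ is the conductor of $\chi$ and $\chi^*$ the primitive character inducing $\chi$. For a tuple $\boldsymbol\ell=(\ell_\chi)_\chi$: $|\boldsymbol\ell|=\sum_\chi\ell_\chi$, $\lambda=\sum_\chi\ell_\chi^2$, $\mathcal L^{\boldsymbol\ell}(s)=\prod_\chi L(s,\chi)^{\ell_\chi}$, $d_{\boldsymbol\ell}(n)$ the coefficient of $n^{-s}$ in its Dirichlet series. $G$ is the Barnes $G$-function. Fix a non-negative $C^\infty$ function $f$ of mass one supported on $[0,1]$; for $X\geqslant2$ let $u(x)=Xf(X\log(x/e)+1)/x$, $U(z)=\int_0^\infty u(x)E_1(z\log x)\,dx$ with $E_1(z)=\int_z^\infty e^{-w}w^{-1}dw$. Define $P_X(s,\chi)=\prod_{p\mid q}(1-\chi^*(p)p^{-s})\exp(\sum_{n\leqslant X}\chi^*(n)\Lambda(n)/(n^s\log n))$ and $Z_X(s,\chi)=\exp(-\sum_\rho U((s-\rho)\log X))$, the sum over zeros $\rho$ of $L(s,\chi^* )$ with $0\leqslant\Re\rho\leqslant1$ (with multiplicity); $\mathcal P_X^{\boldsymbol\ell}=\prod_\chi P_X(\cdot,\chi)^{\ell_\chi}$, $\mathcal Z_X^{\boldsymbol\ell}=\prod_\chi Z_X(\cdot,\chi)^{\ell_\chi}$. Splitting Hypothesis for $\boldsymbol\ell$: for every $\epsilon>0$, as $X,T\to\infty$ with $X\ll_\epsilon(\log T)^{2-\epsilon}$, with $s=1/2+it$,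 $\frac1T\int_T^{2T}|\mathcal L^{\boldsymbol\ell}(s)|^2dt\sim\big(\frac1T\int_T^{2T}|\mathcal P_X^{\boldsymbol\ell}(s)|^2dt\big)\big(\frac1T\int_T^{2T}|\mathcal Z_X^{\boldsymbol\ell}(s)|^2dt\big)$. Random Matrix Hypothesis for $\boldsymbol\ell$: in the same range, $\frac1T\int_T^{2T}|\mathcal Z_X^{\boldsymbol\ell}(s)|^2dt\sim\prod_\chi\Big[\frac{G(\ell_\chi+1)^2}{G(2\ell_\chi+1)}\Big(\frac{\log q^*(\chi)T}{e^\gamma\log X}\Big)^{\ell_\chi^2}\Big]$, $\gamma$ the Euler–Mascheroni constant. *)

theory Defs
  imports
    "HOL-Complex_Analysis.Complex_Analysis"
    "HOL-Number_Theory.Number_Theory"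
    "HOL-Library.Landau_Symbols"
begin

section \<open>Dirichlet characters\<close>

definition dirichlet_character :: "nat \<Rightarrow> (nat \<Rightarrow> complex) \<Rightarrow> bool" where
  "dirichlet_character q chi \<longleftrightarrow>
     chi 1 = 1 \<and> (\<forall>m n. chi (m * n) = chi m * chi n) \<and>
     (\<forall>n. chi (n + q) = chi n) \<and> (\<forall>n. chi n = 0 \<longleftrightarrow> \<not> coprime n q)"

definition dirichlet_characters :: "nat \<Rightarrow> (nat \<Rightarrow> complex) set" where
  "dirichlet_characters q = {chi. dirichlet_character q chi}"

definition principal_character :: "nat \<Rightarrow> (nat \<Rightarrow> complex) \<Rightarrow> bool" where
  "principal_character q chi \<longleftrightarrow> dirichlet_character q chi \<and> (\<forall>n. coprime n q \<longrightarrow> chi n = 1)"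

definition induces :: "nat \<Rightarrow> (nat \<Rightarrow> complex) \<Rightarrow> nat \<Rightarrow> (nat \<Rightarrow> complex) \<Rightarrow> bool" where
  "induces d psi q chi \<longleftrightarrow>
     d dvd q \<and> dirichlet_character d psi \<and> dirichlet_character q chi \<and>
     (\<forall>n. coprime n q \<longrightarrow> chi n = psi n)"

definition conductor :: "nat \<Rightarrow> (nat \<Rightarrow> complex) \<Rightarrow> nat" where
  "conductor q chi = (LEAST d. \<exists>psi. induces d psi q chi)"

definition primitive_character :: "nat \<Rightarrow> (nat \<Rightarrow> complex) \<Rightarrow> bool" where
  "primitive_character q chi \<longleftrightarrow> dirichlet_character q chi \<and> conductor q chi = q"

definition primitive_inducing :: "nat \<Rightarrow> (nat \<Rightarrow> complex) \<Rightarrow> (nat \<Rightarrow> complex)" where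
  "primitive_inducing q chi =
     (THE psi. primitive_character (conductor q chi) psi \<and> induces (conductor q chi) psi q chi)"

lemma finite_dirichlet_characters:
  assumes "q > 0"
  shows   "finite (dirichlet_characters q)"
proof -
  define Z where "Z = insert 0 {z::complex. z ^ totient q = 1}"
  have finZ: "finite Z"
    unfolding Z_def using finite_nth_roots[of "totient q" 1] assms by simp
  have inZ: "chi n \<in> Z" if chi: "dirichlet_character q chi" for chi n
  proof (cases "coprime n q")
    case True
    have pow: "chi (n ^ k) = chi n ^ k" for k
      using chi by (induction k) (auto simp: dirichlet_character_def)
    have per: "chi (a + k * q) = chi a" for a k
    proof (induction k)
      case (Suc k)
      have "chi (a + Suc k * q) = chi ((a + k * q) + q)" by (simp add: algebra_simps)
      with Suc chi show ?case by (simp add: dirichlet_character_def)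
    qed simp
    have md: "chi a = chi (a mod q)" for a
      using per[of "a mod q" "a div q"] by simp
    have "[n ^ totient q = 1] (mod q)" by (rule euler_theorem[OF True])
    hence "chi (n ^ totient q) = chi 1"
      using md[of "n ^ totient q"] md[of 1] by (simp add: cong_def)
    with pow chi show ?thesis by (auto simp: Z_def dirichlet_character_def)
  qed (use chi in \<open>auto simp: Z_def dirichlet_character_def\<close>)
  have "inj_on (\<lambda>chi. restrict chi {..<q}) (dirichlet_characters q)"
  proof (rule inj_onI, rule ext)
    fix chi psi n
    assume A: "chi \<in> dirichlet_characters q" "psi \<in> dirichlet_characters q"
      and E: "restrict chi {..<q} = restrict psi {..<q}"
    show "chi n = psi n"
    proof (induction n rule: less_induct)
      case (less n)
      show ?case
      proof (cases "n < q")
        case True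
        then show ?thesis using fun_cong[OF E, of n] by simp
      next
        case False
        then have "chi n = chi ((n - q) + q)" "psi n = psi ((n - q) + q)" by simp_all
        then have "chi n = chi (n - q)" "psi n = psi (n - q)"
          using A by (simp_all only: dirichlet_characters_def dirichlet_character_def mem_Collect_eq)
        with less[of "n - q"] False assms show ?thesis by simp
      qed
    qed
  qed
  moreover have "(\<lambda>chi. restrict chi {..<q}) ` dirichlet_characters q \<subseteq> {..<q} \<rightarrow>\<^sub>E Z"
    using inZ by (auto simp: dirichlet_characters_def restrict_def PiE_def Pi_def extensional_def split: if_splits)
  moreover have "finite ({..<q} \<rightarrow>\<^sub>E Z)"
    using finZ by (intro finite_PiE) auto
  ultimately show ?thesis
    by (meson finite_imageD finite_subset)
qed

section \<open>L-functions\<close>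

definition dirichlet_L_domain :: "nat \<Rightarrow> (nat \<Rightarrow> complex) \<Rightarrow> complex set" where
  "dirichlet_L_domain q chi = (if principal_character q chi then - {1} else UNIV)"

text \<open>
  The L-function is the analytic continuation of its Dirichlet series. By the identity theorem
  it is determined on \<open>dirichlet_L_domain q chi\<close>; the value at the pole \<open>1\<close> for principal
  characters is unspecified and never used.
\<close>
definition dirichlet_L :: "nat \<Rightarrow> (nat \<Rightarrow> complex) \<Rightarrow> complex \<Rightarrow> complex" where
  "dirichlet_L q chi =
     (SOME g. g holomorphic_on dirichlet_L_domain q chi \<and>
        (\<forall>s. Re s > 1 \<longrightarrow> (\<lambda>n. chi (Suc n) / of_nat (Suc n) powr s) sums g s))"

definition dirichlet_L_zeros :: "nat \<Rightarrow> (nat \<Rightarrow> complex) \<Rightarrow> complex set" where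
  "dirichlet_L_zeros q chi =
     {\<rho> \<in> dirichlet_L_domain q chi. dirichlet_L q chi \<rho> = 0 \<and> 0 \<le> Re \<rho> \<and> Re \<rho> \<le> 1}"

definition L_prod :: "nat \<Rightarrow> ((nat \<Rightarrow> complex) \<Rightarrow> nat) \<Rightarrow> complex \<Rightarrow> complex" where
  "L_prod q l s = (\<Prod>chi\<in>dirichlet_characters q. dirichlet_L q chi s ^ l chi)"

text \<open>
  The coefficient of \<open>n\<^sup>-\<^sup>s\<close> obtained by multiplying out the Dirichlet series of the factors
  of \<open>L_prod q l\<close>: the factors, with multiplicity, are indexed by the pairs \<open>(chi, i)\<close> with
  \<open>i < l chi\<close>, and \<open>m (chi, i)\<close> is the index of the term chosen from the corresponding factor.
\<close>
definition dirichlet_coeff :: "nat \<Rightarrow> ((nat \<Rightarrow> complex) \<Rightarrow> nat) \<Rightarrow> nat \<Rightarrow> complex" where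
  "dirichlet_coeff q l n =
     (let I = (SIGMA chi:dirichlet_characters q. {..<l chi}) in
      \<Sum>m | m \<in> I \<rightarrow>\<^sub>E {d. d dvd n} \<and> (\<Prod>i\<in>I. m i) = n. \<Prod>i\<in>I. fst i (m i))"

section \<open>The Barnes G-function\<close>

text \<open>Weierstrass product of \<open>G(1 + w)\<close> with \<open>w = z - 1\<close>.\<close>
definition barnes_G :: "'a :: {real_normed_field, banach} \<Rightarrow> 'a" where
  "barnes_G z =
     (let w = z - 1 in
        exp (w / 2 * of_real (ln (2 * pi))) *
        exp (- (w + w\<^sup>2 * (1 + euler_mascheroni)) / 2) *
        (\<Prod>k. (1 + w / of_nat (Suc k)) ^ Suc k * exp (w\<^sup>2 / (2 * of_nat (Suc k)) - w)))"

section \<open>The hybrid product\<close>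

definition smooth_bump :: "(real \<Rightarrow> real) \<Rightarrow> bool" where
  "smooth_bump f \<longleftrightarrow>
     (\<forall>x. f x \<ge> 0) \<and> (\<forall>n. (deriv ^^ n) f differentiable_on UNIV) \<and>
     (\<forall>x. x \<notin> {0..1} \<longrightarrow> f x = 0) \<and> (f has_integral 1) UNIV"

definition bump_u :: "(real \<Rightarrow> real) \<Rightarrow> real \<Rightarrow> real \<Rightarrow> real" where
  "bump_u f X x = X * f (X * ln (x / exp 1) + 1) / x"

text \<open>
  Principal branch of the exponential integral; the contour is the horizontal ray from \<open>z\<close>
  to \<open>+\<infinity>\<close>, which avoids \<open>0\<close> unless \<open>z \<in> \<real>\<^sub>\<le>\<^sub>0\<close>. On that cut the value is irrelevant: in
  \<open>Z_X\<close> below it only concerns points \<open>s\<close> with the same imaginary part as a zero, so at most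
  countably many points of the critical line.
\<close>
definition exp_integral_E1 :: "complex \<Rightarrow> complex" where
  "exp_integral_E1 z =
     integral {0..} (\<lambda>t::real. exp (- (z + of_real t)) / (z + of_real t))"

definition smooth_U :: "(real \<Rightarrow> real) \<Rightarrow> real \<Rightarrow> complex \<Rightarrow> complex" where
  "smooth_U f X z =
     integral {0..} (\<lambda>x. of_real (bump_u f X x) * exp_integral_E1 (z * of_real (ln x)))"

definition P_X :: "nat \<Rightarrow> real \<Rightarrow> (nat \<Rightarrow> complex) \<Rightarrow> complex \<Rightarrow> complex" where
  "P_X q X chi s =
     (\<Prod>p\<in>prime_factors q. 1 - primitive_inducing q chi p / of_nat p powr s) *
     exp (\<Sum>n | 1 \<le> n \<and> real n \<le> X.
            primitive_inducing q chi n * mangoldt n / (of_nat n powr s * of_real (ln (real n))))"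

definition Z_X :: "(real \<Rightarrow> real) \<Rightarrow> nat \<Rightarrow> real \<Rightarrow> (nat \<Rightarrow> complex) \<Rightarrow> complex \<Rightarrow> complex" where
  "Z_X f q X chi s =
     (let d = conductor q chi; psi = primitive_inducing q chi in
      exp (- (\<Sum>\<^sub>\<infinity>\<rho>\<in>dirichlet_L_zeros d psi.
                of_int (zorder (dirichlet_L d psi) \<rho>) *
                smooth_U f X ((s - \<rho>) * of_real (ln X)))))"

definition P_prod :: "nat \<Rightarrow> ((nat \<Rightarrow> complex) \<Rightarrow> nat) \<Rightarrow> real \<Rightarrow> complex \<Rightarrow> complex" where
  "P_prod q l X s = (\<Prod>chi\<in>dirichlet_characters q. P_X q X chi s ^ l chi)"

definition Z_prod ::
    "(real \<Rightarrow> real) \<Rightarrow> nat \<Rightarrow> ((nat \<Rightarrow> complex) \<Rightarrow> nat) \<Rightarrow> real \<Rightarrow> complex \<Rightarrow> complex" where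
  "Z_prod f q l X s = (\<Prod>chi\<in>dirichlet_characters q. Z_X f q X chi s ^ l chi)"

section \<open>The two hypotheses\<close>

definition mean_square :: "(complex \<Rightarrow> complex) \<Rightarrow> real \<Rightarrow> real" where
  "mean_square F T = 1 / T * integral {T..2 * T} (\<lambda>t. (norm (F (Complex (1 / 2) t)))\<^sup>2)"

text \<open>The pairs \<open>(X, T)\<close> with \<open>X, T \<rightarrow> \<infinity>\<close> subject to \<open>X \<le> C (log T)\<^sup>2\<^sup>-\<^sup>\<epsilon>\<close>.\<close>
definition XT_range :: "real \<Rightarrow> real \<Rightarrow> (real \<times> real) filter" where
  "XT_range \<epsilon> C = inf (at_top \<times>\<^sub>F at_top) (principal {(X, T). X \<le> C * ln T powr (2 - \<epsilon>)})"

definition splitting_hypothesis ::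
    "(real \<Rightarrow> real) \<Rightarrow> nat \<Rightarrow> ((nat \<Rightarrow> complex) \<Rightarrow> nat) \<Rightarrow> bool" where
  "splitting_hypothesis f q l \<longleftrightarrow>
     (\<forall>\<epsilon>>0. \<forall>C>0.
        (\<lambda>(X, T). mean_square (L_prod q l) T) \<sim>[XT_range \<epsilon> C]
        (\<lambda>(X, T). mean_square (P_prod q l X) T * mean_square (Z_prod f q l X) T))"

definition random_matrix_hypothesis ::
    "(real \<Rightarrow> real) \<Rightarrow> nat \<Rightarrow> ((nat \<Rightarrow> complex) \<Rightarrow> nat) \<Rightarrow> bool" where
  "random_matrix_hypothesis f q l \<longleftrightarrow>
     (\<forall>\<epsilon>>0. \<forall>C>0.
        (\<lambda>(X, T). mean_square (Z_prod f q l X) T) \<sim>[XT_range \<epsilon> C]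
        (\<lambda>(X, T). \<Prod>chi\<in>dirichlet_characters q.
           (barnes_G (real (l chi) + 1))\<^sup>2 / barnes_G (2 * real (l chi) + 1) *
           (ln (real (conductor q chi) * T) / (exp euler_mascheroni * ln X)) ^ ((l chi)\<^sup>2)))"

section \<open>The leading constant\<close>

text \<open>
  The Euler product is in general only conditionally convergent; it is the limit of the partial
  products over \<open>p \<le> N\<close>.
\<close>
definition leading_constant :: "nat \<Rightarrow> ((nat \<Rightarrow> complex) \<Rightarrow> nat) \<Rightarrow> real" where
  "leading_constant q l =
     (\<Prod>p. if prime p
           then (1 - 1 / real p) ^ (\<Sum>chi\<in>dirichlet_characters q. (l chi)\<^sup>2) *
                (\<Sum>m. (norm (dirichlet_coeff q l (p ^ m)))\<^sup>2 / real p ^ m)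
           else 1) *
     (\<Prod>chi\<in>dirichlet_characters q.
        (barnes_G (real (l chi) + 1))\<^sup>2 / barnes_G (2 * real (l chi) + 1))"

end

theory Submission
  imports Defs "HOL-Real_Asymp.Real_Asymp"
begin

text \<open>
  For fixed \<open>X\<close>, the function \<open>P_prod q l X\<close> on the critical line is an absolutely convergent
  Dirichlet series, so its mean square tends as \<open>T \<rightarrow> \<infinity>\<close> to a product over \<open>p \<le> X\<close> of sums of
  squared coefficients. The coefficients at \<open>p\<^sup>m\<close> agree with \<open>d\<^sub>l(p\<^sup>m)\<close> for \<open>p\<^sup>m \<le> X\<close> and are bounded by a
  binomial coefficient in any case, so this product is asymptotic to the product over \<open>p \<le> X\<close> of the
  sums of \<open>\<bar>d\<^sub>l(p\<^sup>m)\<bar>\<^sup>2 / p\<^sup>m\<close>; Mertens' third theorem converts the factor \<open>(e\<^sup>\<gamma> log X)\<^sup>\<lambda>\<close> of the random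
  matrix hypothesis into a product of \<open>(1 - 1/p)\<^sup>-\<^sup>\<lambda>\<close>. It suffices to let \<open>T \<rightarrow> \<infinity>\<close> with \<open>X\<close> fixed and
  \<open>X \<rightarrow> \<infinity>\<close> afterwards. Uniformity in \<open>l\<close> is automatic, since only finitely many tuples have \<open>\<bar>l\<bar> = k\<close>.
\<close>

text \<open>Letting \<open>X\<close> grow with \<open>T\<close> would require control of the
  off-diagonal terms in the mean square of \<open>P_prod\<close>. With \<open>X\<close> fixed they
  vanish by absolute convergence and because the frequencies log n are distinct. The hypotheses
  permit this, since a fixed \<open>X\<close> satisfies X \<le> log T for all large
  \<open>T\<close>. The obstacle is that nothing exact is known at any fixed \<open>X\<close>: the
  quotient of the two sides is only close to 1, arbitrarily so once \<open>X\<close> is large. The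
  argument works because the random matrix prediction is a function of \<open>T\<close> times a
  function of \<open>X\<close>, so that the two limits can be taken separately. The coefficients at
  prime powers are handled through logarithmic derivatives. The truncation p^j \<le> X and the
  factors at primes dividing \<open>q\<close> are simple in the logarithm of a local factor and
  complicated after exponentiation. The recursion contained in F' = B F transfers both agreement and
  size from \<open>B\<close> to \<open>F\<close>.\<close>

unbundle no vec_syntax

section \<open>Abel summation\<close>

text \<open>Summation by parts: the differences \<open>f n - f (Suc n)\<close> are non-negative and
  telescope, so the weights contribute at most \<open>f M\<close> in total. Blocks starting at
  \<open>M\<close>, rather than partial sums from 0, keep \<open>e\<close> small for convergent
  series.\<close>

lemma abel_inequality:
  fixes c f :: "nat \<Rightarrow> real"
  assumes c: "\<And>n. \<bar>sum c {M..<n}\<bar> \<le> e"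
    and dec: "\<And>n. n \<ge> M \<Longrightarrow> f (Suc n) \<le> f n" and nn: "\<And>n. n \<ge> M \<Longrightarrow> f n \<ge> 0"
  shows "\<bar>\<Sum>n=M..<N. c n * f n\<bar> \<le> e * f M"
proof (cases "M \<le> N")
  case True
  have "(\<Sum>n=M..<N. c n * f n) =
          sum c {M..<N} * f N + (\<Sum>n=M..<N. sum c {M..<Suc n} * (f n - f (Suc n)))"
    using True by (induction rule: dec_induct) (auto simp: algebra_simps)
  also have "\<bar>\<dots>\<bar> \<le> e * f N + (\<Sum>n=M..<N. e * (f n - f (Suc n)))"
  proof (rule order.trans[OF abs_triangle_ineq add_mono])
    show "\<bar>sum c {M..<N} * f N\<bar> \<le> e * f N"
      using c[of N] nn[OF True] by (simp add: abs_mult mult_right_mono)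
    show "\<bar>\<Sum>n=M..<N. sum c {M..<Suc n} * (f n - f (Suc n))\<bar> \<le>
            (\<Sum>n=M..<N. e * (f n - f (Suc n)))"
    proof (rule order.trans[OF sum_abs sum_mono])
      fix n assume "n \<in> {M..<N}"
      hence "f n - f (Suc n) \<ge> 0" using dec[of n] by simp
      thus "\<bar>sum c {M..<Suc n} * (f n - f (Suc n))\<bar> \<le> e * (f n - f (Suc n))"
        unfolding abs_mult using c[of "Suc n"] by (simp add: mult_right_mono del: sum.op_ivl_Suc)
    qed
  qed
  also have "(\<Sum>n=M..<N. e * (f n - f (Suc n))) = e * (f M - f N)"
    using True by (induction rule: dec_induct) (auto simp: algebra_simps)
  finally show ?thesis by (simp add: algebra_simps)
next
  case False
  have "e \<ge> 0" using c[of 0] by simp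
  with False nn[of M] show ?thesis by simp
qed

text \<open>A block of \<open>c\<close> is a difference of two partial sums, hence at most
  \<open>2 * B\<close>; \<open>abel_inequality\<close> then gives the Cauchy criterion.\<close>

lemma dirichlet_test:
  fixes c f :: "nat \<Rightarrow> real"
  assumes c: "\<And>n. \<bar>\<Sum>i<n. c i\<bar> \<le> B"
    and dec: "\<And>n. f (Suc n) \<le> f n" and lim: "f \<longlonglongrightarrow> 0"
  shows "summable (\<lambda>n. c n * f n)"
  unfolding summable_Cauchy
proof (intro allI impI)
  fix e :: real assume e: "e > 0"
  have "decseq f" using dec by (simp add: decseq_Suc_iff)
  hence nn: "f n \<ge> 0" for n
    using lim by (rule decseq_ge)
  have B: "B \<ge> 0" using c[of 0] by simp
  have c2: "\<bar>sum c {M..<n}\<bar> \<le> 2 * B" for M n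
  proof (cases "M \<le> n")
    case True
    have "sum c {M..<n} = sum c {..<n} - sum c {..<M}"
      using sum_diff_nat_ivl[of 0 M n c] True by (simp add: lessThan_atLeast0)
    thus ?thesis using c[of n] c[of M] by linarith
  qed (use B in auto)
  have "\<forall>\<^sub>F n in sequentially. f n < e / (2 * B + 1)"
    using lim e B by (intro order_tendstoD) auto
  then obtain N where N: "\<And>n. n \<ge> N \<Longrightarrow> f n < e / (2 * B + 1)"
    by (auto simp: eventually_sequentially)
  show "\<exists>N. \<forall>m\<ge>N. \<forall>n. norm (\<Sum>i=m..<n. c i * f i) < e"
  proof (intro exI allI impI)
    fix m n assume "m \<ge> N"
    have "norm (\<Sum>i=m..<n. c i * f i) \<le> 2 * B * f m"
      unfolding real_norm_def by (rule abel_inequality) (use c2 dec nn in auto)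
    also have "\<dots> \<le> (2 * B + 1) * f m" using nn[of m] by (simp add: algebra_simps)
    also have "\<dots> < e" using N[OF \<open>m \<ge> N\<close>] B by (simp add: field_simps)
    finally show "norm (\<Sum>i=m..<n. c i * f i) < e" .
  qed
qed

text \<open>Abel's limit theorem for general decreasing weights; it is applied to the weights
  (n+1)^-d as d tends to 0 from the right. The tails are bounded uniformly in \<open>x\<close> by
  \<open>abel_inequality\<close>, so the limit only has to be taken in finitely many terms.\<close>

lemma abel_limit:
  fixes c :: "nat \<Rightarrow> real" and f :: "'a \<Rightarrow> nat \<Rightarrow> real"
  assumes c: "summable c"
    and f: "\<forall>\<^sub>F x in F. (\<forall>n. f x (Suc n) \<le> f x n \<and> f x n \<ge> 0) \<and> f x 0 \<le> 1"
    and lim: "\<And>n. ((\<lambda>x. f x n) \<longlongrightarrow> 1) F"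
  shows "((\<lambda>x. \<Sum>n. c n * f x n) \<longlongrightarrow> suminf c) F"
proof (rule tendstoI)
  fix e :: real assume e: "e > 0"
  from c obtain M where M: "\<And>m n. m \<ge> M \<Longrightarrow> \<bar>sum c {m..<n}\<bar> < e / 4"
    unfolding summable_Cauchy using e by (metis divide_pos_pos real_norm_def zero_less_numeral)
  \<comment> \<open>One bound for all admissible weights \<open>g\<close>; the constant weight 1
    gives the tail of \<open>c\<close> itself.\<close>
  have tail: "summable (\<lambda>n. c n * g n) \<and> \<bar>(\<Sum>n. c n * g n) - (\<Sum>n<M. c n * g n)\<bar> \<le> e / 4"
    if g: "\<And>n. g (Suc n) \<le> g n" "\<And>n. g n \<ge> 0" "g 0 \<le> 1" for g :: "nat \<Rightarrow> real"
  proof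
    have "antimono g" using g(1) by (simp add: decseq_Suc_iff)
    hence g1: "g n \<le> 1" for n using g(3) decseqD[of g 0 n] by simp
    have bd: "\<bar>\<Sum>n=m..<N. c n * g n\<bar> \<le> e'"
      if "\<And>n. \<bar>sum c {m..<n}\<bar> \<le> e'" for m N e'
    proof -
      have "\<bar>\<Sum>n=m..<N. c n * g n\<bar> \<le> e' * g m"
        by (rule abel_inequality) (use that g in auto)
      also have "\<dots> \<le> e' * 1" using g1 that[of 0] by (intro mult_left_mono) auto
      finally show ?thesis by simp
    qed
    show sm: "summable (\<lambda>n. c n * g n)"
      unfolding summable_Cauchy
    proof (intro allI impI)
      fix e' :: real assume "e' > 0"
      then obtain N where N: "\<And>m n. m \<ge> N \<Longrightarrow> \<bar>sum c {m..<n}\<bar> < e' / 2"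
        using c unfolding summable_Cauchy by (metis half_gt_zero real_norm_def)
      show "\<exists>N. \<forall>m\<ge>N. \<forall>n. norm (\<Sum>i=m..<n. c i * g i) < e'"
      proof (intro exI allI impI)
        fix m n assume "m \<ge> N"
        have "\<bar>\<Sum>i=m..<n. c i * g i\<bar> \<le> e' / 2"
          by (rule bd) (use N[OF \<open>m \<ge> N\<close>] in \<open>auto intro: less_imp_le\<close>)
        thus "norm (\<Sum>i=m..<n. c i * g i) < e'" using \<open>e' > 0\<close> by simp
      qed
    qed
    have "(\<lambda>N. \<bar>(\<Sum>n<N. c n * g n) - (\<Sum>n<M. c n * g n)\<bar>) \<longlonglongrightarrow>
            \<bar>(\<Sum>n. c n * g n) - (\<Sum>n<M. c n * g n)\<bar>"
      using summable_LIMSEQ[OF sm] by (intro tendsto_intros)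
    moreover have "\<bar>(\<Sum>n<N. c n * g n) - (\<Sum>n<M. c n * g n)\<bar> \<le> e / 4" if "N \<ge> M" for N
    proof -
      have "(\<Sum>n<N. c n * g n) - (\<Sum>n<M. c n * g n) = (\<Sum>n=M..<N. c n * g n)"
        using sum_diff_nat_ivl[of 0 M N "\<lambda>n. c n * g n"] that by (simp add: lessThan_atLeast0)
      thus ?thesis using bd[of M "e/4" N] M[of M] by (auto intro: less_imp_le)
    qed
    ultimately show "\<bar>(\<Sum>n. c n * g n) - (\<Sum>n<M. c n * g n)\<bar> \<le> e / 4"
      by (intro tendsto_upperbound[of _ _ sequentially])
         (auto simp: eventually_sequentially)
  qed
  have one: "\<bar>suminf c - (\<Sum>n<M. c n)\<bar> \<le> e / 4"
    using tail[of "\<lambda>_. 1"] by simp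
  have "((\<lambda>x. \<Sum>n<M. c n * f x n) \<longlongrightarrow> (\<Sum>n<M. c n * 1)) F"
    by (intro tendsto_intros lim)
  hence "\<forall>\<^sub>F x in F. dist (\<Sum>n<M. c n * f x n) (\<Sum>n<M. c n * 1) < e / 4"
    using e by (intro tendstoD) auto
  with f show "\<forall>\<^sub>F x in F. dist (\<Sum>n. c n * f x n) (suminf c) < e"
  proof eventually_elim
    case (elim x)
    hence "\<bar>(\<Sum>n. c n * f x n) - (\<Sum>n<M. c n * f x n)\<bar> \<le> e / 4"
      using tail[of "f x"] by blast
    with elim(2) one e show ?case
      unfolding dist_real_def mult_1_right abs_less_iff abs_le_iff by linarith
  qed
qed

section \<open>Mertens' theorems\<close>

text \<open>Since ln is the divisor sum of \<open>mangoldt\<close>, each \<open>d\<close> is counted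
  once for every multiple of it up to \<open>n\<close>. Both sides are ln n!.\<close>

lemma sum_ln_eq_sum_mangoldt:
  "(\<Sum>m=1..n. ln (real m)) = (\<Sum>d=1..n. mangoldt d * real (n div d))"
proof -
  have "(\<Sum>m=1..n. ln (real m)) = (\<Sum>m=1..n. \<Sum>d | d dvd m. mangoldt d)"
    by (intro sum.cong refl) (subst mangoldt_sum, auto)
  also have "\<dots> = (\<Sum>m=1..n. \<Sum>d | d \<in> {1..n} \<and> d dvd m. mangoldt d)"
    by (intro sum.cong refl) (auto dest: dvd_imp_le intro!: Nat.gr0I)
  also have "\<dots> = (\<Sum>d=1..n. \<Sum>m | m \<in> {1..n} \<and> d dvd m. mangoldt d)"
    by (rule sum.swap_restrict) auto
  also have "\<dots> = (\<Sum>d=1..n. mangoldt d * real (n div d))"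
  proof (intro sum.cong refl)
    fix d assume "d \<in> {1..n}"
    hence d: "d > 0" by auto
    have "{m. m \<in> {1..n} \<and> d dvd m} = (\<lambda>j. d * j) ` {1..n div d}"
      using d by (auto simp: image_iff div_greater_zero_iff less_eq_div_iff_mult_less_eq mult.commute elim!: dvdE)
    moreover have "inj_on (\<lambda>j. d * j) {1..n div d}" using d by (auto simp: inj_on_def)
    ultimately have "card {m. m \<in> {1..n} \<and> d dvd m} = n div d"
      by (simp add: card_image)
    thus "(\<Sum>m | m \<in> {1..n} \<and> d dvd m. mangoldt d) = mangoldt d * real (n div d)"
      by simp
  qed
  finally show ?thesis .
qed

text \<open>A weak form of Stirling's formula with error O(n); the lower bound comes from n ln (1 +
  1/n) \<le> 1.\<close>

lemma sum_ln_bounds: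
  shows "(\<Sum>m=1..n. ln (real m)) \<le> real n * ln (real n)"
    and "(\<Sum>m=1..n. ln (real m)) \<ge> real n * ln (real n) - real n"
proof -
  have "(\<Sum>m=1..n. ln (real m)) \<le> (\<Sum>m=1..n. ln (real n))"
    by (intro sum_mono) auto
  thus "(\<Sum>m=1..n. ln (real m)) \<le> real n * ln (real n)" by simp
  show "(\<Sum>m=1..n. ln (real m)) \<ge> real n * ln (real n) - real n"
  proof (induction n)
    case (Suc n)
    show ?case
    proof (cases "n = 0")
      case False
      have "ln (1 + 1 / real n) \<le> 1 / real n" by (rule ln_add_one_self_le_self) simp
      hence "real n * ln (1 + 1 / real n) \<le> 1" using False by (simp add: field_simps)
      moreover have "ln (1 + 1 / real n) = ln (real (Suc n)) - ln (real n)"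
        using False by (subst ln_divide_pos [symmetric]) (auto simp: field_simps)
      ultimately have "real n * (ln (real (Suc n)) - ln (real n)) \<le> 1" by simp
      with Suc.IH show ?thesis by (simp add: algebra_simps)
    qed simp
  qed simp
qed

text \<open>Chebyshev's argument: with m = n div 2, the quantity ln (n! / (m!)^2) is at most 4 n and
  bounds the sum of \<open>mangoldt\<close> over m < d \<le> n. The induction closes by 8 m + 4 n
  \<le> 8 n.\<close>

lemma sum_mangoldt_le: "(\<Sum>d=1..n. mangoldt d) \<le> 8 * real n"
proof (induction n rule: less_induct)
  case (less n)
  show ?case
  proof (cases "n \<le> 1")
    case True
    hence "n = 0 \<or> n = 1" by auto
    thus ?thesis by auto
  next
    case False
    define m where "m = n div 2"
    have m: "m > 0" "m < n" "2 * m \<le> n" "n \<le> 2 * m + 1" "n \<le> 3 * m"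
      using False by (auto simp: m_def)
    let ?T = "\<lambda>n. \<Sum>m=1..n. ln (real m)"
    have "(\<Sum>d=m+1..n. mangoldt d) \<le>
            (\<Sum>d=m+1..n. mangoldt d * (real (n div d) - 2 * real (m div d)))"
    proof (intro sum_mono)
      fix d assume d: "d \<in> {m+1..n}"
      hence "m div d = 0" "n div d \<ge> 1" by (auto simp: Suc_le_eq div_greater_zero_iff)
      thus "(mangoldt d :: real) \<le> mangoldt d * (real (n div d) - 2 * real (m div d))"
        using mangoldt_nonneg[of d] by (simp add: mult_le_cancel_left1)
    qed
    also have "\<dots> \<le> (\<Sum>d=1..n. mangoldt d * (real (n div d) - 2 * real (m div d)))"
    proof (intro sum_mono2 mult_nonneg_nonneg mangoldt_nonneg)
      fix d
      have "2 * (m div d) \<le> n div d"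
        unfolding m_def by (metis div_mult2_eq mult.commute div_times_less_eq_dividend)
      thus "0 \<le> real (n div d) - 2 * real (m div d)" by linarith
    qed auto
    also have "\<dots> = (\<Sum>d=1..n. mangoldt d * real (n div d)) - 2 * (\<Sum>d=1..n. mangoldt d * real (m div d))"
      by (simp add: algebra_simps sum_subtractf sum_distrib_left)
    also have "(\<Sum>d=1..n. mangoldt d * real (m div d)) = (\<Sum>d=1..m. mangoldt d * real (m div d))"
      using m by (intro sum.mono_neutral_right) auto
    also have "(\<Sum>d=1..n. mangoldt d * real (n div d)) - 2 * (\<Sum>d=1..m. mangoldt d * real (m div d))
                 = ?T n - 2 * ?T m"
      by (simp only: sum_ln_eq_sum_mangoldt)
    also have "\<dots> \<le> real n * ln n - 2 * (real m * ln m - real m)"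
      using sum_ln_bounds[of n] sum_ln_bounds[of m] by (intro diff_mono mult_left_mono) auto
    \<comment> \<open>The leading terms cancel because n - 1 \<le> 2 m and ln n \<le> ln 3 + ln m.
      What remains is at most (n - 1) + 2 (n - 1) + n.\<close>
    also have "\<dots> \<le> 4 * real n"
    proof -
      have "real n \<le> 3 * real m" using m(5) by linarith
      hence "ln (real n) \<le> ln (3 * real m)" using m(1) False by simp
      also have "\<dots> = ln 3 + ln (real m)" using m by (simp add: ln_mult)
      finally have l: "ln (real n) \<le> ln 3 + ln (real m)" .
      have l3: "ln (3::real) \<le> 2" using ln_le_minus_one[of 3] by simp
      have ln: "ln (real n) \<le> real n - 1" using False by (intro ln_le_minus_one) auto
      have "(real n - 1) * (ln (real n) - ln 3) \<le> 2 * real m * ln (real m)"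
      proof (rule order.trans)
        show "(real n - 1) * (ln (real n) - ln 3) \<le> (real n - 1) * ln (real m)"
          using l False by (intro mult_left_mono) auto
        show "(real n - 1) * ln (real m) \<le> 2 * real m * ln (real m)"
          using m by (intro mult_right_mono) auto
      qed
      hence "real n * ln n - 2 * (real m * ln m - real m) \<le>
          ln n + (real n - 1) * ln 3 + 2 * real m"
        by (simp add: algebra_simps)
      also have "(real n - 1) * ln 3 \<le> (real n - 1) * 2" using l3 False by (intro mult_left_mono) auto
      finally show ?thesis using ln m by simp
    qed
    finally have "(\<Sum>d=m+1..n. mangoldt d) \<le> 4 * real n" .
    moreover have "(\<Sum>d=1..n. mangoldt d) = (\<Sum>d=1..m. mangoldt d) + (\<Sum>d=m+1..n. mangoldt d :: real)"
      using m by (subst sum.union_disjoint [symmetric]) (auto intro!: sum.cong)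
    moreover have "(\<Sum>d=1..m. mangoldt d) \<le> 8 * real m" using less m by simp
    ultimately show ?thesis using m by simp
  qed
qed

text \<open>Replacing n div d by n / d in the formula for ln n! costs at most the sum of
  \<open>mangoldt\<close>, which is at most 8 n; the bounds for ln n! are then divided by n.\<close>

lemma sum_mangoldt_div_bounds:
  assumes "n > 0"
  shows "\<bar>(\<Sum>d=1..n. mangoldt d / real d) - ln (real n)\<bar> \<le> 8"
proof -
  let ?T = "\<Sum>m=1..n. ln (real m)" and ?S = "\<Sum>d=1..n. mangoldt d / real d :: real"
  have bd: "real (n div d) \<le> real n / real d" "real n / real d - 1 \<le> real (n div d)" for d
    using floor_divide_of_nat_eq[of n d, where ?'a = real] by linarith+
  have "?T \<le> (\<Sum>d=1..n. mangoldt d * (real n / real d))"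
    unfolding sum_ln_eq_sum_mangoldt using bd by (intro sum_mono mult_left_mono mangoldt_nonneg)
  hence 1: "?T \<le> real n * ?S" by (simp add: sum_distrib_left mult_ac)
  have "?T \<ge> (\<Sum>d=1..n. mangoldt d * (real n / real d - 1))"
    unfolding sum_ln_eq_sum_mangoldt using bd by (intro sum_mono mult_left_mono mangoldt_nonneg)
  moreover have "(\<Sum>d=1..n. mangoldt d * (real n / real d - 1)) = real n * ?S - (\<Sum>d=1..n. mangoldt d)"
    by (simp add: sum_distrib_left sum_subtractf algebra_simps)
  ultimately have 2: "real n * ?S \<le> ?T + 8 * real n" using sum_mangoldt_le[of n] by simp
  have "real n * (ln n - 1) \<le> real n * ?S" using 1 sum_ln_bounds(2)[of n] by (simp add: algebra_simps)
  moreover have "real n * ?S \<le> real n * (ln n + 8)" using 2 sum_ln_bounds(1)[of n] by (simp add: algebra_simps)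
  ultimately show ?thesis using assms by (simp add: abs_le_iff)
qed

section \<open>Mertens' second theorem with an unspecified constant\<close>

text \<open>Subtracting the increments of ln makes the partial sums bounded, by Mertens' first
  theorem, so that Dirichlet's test applies with the weights 1 / ln.\<close>

lemma summable_mangoldt_minus_ln_increment_over_ln:
  "summable (\<lambda>n. (mangoldt (n + 2) / real (n + 2) - (ln (real (n + 2)) - ln (real (n + 1)))) * (1 / ln (real (n + 2))))"
proof (rule dirichlet_test)
  fix n
  have 1: "(\<Sum>i<n. mangoldt (i + 2) / real (i + 2)) = (\<Sum>d=1..n+1. mangoldt d / real d :: real)"
    by (induction n) auto
  have 2: "(\<Sum>i<n. ln (real (i + 2)) - ln (real (i + 1))) = ln (real (n + 1))"
    by (induction n) (auto simp: add_ac)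
  show "\<bar>\<Sum>i<n. mangoldt (i + 2) / real (i + 2) - (ln (real (i + 2)) - ln (real (i + 1)))\<bar> \<le> 8"
    unfolding sum_subtractf[of _ "\<lambda>i. ln (real (i + 2)) - ln (real (i + 1))"] 1 2
    by (rule sum_mangoldt_div_bounds) simp
next
  show "1 / ln (real (Suc n + 2)) \<le> 1 / ln (real (n + 2))" for n
    by (intro divide_left_mono) auto
  show "(\<lambda>n. 1 / ln (real (n + 2))) \<longlonglongrightarrow> 0" by real_asymp
qed

text \<open>Compares a Riemann sum for the integral of dv / v, taken at the points v = ln n, with
  the increments of ln ln. For consecutive points x and y the increment lies between (y - x) / y and
  (y - x) / x, and y - x \<le> 1 leaves the telescoping bound 1 / x - 1 / y.\<close>

lemma summable_ln_ln_increment_error: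
  defines "t \<equiv> (\<lambda>n. (ln (real (n + 3)) - ln (real (n + 2))) / ln (real (n + 3)) -
                     (ln (ln (real (n + 3))) - ln (ln (real (n + 2)))))"
  shows "summable t"
proof (rule summable_comparison_test')
  show "summable (\<lambda>n. 1 / ln (real (n + 2)) - 1 / ln (real (Suc n + 2)))"
    by (intro telescope_summable'[of _ 0]) real_asymp
  fix n :: nat
  define x y where "x = ln (real (n + 2))" and "y = ln (real (n + 3))"
  have xy: "x > 0" "x \<le> y" by (auto simp: x_def y_def)
  have "ln (real (n + 3) / real (n + 2)) \<le> real (n + 3) / real (n + 2) - 1"
    by (intro ln_le_minus_one) auto
  hence "y - x \<le> real (n + 3) / real (n + 2) - 1"
    by (subst (asm) ln_divide_pos) (auto simp: x_def y_def)
  also have "\<dots> \<le> 1" by (simp add: field_simps)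
  finally have d1: "y - x \<le> 1" .
  have "ln (y / x) \<le> y / x - 1" using xy by (intro ln_le_minus_one) auto
  hence u: "ln y - ln x \<le> (y - x) / x" using xy by (simp add: ln_divide_pos diff_divide_distrib)
  have "ln (x / y) \<le> x / y - 1" using xy by (intro ln_le_minus_one) auto
  hence l: "(y - x) / y \<le> ln y - ln x" using xy by (simp add: ln_divide_pos diff_divide_distrib)
  have t: "t n = (y - x) / y - (ln y - ln x)" by (simp add: t_def x_def y_def)
  have "norm (t n) \<le> (y - x) * (1 / x - 1 / y)" using u l by (simp add: t algebra_simps)
  also have "\<dots> \<le> 1 * (1 / x - 1 / y)" using d1 xy by (intro mult_right_mono) (auto simp: field_simps)
  finally show "norm (t n) \<le> 1 / ln (real (n + 2)) - 1 / ln (real (Suc n + 2))"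
    by (simp add: x_def y_def add_ac)
qed

lemma sum_mangoldt_ln_convergent:
  "\<exists>c. (\<lambda>n. (\<Sum>d=1..n. mangoldt d / (real d * ln (real d))) - ln (ln (real n))) \<longlonglongrightarrow> c"
proof -
  define u :: "nat \<Rightarrow> real" where "u = (\<lambda>n. (mangoldt (n + 2) / real (n + 2) - (ln (real (n + 2)) - ln (real (n + 1)))) * (1 / ln (real (n + 2))))"
  define t where "t = (\<lambda>n. (ln (real (n + 3)) - ln (real (n + 2))) / ln (real (n + 3)) -
                     (ln (ln (real (n + 3))) - ln (ln (real (n + 2)))))"
  have u: "summable u" unfolding u_def by (rule summable_mangoldt_minus_ln_increment_over_ln)
  have t: "summable t" unfolding t_def by (rule summable_ln_ln_increment_error)
  \<comment> \<open>The constant makes the identity true at n = 0: \<open>u 0\<close> subtracts ln 2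
    / ln 2 = 1, and ln (ln 2) is the starting value of the double logarithm.\<close>
  have "(\<Sum>d=1..n+2. mangoldt d / (real d * ln (real d))) - ln (ln (real (n + 2))) =
          (\<Sum>i<Suc n. u i) + (\<Sum>i<n. t i) + (1 - ln (ln 2))" for n
  proof (induction n)
    case 0
    have "{1..2::nat} = {1,2}" by auto
    thus ?case by (simp add: u_def field_simps)
  next
    case (Suc n)
    have "(\<Sum>d=1..Suc n+2. mangoldt d / (real d * ln (real d))) - ln (ln (real (Suc n + 2))) =
          ((\<Sum>d=1..n+2. mangoldt d / (real d * ln (real d))) - ln (ln (real (n + 2)))) +
          (mangoldt (n + 3) / (real (n + 3) * ln (real (n + 3))) - (ln (ln (real (n + 3))) - ln (ln (real (n + 2)))))"
      by (simp add: numeral_3_eq_3 add_ac)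
    also have "mangoldt (n + 3) / (real (n + 3) * ln (real (n + 3))) - (ln (ln (real (n + 3))) - ln (ln (real (n + 2))))
                 = u (Suc n) + t n"
      by (simp add: u_def t_def numeral_3_eq_3 diff_divide_distrib)
    finally show ?case using Suc by simp
  qed
  moreover have "(\<lambda>n. (\<Sum>i<Suc n. u i) + (\<Sum>i<n. t i) + (1 - ln (ln 2))) \<longlonglongrightarrow>
                   suminf u + suminf t + (1 - ln (ln 2))"
    by (intro tendsto_intros LIMSEQ_Suc[OF summable_LIMSEQ[OF u]] summable_LIMSEQ[OF t])
  ultimately have "(\<lambda>n. (\<Sum>d=1..n+2. mangoldt d / (real d * ln (real d))) - ln (ln (real (n + 2))))
     \<longlonglongrightarrow> suminf u + suminf t + (1 - ln (ln 2))"
    by simp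
  thus ?thesis by (intro exI) (rule LIMSEQ_offset[where k = 2])
qed

section \<open>The zeta series, prime powers and the Euler product\<close>

text \<open>The mean value theorem for x^-d compares the terms d n^-(1+d) with telescoping
  differences of total 1. This gives 1 \<le> d zeta(1+d) \<le> 1 + d.\<close>

lemma zeta_near_one:
  shows "d > 0 \<Longrightarrow> summable (\<lambda>n. real (Suc n) powr - (1 + d))"
    and "((\<lambda>d. d * (\<Sum>n. real (Suc n) powr - (1 + d))) \<longlongrightarrow> 1) (at_right 0)"
proof -
  have step: "d * real (n + 2) powr - (1 + d) \<le> real (n + 1) powr - d - real (n + 2) powr - d"
             "real (n + 1) powr - d - real (n + 2) powr - d \<le> d * real (n + 1) powr - (1 + d)"
    if "d > 0" for d n
  proof -
    have "\<exists>z. real (n + 1) < z \<and> z < real (n + 2) \<and>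
        real (n + 2) powr - d - real (n + 1) powr - d = (real (n + 2) - real (n + 1)) * (- d * z powr (- d - 1))"
      using that by (intro MVT2) (auto intro!: derivative_eq_intros simp: powr_diff)
    then obtain z where z: "real (n + 1) < z" "z < real (n + 2)"
       "real (n + 2) powr - d - real (n + 1) powr - d = - d * z powr (- d - 1)" by auto
    have e: "- (1 + d) = - d - 1" by simp
    have "real (n + 2) powr (- d - 1) \<le> z powr (- d - 1)" "z powr (- d - 1) \<le> real (n + 1) powr (- d - 1)"
      using z that by (auto intro!: powr_mono2')
    with that have "d * real (n + 2) powr (- d - 1) \<le> d * z powr (- d - 1)"
        "d * z powr (- d - 1) \<le> d * real (n + 1) powr (- d - 1)"
      by (auto intro!: mult_left_mono)
    with z(3) show "d * real (n + 2) powr - (1 + d) \<le> real (n + 1) powr - d - real (n + 2) powr - d"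
         "real (n + 1) powr - d - real (n + 2) powr - d \<le> d * real (n + 1) powr - (1 + d)"
      unfolding e by linarith+
  qed
  have tel: "(\<lambda>n. real (Suc n) powr - d - real (Suc (Suc n)) powr - d) sums 1" if "d > 0" for d
  proof -
    have "(\<lambda>n. real (Suc n) powr - d) \<longlonglongrightarrow> 0" using that by real_asymp
    from telescope_sums'[OF this] show ?thesis by simp
  qed
  show sm: "summable (\<lambda>n. real (Suc n) powr - (1 + d))" if "d > 0" for d
  proof -
    have "summable (\<lambda>n. real (Suc (Suc n)) powr - (1 + d))"
    proof (rule summable_comparison_test')
      show "summable (\<lambda>n. (real (Suc n) powr - d - real (Suc (Suc n)) powr - d) / d)"
        using tel[OF that] by (intro summable_divide) (simp add: sums_iff)
      show "norm (real (Suc (Suc n)) powr - (1 + d)) \<le> (real (Suc n) powr - d - real (Suc (Suc n)) powr - d) / d" for n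
        using step(1)[OF that, of n] that by (simp add: field_simps add_ac)
    qed
    thus ?thesis by (subst (asm) summable_Suc_iff)
  qed
  show "((\<lambda>d. d * (\<Sum>n. real (Suc n) powr - (1 + d))) \<longlongrightarrow> 1) (at_right 0)"
  proof (rule tendsto_sandwich)
    show "((\<lambda>_. 1) \<longlongrightarrow> 1) (at_right (0::real))" "((\<lambda>d. 1 + d) \<longlongrightarrow> 1) (at_right (0::real))"
      by (auto intro!: tendsto_eq_intros)
    have pos: "\<forall>\<^sub>F d in at_right 0. d > (0::real)" by (simp add: eventually_at_right_less)
    show "\<forall>\<^sub>F d in at_right 0. 1 \<le> d * (\<Sum>n. real (Suc n) powr - (1 + d))"
      using pos
    proof eventually_elim
      case (elim d)
      have "1 \<le> (\<Sum>n. d * real (Suc n) powr - (1 + d))"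
        by (intro sums_le[OF _ tel[OF elim] summable_sums] summable_mult sm[OF elim])
           (use step(2)[OF elim] in \<open>simp add: add_ac\<close>)
      thus ?case unfolding suminf_mult[OF sm[OF elim]] .
    qed
    show "\<forall>\<^sub>F d in at_right 0. d * (\<Sum>n. real (Suc n) powr - (1 + d)) \<le> 1 + d"
      using pos
    proof eventually_elim
      case (elim d)
      have sm': "summable (\<lambda>n. real (Suc (Suc n)) powr - (1 + d))"
        using sm[OF elim] by (subst summable_Suc_iff)
      have "(\<Sum>n. d * real (Suc (Suc n)) powr - (1 + d)) \<le> 1"
        by (intro sums_le[OF _ summable_sums tel[OF elim]] summable_mult sm')
           (use step(1)[OF elim] in \<open>simp add: add_ac\<close>)
      hence "d * (\<Sum>n. real (Suc (Suc n)) powr - (1 + d)) \<le> 1"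
        unfolding suminf_mult[OF sm'] .
      moreover have "(\<Sum>n. real (Suc (Suc n)) powr - (1 + d)) = (\<Sum>n. real (Suc n) powr - (1 + d)) - 1"
        using suminf_split_head[OF sm[OF elim]] by simp
      ultimately show ?case by (simp only: right_diff_distrib)
    qed
  qed
qed

text \<open>The non-zero terms sit at the powers p^j with j \<ge> 1, where the quotient of
  \<open>mangoldt\<close> and ln is 1 / j; the bound j \<le> N follows from p^j \<le> N. The general
  field serves both the real sums in Mertens' theorem and the complex exponent of
  \<open>P_X\<close>.\<close>

lemma sum_mangoldt_eq_sum_prime_powers:
  fixes h :: "nat \<Rightarrow> 'a :: real_normed_field"
  shows "(\<Sum>n=1..N. h n * mangoldt n / of_real (ln (real n))) =
         (\<Sum>p | prime p \<and> p \<le> N. \<Sum>j | j \<in> {1..N} \<and> p ^ j \<le> N. h (p ^ j) / of_nat j)"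
proof -
  have "(\<Sum>n=1..N. h n * mangoldt n / of_real (ln (real n))) =
        (\<Sum>n | n \<in> {1..N} \<and> primepow n. h n * mangoldt n / of_real (ln (real n)))"
    by (intro sum.mono_neutral_right) (auto simp: mangoldt_def)
  also have "\<dots> = (\<Sum>(p, j)\<in>(SIGMA p:{p. prime p \<and> p \<le> N}. {j. j \<in> {1..N} \<and> p ^ j \<le> N}). h (p ^ j) / of_nat j)"
  proof (rule sum.reindex_bij_witness[of _ "\<lambda>(p, j). p ^ j"
           "\<lambda>n. (aprimedivisor n, multiplicity (aprimedivisor n) n)"], goal_cases)
    case (1 n)
    thus ?case by (simp add: primepow_decompose)
  next
    case (2 n)
    define p k where "p = aprimedivisor n" and "k = multiplicity p n"
    have n: "n = p ^ k" using 2 by (simp add: p_def k_def primepow_decompose)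
    have p: "prime p" using 2 primepow_gt_Suc_0[of n] by (auto simp: p_def intro!: aprimedivisor_nat(1))
    have k: "k > 0" using 2 n by (cases k) auto
    have "p \<le> n" using n k self_le_power[of p k] prime_ge_1_nat[OF p] by simp
    moreover have "k \<le> n" using n power_gt_expt[OF prime_gt_Suc_0_nat[OF p], of k] by simp
    ultimately show ?case using 2 n p k unfolding p_def k_def by auto
  next
    case (3 x)
    then show ?case by (auto simp: aprimedivisor_prime_power)
  next
    case (4 x)
    then show ?case by (auto simp: Suc_le_eq prime_gt_0_nat)
  next
    case (5 n)
    define p k where "p = aprimedivisor n" and "k = multiplicity p n"
    have n: "n = p ^ k" using 5 by (simp add: p_def k_def primepow_decompose)
    have p: "prime p" using 5 primepow_gt_Suc_0[of n] by (auto simp: p_def intro!: aprimedivisor_nat(1))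
    have k: "k > 0" using 5 n by (cases k) auto
    have "ln (real p) > 0" using prime_gt_1_nat[OF p] by simp
    hence "h (p ^ k) / of_nat k = h n * mangoldt n / of_real (ln (real n))"
      using k p by (simp add: n ln_realpow)
    thus ?case by (simp only: prod.case p_def k_def)
  qed
  also have "\<dots> = (\<Sum>p | prime p \<and> p \<le> N. \<Sum>j | j \<in> {1..N} \<and> p ^ j \<le> N. h (p ^ j) / of_nat j)"
    by (intro sum.Sigma [symmetric]) auto
  finally show ?thesis .
qed

text \<open>The error at p of truncating at p^m \<le> N. It occurs with w = 1 for the logarithms of
  Euler factors, and with squared binomial coefficients for the Euler factors of the mean
  square.\<close>

definition prime_power_tail :: "(nat \<Rightarrow> real) \<Rightarrow> nat \<Rightarrow> nat \<Rightarrow> real" where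
  "prime_power_tail w N p = (\<Sum>m. if N < p ^ m then w m / real (p ^ m) else 0)"

text \<open>For p \<le> N < p^m one has m \<ge> 2. Splitting p^-m into (p^m)^(-1/4) and (p^m)^(-3/4)
  yields N^(-1/4) from the first factor, and p^(-3/2) times a power of 2^(-3/4) from the second, so
  that the sums over p and over m both converge.\<close>

lemma
  fixes w :: "nat \<Rightarrow> real"
  assumes w: "\<And>m. w m \<ge> 0" and sm: "summable (\<lambda>m. w m * (2 powr (- 3 / 4)) ^ m)"
  shows summable_prime_power_tail:
      "\<And>p N. prime p \<Longrightarrow> p \<le> N \<Longrightarrow> summable (\<lambda>m. if N < p ^ m then w m / real (p ^ m) else 0)"
    and prime_power_tail_tendsto_0:
      "(\<lambda>N. \<Sum>p | prime p \<and> p \<le> N. prime_power_tail w N p) \<longlonglongrightarrow> 0"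
proof -
  define r :: real where "r = 2 powr (- 3 / 4)"
  have r: "r > 0" by (simp add: r_def)
  have sm: "summable (\<lambda>m. w m * r ^ m)" using sm by (simp add: r_def)
  define W where "W = (\<Sum>m. w m * r ^ m) / r ^ 2"
  have bd: "norm (if N < p ^ m then w m / real (p ^ m) else 0) \<le>
               real N powr (- 1 / 4) * real p powr (- 3 / 2) * (w m * r ^ m / r ^ 2)"
    if p: "prime p" "p \<le> N" for p N m
  proof (cases "N < p ^ m")
    case True
    have p2: "p \<ge> 2" using p by (simp add: prime_ge_2_nat)
    have "m \<ge> 2"
    proof (rule ccontr)
      assume "\<not> m \<ge> 2"
      hence "m = 0 \<or> m = 1" by auto
      thus False using True p p2 by auto
    qed
    then obtain k where m: "m = k + 2" by (metis le_add_diff_inverse2)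
    have pp: "real p powr x > 0" for x using p2 by auto
    have "1 / real (p ^ m) = real (p ^ m) powr (- 1 / 4) * real (p ^ m) powr (- 3 / 4)"
      using p2 by (simp add: powr_add [symmetric] powr_minus field_simps)
    also have "\<dots> \<le> real N powr (- 1 / 4) * real (p ^ m) powr (- 3 / 4)"
      using True p p2 by (intro mult_right_mono powr_mono2') auto
    also have "real (p ^ m) powr (- 3 / 4) = (real p powr (- 3 / 4)) ^ m"
      using p2 by (simp add: powr_realpow [symmetric] powr_powr mult.commute)
    also have "\<dots> = (real p powr (- 3 / 4)) ^ k * (real p powr (- 3 / 4)) ^ 2"
      by (simp only: m power_add)
    also have "(real p powr (- 3 / 4)) ^ 2 = real p powr (- 3 / 2)"
      using pp by (simp add: powr_realpow [symmetric] powr_powr)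
    also have "(real p powr (- 3 / 4)) ^ k \<le> r ^ k"
      unfolding r_def using p2 by (intro power_mono powr_mono2') auto
    also have "r ^ k = r ^ m / r ^ 2" using r by (simp add: m power_add power2_eq_square)
    finally have "1 / real (p ^ m) \<le> real N powr (- 1 / 4) * (r ^ m / r ^ 2 * real p powr (- 3 / 2))"
      by (simp add: mult_left_mono mult_right_mono)
    from mult_left_mono[OF this w[of m]] show ?thesis using True w[of m]
      by (simp add: mult_ac)
  next
    case False
    thus ?thesis using w r by simp
  qed
  have smb: "summable (\<lambda>m. real N powr (- 1 / 4) * real p powr (- 3 / 2) * (w m * r ^ m / r ^ 2))" for p N
    by (intro summable_mult summable_divide sm)
  show sm1: "summable (\<lambda>m. if N < p ^ m then w m / real (p ^ m) else 0)" if p: "prime p" "p \<le> N" for p N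
    by (rule summable_comparison_test'[OF smb]) (use bd[OF p] in blast)
  define Z where "Z = (\<Sum>n. real (Suc n) powr (- 3 / 2))"
  have Zs: "summable (\<lambda>n. real (Suc n) powr (- 3 / 2))"
    using zeta_near_one(1)[of "1/2"] by simp
  have W0: "W \<ge> 0" unfolding W_def using w r by (intro divide_nonneg_nonneg suminf_nonneg sm) auto
  have ub: "(\<Sum>p | prime p \<and> p \<le> N. prime_power_tail w N p) \<le> real N powr (- 1 / 4) * (Z * W)" for N
  proof -
    have "(\<Sum>p | prime p \<and> p \<le> N. prime_power_tail w N p) \<le>
          (\<Sum>p | prime p \<and> p \<le> N. real N powr (- 1 / 4) * real p powr (- 3 / 2) * W)"
    proof (rule sum_mono)
      fix p assume "p \<in> {p. prime p \<and> p \<le> N}"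
      hence p: "prime p" "p \<le> N" by auto
      have "prime_power_tail w N p \<le> (\<Sum>m. real N powr (- 1 / 4) * real p powr (- 3 / 2) * (w m * r ^ m / r ^ 2))"
        unfolding prime_power_tail_def
        using bd[OF p] by (intro suminf_le sm1[OF p] smb) (auto simp: abs_le_iff)
      also have "\<dots> = real N powr (- 1 / 4) * real p powr (- 3 / 2) * W"
        unfolding W_def by (subst suminf_mult) (auto intro!: sm summable_divide simp: suminf_divide[OF sm])
      finally show "prime_power_tail w N p \<le> real N powr (- 1 / 4) * real p powr (- 3 / 2) * W" .
    qed
    also have "\<dots> \<le> (\<Sum>p\<in>{1..N}. real N powr (- 1 / 4) * real p powr (- 3 / 2) * W)"
      using W0 by (intro sum_mono2) (auto simp: Suc_le_eq prime_gt_0_nat)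
    also have "\<dots> = real N powr (- 1 / 4) * W * (\<Sum>p\<in>{1..N}. real p powr (- 3 / 2))"
      by (simp add: sum_distrib_left mult_ac)
    also have "(\<Sum>p\<in>{1..N}. real p powr (- 3 / 2)) = (\<Sum>n<N. real (Suc n) powr (- 3 / 2))"
      by (rule sum.reindex_bij_witness[of _ Suc "\<lambda>n. n - 1"]) auto
    also have "real N powr (- 1 / 4) * W * (\<Sum>n<N. real (Suc n) powr (- 3 / 2)) \<le> real N powr (- 1 / 4) * W * Z"
      unfolding Z_def using W0 by (intro mult_left_mono sum_le_suminf Zs) auto
    finally show ?thesis by (simp only: mult_ac)
  qed
  have lb: "(\<Sum>p | prime p \<and> p \<le> N. prime_power_tail w N p) \<ge> 0" for N
    unfolding prime_power_tail_def using w by (intro sum_nonneg suminf_nonneg sm1) auto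
  have lim: "(\<lambda>N. real N powr (- 1 / 4) * (Z * W)) \<longlonglongrightarrow> 0"
    by (rule tendsto_mult_left_zero) real_asymp
  show "(\<lambda>N. \<Sum>p | prime p \<and> p \<le> N. prime_power_tail w N p) \<longlonglongrightarrow> 0"
    by (rule tendsto_sandwich[OF _ _ tendsto_const lim]) (use lb ub in \<open>auto intro: always_eventually\<close>)
qed

lemma inj_on_prod_prime_powers:
  assumes "finite S" "\<And>p. p \<in> S \<Longrightarrow> prime (p :: nat)"
  shows "inj_on (\<lambda>f. \<Prod>p\<in>S. p ^ f p) (S \<rightarrow>\<^sub>E (A :: nat set))"
proof (rule inj_onI)
  fix f g assume fg: "f \<in> S \<rightarrow>\<^sub>E A" "g \<in> S \<rightarrow>\<^sub>E A" and eq: "(\<Prod>p\<in>S. p ^ f p) = (\<Prod>p\<in>S. p ^ g p)"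
  show "f = g"
  proof (rule PiE_ext[OF fg])
    fix p assume "p \<in> S"
    thus "f p = g p"
      using multiplicity_prod_prime_powers[OF assms, of p f] multiplicity_prod_prime_powers[OF assms, of p g]
        assms eq by simp
  qed
qed

text \<open>A product of finite geometric sums expands into a sum over distinct integers, by unique
  factorisation. It is at most the whole series, and with primes and exponents up to N it contains
  every n \<le> N, because p^e dividing n forces e < n.\<close>

lemma euler_product_zeta:
  assumes s: "s > (1 :: real)"
  shows "(\<lambda>N. \<Prod>p | prime p \<and> p \<le> N. 1 / (1 - real p powr -s)) \<longlonglongrightarrow> (\<Sum>n. real (Suc n) powr -s)"
proof -
  have smz: "summable (\<lambda>n. real (Suc n) powr -s)" using zeta_near_one(1)[of "s - 1"] s by simp
  have lt1: "real p powr -s < 1" "real p powr -s > 0" if "prime p" for p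
    using s that prime_gt_1_nat[of p] by (auto simp: powr_less_one)
  have fin: "(\<Prod>p\<in>S. \<Sum>m\<le>M. (real p powr -s) ^ m) =
              (\<Sum>n\<in>(\<lambda>f. \<Prod>p\<in>S. p ^ f p) ` (S \<rightarrow>\<^sub>E {..M}). real n powr -s)"
    if S: "finite S" "\<And>p. p \<in> S \<Longrightarrow> prime p" for S M
  proof -
    have "(\<Prod>p\<in>S. \<Sum>m\<le>M. (real p powr -s) ^ m) = (\<Sum>f\<in>S \<rightarrow>\<^sub>E {..M}. \<Prod>p\<in>S. (real p powr -s) ^ f p)"
      using S by (intro prod_sum_PiE) auto
    also have "\<dots> = (\<Sum>f\<in>S \<rightarrow>\<^sub>E {..M}. real (\<Prod>p\<in>S. p ^ f p) powr -s)"
    proof (intro sum.cong refl)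
      fix f
      have "real (\<Prod>p\<in>S. p ^ f p) powr -s = (\<Prod>p\<in>S. real (p ^ f p) powr -s)"
        by (simp add: prod_powr_distrib [symmetric])
      also have "\<dots> = (\<Prod>p\<in>S. (real p powr -s) ^ f p)"
        using S by (intro prod.cong refl) (auto simp: powr_realpow [symmetric] powr_powr prime_gt_0_nat mult.commute)
      finally show "(\<Prod>p\<in>S. (real p powr -s) ^ f p) = real (\<Prod>p\<in>S. p ^ f p) powr -s" ..
    qed
    also have "\<dots> = (\<Sum>n\<in>(\<lambda>f. \<Prod>p\<in>S. p ^ f p) ` (S \<rightarrow>\<^sub>E {..M}). real n powr -s)"
      by (subst sum.reindex[OF inj_on_prod_prime_powers[OF S]]) auto
    finally show ?thesis .
  qed
  have upper: "(\<Prod>p\<in>S. 1 / (1 - real p powr -s)) \<le> (\<Sum>n. real (Suc n) powr -s)"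
    if S: "finite S" "\<And>p. p \<in> S \<Longrightarrow> prime p" for S
  proof (rule tendsto_upperbound)
    show "(\<lambda>M. \<Prod>p\<in>S. \<Sum>m\<le>M. (real p powr -s) ^ m) \<longlonglongrightarrow> (\<Prod>p\<in>S. 1 / (1 - real p powr -s))"
      using S lt1
      by (intro tendsto_prod) (auto simp: sums_def_le[symmetric] intro!: geometric_sums less_imp_le)
    have "(\<Prod>p\<in>S. \<Sum>m\<le>M. (real p powr -s) ^ m) \<le> (\<Sum>n. real (Suc n) powr -s)" for M
    proof -
      let ?I = "(\<lambda>f. \<Prod>p\<in>S. p ^ f p) ` (S \<rightarrow>\<^sub>E {..M})"
      have fI: "finite ?I" using S by (intro finite_imageI finite_PiE) auto
      have pI: "n > 0" if "n \<in> ?I" for n using that S(1) S(2)[of 0] by (auto intro!: Nat.gr0I)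
      have "(\<Prod>p\<in>S. \<Sum>m\<le>M. (real p powr -s) ^ m) = (\<Sum>n\<in>?I. real n powr -s)"
        using S by (rule fin)
      also have "\<dots> = (\<Sum>n\<in>(\<lambda>n. n - 1) ` ?I. real (Suc n) powr -s)"
        using pI by (intro sum.reindex_bij_witness[of _ Suc "\<lambda>n. n - 1"]) force+
      also have "\<dots> \<le> (\<Sum>n. real (Suc n) powr -s)"
        using fI by (intro sum_le_suminf smz) auto
      finally show ?thesis .
    qed
    thus "\<forall>\<^sub>F M in sequentially. (\<Prod>p\<in>S. \<Sum>m\<le>M. (real p powr -s) ^ m) \<le> (\<Sum>n. real (Suc n) powr -s)"
      by simp
  qed auto
  have lower: "(\<Sum>n<N. real (Suc n) powr -s) \<le> (\<Prod>p | prime p \<and> p \<le> N. 1 / (1 - real p powr -s))" for N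
  proof -
    let ?S = "{p. prime p \<and> p \<le> N}"
    let ?I = "(\<lambda>f. \<Prod>p\<in>?S. p ^ f p) ` (?S \<rightarrow>\<^sub>E {..N})"
    have S: "finite ?S" "\<And>p. p \<in> ?S \<Longrightarrow> prime p" by auto
    have "n \<in> ?I" if n: "n \<in> {1..N}" for n
    proof
      define f where "f = restrict (\<lambda>p. multiplicity p n) ?S"
      have "n = (\<Prod>p\<in>prime_factors n. p ^ multiplicity p n)"
        using n by (intro prime_factorization_nat) auto
      also have "\<dots> = (\<Prod>p\<in>?S. p ^ multiplicity p n)"
        using n by (intro prod.mono_neutral_left)
          (auto simp: in_prime_factors_iff not_dvd_imp_multiplicity_0 dest!: dvd_imp_le)
      also have "\<dots> = (\<Prod>p\<in>?S. p ^ f p)" by (simp add: f_def)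
      finally show "n = (\<Prod>p\<in>?S. p ^ f p)" .
      have "multiplicity p n \<le> N" if "prime p" for p
      proof -
        have "p ^ multiplicity p n \<le> n" using n by (intro dvd_imp_le multiplicity_dvd) auto
        moreover have "multiplicity p n < p ^ multiplicity p n"
          using prime_gt_Suc_0_nat[OF that] by (rule power_gt_expt)
        ultimately show ?thesis using n by simp
      qed
      thus "f \<in> ?S \<rightarrow>\<^sub>E {..N}" by (auto simp: f_def)
    qed
    hence "(\<Sum>n\<in>{1..N}. real n powr -s) \<le> (\<Sum>n\<in>?I. real n powr -s)"
      by (intro sum_mono2) (auto intro!: finite_imageI finite_PiE)
    also have "\<dots> = (\<Prod>p\<in>?S. \<Sum>m\<le>N. (real p powr -s) ^ m)" using fin[OF S] by simp
    also have "\<dots> \<le> (\<Prod>p\<in>?S. 1 / (1 - real p powr -s))"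
    proof (intro prod_mono conjI sum_nonneg)
      fix p assume "p \<in> ?S"
      hence "(\<Sum>m\<le>N. (real p powr -s) ^ m) \<le> (\<Sum>m. (real p powr -s) ^ m)"
        using lt1[of p] by (intro sum_le_suminf summable_geometric) auto
      thus "(\<Sum>m\<le>N. (real p powr -s) ^ m) \<le> 1 / (1 - real p powr -s)"
        using lt1[of p] \<open>p \<in> ?S\<close> by (subst (asm) suminf_geometric) auto
    qed auto
    also have "(\<Sum>n\<in>{1..N}. real n powr -s) = (\<Sum>n<N. real (Suc n) powr - s)"
      by (rule sum.reindex_bij_witness[of _ Suc "\<lambda>n. n - 1"]) auto
    finally show ?thesis .
  qed
  have "(\<Prod>p | prime p \<and> p \<le> N. 1 / (1 - real p powr -s)) \<le> (\<Sum>n. real (Suc n) powr -s)" for N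
    by (rule upper) auto
  with lower show ?thesis
    by (intro tendsto_sandwich[OF _ _ summable_LIMSEQ[OF smz] tendsto_const] always_eventually allI)
qed

text \<open>\<open>D N\<close> consists of the terms p^(-sj) / j of the logarithm series with p
  \<le> N < p^j. It is therefore non-negative and, as p^-s \<le> 1 / p, dominated by prime power
  tails. At s = 1 both sums diverge and only their difference is controlled.\<close>

lemma sum_ln_euler_factor_bounds:
  assumes s: "s \<ge> (1 :: real)"
  defines "D \<equiv> \<lambda>N. (\<Sum>p | prime p \<and> p \<le> N. - ln (1 - real p powr -s)) -
                    (\<Sum>n=1..N. real n powr -s * mangoldt n / ln (real n))"
  shows "D N \<ge> 0" "D N \<le> (\<Sum>p | prime p \<and> p \<le> N. prime_power_tail (\<lambda>_. 1) N p)"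
proof -
  have *: "0 \<le> - ln (1 - real p powr -s) - (\<Sum>j | j \<in> {1..N} \<and> p ^ j \<le> N. real (p ^ j) powr -s / real j) \<and>
           - ln (1 - real p powr -s) - (\<Sum>j | j \<in> {1..N} \<and> p ^ j \<le> N. real (p ^ j) powr -s / real j)
             \<le> prime_power_tail (\<lambda>_. 1) N p"
    if p: "prime p" "p \<le> N" for p
  proof -
    define y where "y = real p powr -s"
    have p1: "p > Suc 0" using p prime_gt_Suc_0_nat by auto
    have y0: "y > 0" using p1 by (simp add: y_def)
    have y1: "y < 1" using p1 s by (simp add: y_def powr_less_one)
    have yp: "y \<le> 1 / real p"
      using powr_mono[of "-s" "-1" "real p"] p1 s by (simp add: y_def powr_minus_divide)
    have pow: "real (p ^ j) powr -s = y ^ j" for j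
      using p1 by (simp add: y_def powr_realpow [symmetric] powr_powr mult.commute)
    have "(\<lambda>n. - ((- (-y)) ^ n) / of_nat n) sums ln (1 + (-y))"
      using y0 y1 by (intro ln_series') auto
    from sums_minus[OF this] have 1: "(\<lambda>n. y ^ n / of_nat n) sums (- ln (1 - y))" by simp
    have eq: "{j. j \<in> {1..N} \<and> p ^ j \<le> N} = {j. p ^ j \<le> N} - {0}"
    proof -
      have "j \<le> N" if "p ^ j \<le> N" for j using power_gt_expt[OF p1, of j] that by linarith
      thus ?thesis by auto
    qed
    have fin: "finite {j. p ^ j \<le> N}"
    proof (rule finite_subset)
      show "{j. p ^ j \<le> N} \<subseteq> {..N}"
      proof
        fix j assume "j \<in> {j. p ^ j \<le> N}"
        thus "j \<in> {..N}" using power_gt_expt[OF p1, of j] by simp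
      qed
    qed simp
    have 2: "(\<lambda>j. if j \<in> {j. p ^ j \<le> N} then y ^ j / real j else 0) sums (\<Sum>j | p ^ j \<le> N. y ^ j / real j)"
      by (rule sums_If_finite_set) (fact fin)
    have 3: "(\<Sum>j | p ^ j \<le> N. y ^ j / real j) = (\<Sum>j | j \<in> {1..N} \<and> p ^ j \<le> N. y ^ j / real j)"
      unfolding eq by (rule sum.mono_neutral_right) (use fin in auto)
    have 4: "(\<lambda>j. if N < p ^ j then y ^ j / real j else 0) sums
               (- ln (1 - y) - (\<Sum>j | j \<in> {1..N} \<and> p ^ j \<le> N. y ^ j / real j))"
      using sums_diff[OF 1 2] unfolding 3 by (rule sums_cong[THEN iffD1, rotated]) auto
    have 5: "summable (\<lambda>m. if N < p ^ m then 1 / real (p ^ m) else 0)"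
      using summable_prime_power_tail[of "\<lambda>_. 1" p N] p by (simp add: powr_less_one summable_geometric)
    have "0 \<le> - ln (1 - y) - (\<Sum>j | j \<in> {1..N} \<and> p ^ j \<le> N. y ^ j / real j)"
      by (rule sums_le[OF _ sums_zero 4]) (use y0 in auto)
    moreover have "- ln (1 - y) - (\<Sum>j | j \<in> {1..N} \<and> p ^ j \<le> N. y ^ j / real j) \<le> prime_power_tail (\<lambda>_. 1) N p"
      unfolding prime_power_tail_def
    proof (rule sums_le[OF _ 4 summable_sums[OF 5]])
      fix j
      have "y ^ j / real j \<le> 1 / real (p ^ j)"
      proof (cases "j = 0")
        case False
        have "y ^ j / real j \<le> y ^ j / 1" using False y0 by (intro divide_left_mono) auto
        also have "\<dots> \<le> (1 / real p) ^ j / 1" using yp y0 by (intro divide_right_mono power_mono) auto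
        finally show ?thesis by (simp add: power_one_over)
      qed auto
      thus "(if N < p ^ j then y ^ j / real j else 0) \<le> (if N < p ^ j then 1 / real (p ^ j) else 0)" by auto
    qed
    ultimately show ?thesis unfolding pow unfolding y_def by blast
  qed
  have "D N = (\<Sum>p | prime p \<and> p \<le> N. - ln (1 - real p powr -s)) -
         (\<Sum>p | prime p \<and> p \<le> N. \<Sum>j | j \<in> {1..N} \<and> p ^ j \<le> N. real (p ^ j) powr -s / real j)"
    unfolding D_def using sum_mangoldt_eq_sum_prime_powers[of "\<lambda>n. real n powr -s" N] by simp
  hence D: "D N = (\<Sum>p | prime p \<and> p \<le> N. - ln (1 - real p powr -s) -
         (\<Sum>j | j \<in> {1..N} \<and> p ^ j \<le> N. real (p ^ j) powr -s / real j))"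
    by (simp only: sum_subtractf)
  show "D N \<ge> 0" unfolding D by (intro sum_nonneg) (use * in auto)
  show "D N \<le> (\<Sum>p | prime p \<and> p \<le> N. prime_power_tail (\<lambda>_. 1) N p)"
    unfolding D by (intro sum_mono) (use * in auto)
qed

lemma sum_ln_euler_factor_tendsto:
  assumes "s \<ge> (1 :: real)"
  shows "(\<lambda>N. (\<Sum>p | prime p \<and> p \<le> N. - ln (1 - real p powr -s)) -
              (\<Sum>n=1..N. real n powr -s * mangoldt n / ln (real n))) \<longlonglongrightarrow> 0"
  by (rule tendsto_sandwich[OF _ _ tendsto_const prime_power_tail_tendsto_0[of "\<lambda>_. 1"]])
     (use sum_ln_euler_factor_bounds[OF assms] in \<open>auto simp: powr_less_one summable_geometric\<close>)

text \<open>The logarithm of the Euler product, with the sum over primes exchanged for one over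
  prime powers by \<open>sum_ln_euler_factor_tendsto\<close>. The factor (n+1)^-d stays separate as
  a weight for \<open>abel_limit\<close>.\<close>

lemma ln_zeta_sums:
  assumes d: "d > (0 :: real)"
  shows "(\<lambda>n. mangoldt (Suc n) / (real (Suc n) * ln (real (Suc n))) * real (Suc n) powr -d) sums
           ln (\<Sum>n. real (Suc n) powr - (1 + d))"
proof -
  let ?Z = "\<Sum>n. real (Suc n) powr - (1 + d)"
  have sm: "summable (\<lambda>n. real (Suc n) powr - (1 + d))" by (rule zeta_near_one(1)[OF d])
  have "?Z > 0" by (intro suminf_pos sm) auto
  have *: "1 - real p powr - (1 + d) > 0" if "prime p" for p
    using prime_gt_1_nat[OF that] d by (auto simp: powr_less_one)
  hence **: "1 / (1 - real p powr - (1 + d)) \<noteq> 0" if "prime p" for p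
    using *[OF that] by simp
  have "(\<lambda>N. ln (\<Prod>p | prime p \<and> p \<le> N. 1 / (1 - real p powr - (1 + d)))) \<longlonglongrightarrow> ln ?Z"
    using \<open>?Z > 0\<close> euler_product_zeta[of "1 + d"] d by (intro tendsto_ln) auto
  also have "(\<lambda>N. ln (\<Prod>p | prime p \<and> p \<le> N. 1 / (1 - real p powr - (1 + d)))) =
             (\<lambda>N. \<Sum>p | prime p \<and> p \<le> N. - ln (1 - real p powr - (1 + d)))"
  proof
    fix N
    have "ln (\<Prod>p | prime p \<and> p \<le> N. 1 / (1 - real p powr - (1 + d))) =
          (\<Sum>p | prime p \<and> p \<le> N. ln (1 / (1 - real p powr - (1 + d))))"
      by (rule ln_prod) (use ** in \<open>auto simp only: mem_Collect_eq finite_Collect_conjI\<close>)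
    also have "\<dots> = (\<Sum>p | prime p \<and> p \<le> N. - ln (1 - real p powr - (1 + d)))"
      by (intro sum.cong refl) (use * in \<open>auto simp: ln_divide_pos\<close>)
    finally show "ln (\<Prod>p | prime p \<and> p \<le> N. 1 / (1 - real p powr - (1 + d))) = \<dots>" .
  qed
  finally have "(\<lambda>N. (\<Sum>p | prime p \<and> p \<le> N. - ln (1 - real p powr - (1 + d))) -
       ((\<Sum>p | prime p \<and> p \<le> N. - ln (1 - real p powr - (1 + d))) -
              (\<Sum>n=1..N. real n powr - (1 + d) * mangoldt n / ln (real n)))) \<longlonglongrightarrow> ln ?Z - 0"
    using d by (intro tendsto_diff sum_ln_euler_factor_tendsto) auto
  also have "(\<lambda>N. (\<Sum>p | prime p \<and> p \<le> N. - ln (1 - real p powr - (1 + d))) -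
       ((\<Sum>p | prime p \<and> p \<le> N. - ln (1 - real p powr - (1 + d))) -
              (\<Sum>n=1..N. real n powr - (1 + d) * mangoldt n / ln (real n)))) =
       (\<lambda>N. \<Sum>n<N. mangoldt (Suc n) / (real (Suc n) * ln (real (Suc n))) * real (Suc n) powr -d)"
  proof
    fix N
    have "(\<Sum>n=1..N. real n powr - (1 + d) * mangoldt n / ln (real n)) =
        (\<Sum>n<N. real (Suc n) powr - (1 + d) * mangoldt (Suc n) / ln (real (Suc n)))"
      by (rule sum.reindex_bij_witness[of _ Suc "\<lambda>n. n - 1"]) auto
    also have "\<dots> = (\<Sum>n<N. mangoldt (Suc n) / (real (Suc n) * ln (real (Suc n))) * real (Suc n) powr -d)"
    proof (intro sum.cong refl)
      fix n
      have "real (Suc n) powr - (1 + d) = real (Suc n) powr - 1 * real (Suc n) powr - d"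
        unfolding powr_add [symmetric] by simp
      also have "real (Suc n) powr - 1 = 1 / real (Suc n)" by (simp add: powr_minus_divide)
      finally show "real (Suc n) powr - (1 + d) * mangoldt (Suc n) / ln (real (Suc n)) =
          mangoldt (Suc n) / (real (Suc n) * ln (real (Suc n))) * real (Suc n) powr -d"
        by (simp add: mult_ac)
    qed
    finally show "(\<Sum>p | prime p \<and> p \<le> N. - ln (1 - real p powr - (1 + d))) -
       ((\<Sum>p | prime p \<and> p \<le> N. - ln (1 - real p powr - (1 + d))) -
              (\<Sum>n=1..N. real n powr - (1 + d) * mangoldt n / ln (real n))) = \<dots>"
      by simp
  qed
  finally show ?thesis by (simp add: sums_def)
qed

section \<open>The constant in Mertens' theorem\<close>

text \<open>
  The jumps of the harmonic numbers are placed at \<open>\<lceil>e\<^sup>m\<rceil>\<close>, so that the partial sums are asymptotic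
  to \<open>ln (ln N) + \<gamma>\<close>; comparing with a sequence of known Dirichlet series then identifies the
  constant in Mertens' theorem.
\<close>
definition harm_jump :: "nat \<Rightarrow> real" where
  "harm_jump n = (\<Sum>m | m \<in> {1..n} \<and> nat \<lceil>exp (real m)\<rceil> = n. 1 / real m)"

text \<open>Shows that the bound \<open>m \<le> n\<close> in \<open>harm_jump n\<close> excludes no
  \<open>m\<close> whose jump lies at \<open>n\<close>.\<close>

lemma le_nat_ceiling_exp: "m \<le> nat \<lceil>exp (real m)\<rceil>"
proof -
  have "1 + real m \<le> exp (real m)" by (rule exp_ge_add_one_self)
  also have "\<dots> \<le> of_int \<lceil>exp (real m)\<rceil>" by simp
  finally show ?thesis by linarith
qed

text \<open>Jump points do not coincide, since e^(m+1) \<ge> 2 e^m \<ge> e^m + 1.\<close>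

lemma nat_ceiling_exp_less: "nat \<lceil>exp (real m)\<rceil> < nat \<lceil>exp (real (Suc m))\<rceil>"
proof -
  have "exp (real (Suc m)) = exp 1 * exp (real m)" by (simp add: exp_add [symmetric] add.commute)
  also have "\<dots> \<ge> 2 * exp (real m)" using exp_ge_add_one_self[of 1] by (intro mult_right_mono) auto
  finally have "exp (real (Suc m)) \<ge> exp (real m) + 1"
    using one_le_exp_iff[of "real m"] by linarith
  moreover have "exp (real m) > 0" by simp
  ultimately show ?thesis by linarith
qed

text \<open>As N is an integer, the jump at the ceiling of e^m occurs up to N exactly when m \<le>
  ln N.\<close>

lemma sum_harm_jump: "(\<Sum>n=1..N. harm_jump n) = harm (nat \<lfloor>ln (real N)\<rfloor>)"
proof -
  have "(\<Sum>n=1..N. harm_jump n) =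
        (\<Sum>n=1..N. \<Sum>m | m \<in> {1..N} \<and> nat \<lceil>exp (real m)\<rceil> = n. 1 / real m)"
    unfolding harm_jump_def
  proof (intro sum.cong refl)
    fix n assume n: "n \<in> {1..N}"
    have "(m \<in> {1..n} \<and> nat \<lceil>exp (real m)\<rceil> = n) \<longleftrightarrow> (m \<in> {1..N} \<and> nat \<lceil>exp (real m)\<rceil> = n)" for m
      using n le_nat_ceiling_exp[of m] by (metis atLeastAtMost_iff order.trans)
    thus "{m. m \<in> {1..n} \<and> nat \<lceil>exp (real m)\<rceil> = n} = {m. m \<in> {1..N} \<and> nat \<lceil>exp (real m)\<rceil> = n}"
      by (simp only:)
  qed
  also have "\<dots> = (\<Sum>m=1..N. \<Sum>n | n \<in> {1..N} \<and> nat \<lceil>exp (real m)\<rceil> = n. 1 / real m)"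
    by (rule sum.swap_restrict) auto
  also have "\<dots> = (\<Sum>m=1..N. if nat \<lceil>exp (real m)\<rceil> \<le> N then 1 / real m else 0)"
  proof (intro sum.cong refl)
    fix m assume "m \<in> {1..N}"
    hence "nat \<lceil>exp (real m)\<rceil> \<ge> 1" using le_nat_ceiling_exp[of m] by simp
    hence "{n. n \<in> {1..N} \<and> nat \<lceil>exp (real m)\<rceil> = n} =
             (if nat \<lceil>exp (real m)\<rceil> \<le> N then {nat \<lceil>exp (real m)\<rceil>} else {})" by auto
    thus "(\<Sum>n | n \<in> {1..N} \<and> nat \<lceil>exp (real m)\<rceil> = n. 1 / real m) =
            (if nat \<lceil>exp (real m)\<rceil> \<le> N then 1 / real m else 0)" by simp
  qed
  also have "\<dots> = (\<Sum>m | m \<in> {1..N} \<and> nat \<lceil>exp (real m)\<rceil> \<le> N. 1 / real m)"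
    by (rule sum.inter_filter [symmetric]) auto
  also have "{m. m \<in> {1..N} \<and> nat \<lceil>exp (real m)\<rceil> \<le> N} = {1..nat \<lfloor>ln (real N)\<rfloor>}"
  proof (cases "N = 0")
    case False
    have "nat \<lceil>exp (real m)\<rceil> \<le> N \<longleftrightarrow> m \<le> nat \<lfloor>ln (real N)\<rfloor>" if "m \<ge> 1" for m
    proof -
      have "nat \<lceil>exp (real m)\<rceil> \<le> N \<longleftrightarrow> exp (real m) \<le> real N"
        by (simp add: nat_le_iff ceiling_le_iff)
      also have "\<dots> \<longleftrightarrow> real m \<le> ln (real N)" using False by (simp add: ln_ge_iff)
      also have "\<dots> \<longleftrightarrow> int m \<le> \<lfloor>ln (real N)\<rfloor>" by (simp add: le_floor_iff)
      also have "\<dots> \<longleftrightarrow> m \<le> nat \<lfloor>ln (real N)\<rfloor>" using that by linarith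
      finally show ?thesis .
    qed
    moreover have "m \<le> N" if "nat \<lceil>exp (real m)\<rceil> \<le> N" for m
      using le_nat_ceiling_exp[of m] that by linarith
    ultimately show ?thesis by auto
  qed auto
  finally show ?thesis by (simp add: harm_def divide_inverse)
qed

lemma sum_harm_jump_tendsto:
  "(\<lambda>N. (\<Sum>n=1..N. harm_jump n) - ln (ln (real N))) \<longlonglongrightarrow> euler_mascheroni"
proof -
  have "(\<lambda>N. harm (nat \<lfloor>ln (real N)\<rfloor>) - ln (real (nat \<lfloor>ln (real N)\<rfloor>))) \<longlonglongrightarrow> (euler_mascheroni :: real)"
  proof (rule filterlim_compose[OF euler_mascheroni_LIMSEQ])
    show "filterlim (\<lambda>N. nat \<lfloor>ln (real N)\<rfloor>) at_top sequentially"
      by (intro filterlim_compose[OF filterlim_nat_sequentially] filterlim_compose[OF filterlim_floor_sequentially]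
            filterlim_compose[OF ln_at_top] filterlim_real_sequentially)
  qed
  moreover have "(\<lambda>N. ln (real (nat \<lfloor>ln (real N)\<rfloor>)) - ln (ln (real N))) \<longlonglongrightarrow> 0"
  proof -
    have "((\<lambda>x::real. ln (real_of_int \<lfloor>x\<rfloor>) - ln x) \<longlongrightarrow> 0) at_top" by real_asymp
    hence "(\<lambda>N. ln (real_of_int \<lfloor>ln (real N)\<rfloor>) - ln (ln (real N))) \<longlonglongrightarrow> 0"
      by (rule filterlim_compose) real_asymp
    thus ?thesis
    proof (rule Lim_transform_eventually)
      show "\<forall>\<^sub>F N in sequentially. ln (real_of_int \<lfloor>ln (real N)\<rfloor>) - ln (ln (real N)) =
              ln (real (nat \<lfloor>ln (real N)\<rfloor>)) - ln (ln (real N))"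
        using eventually_ge_at_top[of 1] by eventually_elim (simp add: of_nat_nat)
    qed
  qed
  ultimately have "(\<lambda>N. (harm (nat \<lfloor>ln (real N)\<rfloor>) - ln (real (nat \<lfloor>ln (real N)\<rfloor>))) +
      (ln (real (nat \<lfloor>ln (real N)\<rfloor>)) - ln (ln (real N)))) \<longlonglongrightarrow> (euler_mascheroni + 0 :: real)"
    by (rule tendsto_add)
  thus ?thesis by (simp only: sum_harm_jump) simp
qed

text \<open>With e^m in place of its ceiling, the series is the sum of e^(-dm) / m, which equals -ln
  (1 - e^-d). Each rounding costs at most d e^-m, by 1 - d x \<le> (1 + x)^-d with x = e^-m.\<close>

lemma harm_jump_series:
  fixes d :: real
  assumes d: "d > 0"
  shows "\<exists>B. (\<lambda>n. harm_jump (Suc n) * real (Suc n) powr -d) sums B \<and>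
             \<bar>B + ln (1 - exp (-d))\<bar> \<le> d * (\<Sum>m. exp (- real m))"
proof -
  define e where "e = (\<lambda>m. nat \<lceil>exp (real m)\<rceil>)"
  have smono: "strict_mono e" unfolding e_def
    using nat_ceiling_exp_less by (simp add: strict_mono_Suc_iff)
  have e1: "e m \<ge> 1" for m unfolding e_def using one_le_exp_iff[of "real m"] by linarith
  have jump: "harm_jump (e m) = 1 / real m" for m
  proof (cases "m = 0")
    case False
    have "{m'. m' \<in> {1..e m} \<and> e m' = e m} = {m}"
      using False strict_mono_eq[OF smono] le_nat_ceiling_exp[of m] by (auto simp: e_def)
    thus ?thesis unfolding harm_jump_def e_def by simp
  next
    \<comment> \<open>The jumps start at m = 1, so there is none at \<open>e 0 = 1\<close>; this
      agrees with \<open>1 / real 0 = 0\<close>.\<close>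
    case True
    have "{m'. m' \<in> {1..e 0} \<and> e m' = e 0} = {}"
      using strict_mono_eq[OF smono] by auto
    thus ?thesis using True unfolding harm_jump_def e_def by simp
  qed
  \<comment> \<open>The range of \<open>g\<close> contains the support of
    \<open>harm_jump (Suc n)\<close>, so the full series is a reindexing of the sum over
    \<open>m\<close>.\<close>
  define g where "g = (\<lambda>m. e m - 1)"
  have Sg: "Suc (g m) = e m" for m using e1[of m] by (simp add: g_def)
  have gmono: "strict_mono g"
    by (rule strict_monoI) (use strict_monoD[OF smono] e1 in \<open>force simp: g_def intro!: diff_less_mono\<close>)
  have exs: "summable (\<lambda>m. exp (- real m))"
    using summable_geometric[of "exp (-1 :: real)"] by (simp add: exp_of_nat_mult [symmetric])
  define h where "h = (\<lambda>m. 1 / real m * exp (- d) ^ m)"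
  define k where "k = (\<lambda>m. 1 / real m * real (e m) powr -d)"
  have "(\<lambda>n. - ((- (- exp (-d))) ^ n) / of_nat n) sums ln (1 + (- exp (-d)))"
    using d by (intro ln_series') auto
  from sums_minus[OF this] have h: "h sums (- ln (1 - exp (-d)))" by (simp add: h_def)
  have diff: "0 \<le> h m - k m \<and> h m - k m \<le> d * exp (- real m)" for m
  proof (cases "m = 0")
    case False
    have ex: "exp (- d) ^ m = exp (real m) powr -d"
      by (simp add: powr_def exp_of_nat_mult [symmetric] mult.commute)
    have a: "exp (real m) \<le> real (e m)" "real (e m) \<le> exp (real m) + 1"
      unfolding e_def using exp_gt_zero[of "real m"] by linarith+
    have "real (e m) powr -d \<le> exp (real m) powr -d"
      using a d by (intro powr_mono2') auto
    moreover have "exp (real m) powr -d - real (e m) powr -d \<le> d * exp (- real m)"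
    proof -
      have "exp (real m) powr -d * (1 - d * exp (- real m)) \<le> exp (real m) powr -d * (1 + exp (- real m)) powr -d"
      proof (intro mult_left_mono)
        have "1 - d * exp (- real m) \<le> 1 - d * ln (1 + exp (- real m))"
          using d ln_add_one_self_le_self[of "exp (- real m)"] by simp
        also have "\<dots> \<le> exp (- d * ln (1 + exp (- real m)))"
          using exp_ge_add_one_self[of "- d * ln (1 + exp (- real m))"] by simp
        also have "\<dots> = (1 + exp (- real m)) powr -d"
        proof -
          have "1 + exp (- real m) \<noteq> 0" using exp_gt_zero[of "- real m"] by linarith
          thus ?thesis by (simp add: powr_def)
        qed
        finally show "1 - d * exp (- real m) \<le> (1 + exp (- real m)) powr -d" .
      qed auto
      also have "\<dots> = (exp (real m) + 1) powr -d"
        by (subst powr_mult [symmetric]) (auto simp: algebra_simps exp_minus intro: add_nonneg_nonneg)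
      also have "\<dots> \<le> real (e m) powr -d"
        using a d e1[of m] by (intro powr_mono2') auto
      finally have "exp (real m) powr -d - real (e m) powr -d \<le> exp (real m) powr -d * (d * exp (- real m))"
        by (simp add: algebra_simps)
      also have "\<dots> \<le> 1 * (d * exp (- real m))"
      proof (intro mult_right_mono)
        show "exp (real m) powr -d \<le> 1" using d by (simp add: powr_def)
      qed (use d in auto)
      finally show ?thesis by simp
    qed
    moreover have "h m - k m = (exp (real m) powr -d - real (e m) powr -d) / real m"
      by (simp add: h_def k_def ex diff_divide_distrib)
    moreover have "x / real m \<le> x" if "x \<ge> 0" for x
      using False that by (simp add: divide_le_eq mult_left_le_one_le mult_le_cancel_left1)
    ultimately show ?thesis using False by (smt (verit) divide_nonneg_nonneg of_nat_0_le_iff)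
  next
    case True
    thus ?thesis using d by (simp add: h_def k_def)
  qed
  have "summable (\<lambda>m. h m - k m)"
    by (rule summable_comparison_test'[OF summable_mult[OF exs, of d], of 0]) (use diff in auto)
  then obtain E where E: "(\<lambda>m. h m - k m) sums E" by (auto simp: summable_def)
  have E0: "E \<ge> 0" by (rule sums_le[OF _ sums_zero E]) (use diff in auto)
  have E1: "E \<le> d * (\<Sum>m. exp (- real m))"
    by (rule sums_le[OF _ E sums_mult[OF summable_sums[OF exs]]]) (use diff in auto)
  have "k sums (- ln (1 - exp (-d)) - E)" using sums_diff[OF h E] by simp
  also have "k = (\<lambda>m. harm_jump (Suc (g m)) * real (Suc (g m)) powr -d)"
    by (simp only: k_def Sg jump)
  finally have "(\<lambda>m. harm_jump (Suc (g m)) * real (Suc (g m)) powr -d) sums (- ln (1 - exp (-d)) - E)" .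
  moreover have "harm_jump (Suc n) * real (Suc n) powr -d = 0" if "n \<notin> range g" for n
  proof -
    have "e m \<noteq> Suc n" for m using that Sg[of m] by (metis diff_Suc_1 g_def rangeI)
    thus ?thesis unfolding harm_jump_def e_def by simp
  qed
  ultimately have "(\<lambda>n. harm_jump (Suc n) * real (Suc n) powr -d) sums (- ln (1 - exp (-d)) - E)"
    using sums_mono_reindex[OF gmono, of "\<lambda>n. harm_jump (Suc n) * real (Suc n) powr -d"] by blast
  thus ?thesis using E0 E1 by (intro exI[of _ "- ln (1 - exp (-d)) - E"]) auto
qed

text \<open>The limit \<open>K\<close> is known to exist, so \<open>c\<close> has the sum K - gamma,
  and by Abel's theorem this is the limit of the sum of c_n (n+1)^-d as d tends to 0. That sum is ln
  zeta(1+d) + ln (1 - e^-d) + O(d). The logarithmic singularities cancel, as d zeta(1+d) and (1 -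
  e^-d) / d tend to 1, hence K = gamma.\<close>

lemma mertens_constant:
  "(\<lambda>N. (\<Sum>n=1..N. mangoldt n / (real n * ln (real n))) - ln (ln (real N))) \<longlonglongrightarrow> euler_mascheroni"
proof -
  obtain K where K: "(\<lambda>N. (\<Sum>n=1..N. mangoldt n / (real n * ln (real n))) - ln (ln (real N))) \<longlonglongrightarrow> K"
    using sum_mangoldt_ln_convergent by blast
  define a :: "nat \<Rightarrow> real" where "a = (\<lambda>n. mangoldt (Suc n) / (real (Suc n) * ln (real (Suc n))))"
  define c where "c = (\<lambda>n. a n - harm_jump (Suc n))"
  have shift: "(\<Sum>n<N. f (Suc n)) = (\<Sum>n=1..N. f n)" for f :: "nat \<Rightarrow> real" and N
    by (rule sum.reindex_bij_witness[of _ "\<lambda>n. n - 1" Suc]) auto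
  have "c sums (K - euler_mascheroni)"
    unfolding sums_def c_def a_def sum_subtractf
      shift[of "\<lambda>n. mangoldt n / (real n * ln (real n))"] shift[of harm_jump]
    using tendsto_diff[OF K sum_harm_jump_tendsto] by simp
  hence c: "summable c" "suminf c = K - euler_mascheroni" by (auto simp: sums_iff)
  have lim: "((\<lambda>d. \<Sum>n. c n * real (Suc n) powr -d) \<longlongrightarrow> K - euler_mascheroni) (at_right 0)"
    unfolding c(2) [symmetric]
  proof (rule abel_limit[OF c(1)])
    show "\<forall>\<^sub>F d in at_right 0. (\<forall>n. real (Suc (Suc n)) powr -d \<le> real (Suc n) powr -d \<and> real (Suc n) powr -d \<ge> 0) \<and>
            real (Suc 0) powr -d \<le> 1"
      using eventually_at_right_less[of 0] by eventually_elim (auto intro!: powr_mono2')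
    show "((\<lambda>d. real (Suc n) powr -d) \<longlongrightarrow> 1) (at_right 0)" for n
      by (auto intro!: tendsto_eq_intros)
  qed
  define Z where "Z = (\<lambda>d. \<Sum>n. real (Suc n) powr - (1 + d))"
  define X where "X = (\<Sum>m. exp (- real m))"
  have "((\<lambda>d. \<Sum>n. c n * real (Suc n) powr -d) \<longlongrightarrow> 0) (at_right 0)"
  proof (rule Lim_null_comparison)
    have "((\<lambda>d. \<bar>ln (d * Z d)\<bar>) \<longlongrightarrow> \<bar>ln 1\<bar>) (at_right 0)"
      unfolding Z_def by (intro tendsto_intros zeta_near_one(2)) auto
    moreover have "((\<lambda>d::real. \<bar>ln (1 - exp (-d)) - ln d\<bar>) \<longlongrightarrow> 0) (at_right 0)"
      by real_asymp
    moreover have "((\<lambda>d::real. d * X) \<longlongrightarrow> 0) (at_right 0)"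
      by (auto intro!: tendsto_eq_intros)
    ultimately have "((\<lambda>d. \<bar>ln (d * Z d)\<bar> + \<bar>ln (1 - exp (-d)) - ln d\<bar> + d * X) \<longlongrightarrow> \<bar>ln 1\<bar> + 0 + 0) (at_right 0)"
      by (intro tendsto_add)
    thus "((\<lambda>d. \<bar>ln (d * Z d)\<bar> + \<bar>ln (1 - exp (-d)) - ln d\<bar> + d * X) \<longlongrightarrow> 0) (at_right 0)" by simp
    show "\<forall>\<^sub>F d in at_right 0. norm (\<Sum>n. c n * real (Suc n) powr -d) \<le>
             \<bar>ln (d * Z d)\<bar> + \<bar>ln (1 - exp (-d)) - ln d\<bar> + d * X"
      using eventually_at_right_less[of 0]
    proof eventually_elim
      case (elim d)
      obtain B where B: "(\<lambda>n. harm_jump (Suc n) * real (Suc n) powr -d) sums B"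
        "\<bar>B + ln (1 - exp (-d))\<bar> \<le> d * X"
        using harm_jump_series[OF elim] unfolding X_def by blast
      have "(\<lambda>n. a n * real (Suc n) powr -d) sums ln (Z d)"
        using ln_zeta_sums[OF elim] by (simp only: a_def Z_def)
      from sums_diff[OF this B(1)] have "(\<Sum>n. c n * real (Suc n) powr -d) = ln (Z d) - B"
        by (simp add: c_def left_diff_distrib sums_iff)
      moreover have "Z d > 0" unfolding Z_def by (intro suminf_pos zeta_near_one(1) elim) auto
      hence "ln (d * Z d) = ln d + ln (Z d)" using elim by (simp add: ln_mult)
      ultimately show ?case using B(2) unfolding real_norm_def by linarith
    qed
  qed
  with lim have "K - euler_mascheroni = 0"
    by (intro tendsto_unique[OF trivial_limit_at_right_real])
  with K show ?thesis by simp
qed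

theorem mertens_product:
  "(\<lambda>N. (\<Prod>p | prime p \<and> p \<le> N. 1 - 1 / real p) * (exp euler_mascheroni * ln (real N))) \<longlonglongrightarrow> 1"
proof -
  let ?A = "\<lambda>N. \<Sum>n=1..N. mangoldt n / (real n * ln (real n)) :: real"
  let ?D = "\<lambda>N. \<Sum>p | prime p \<and> p \<le> N. - ln (1 - 1 / real p)"
  have "(\<lambda>N. ?D N - ?A N) \<longlonglongrightarrow> 0"
    using sum_ln_euler_factor_tendsto[of 1] by (simp add: powr_minus_divide)
  from tendsto_add[OF this mertens_constant]
  have "(\<lambda>N. ?D N - ln (ln (real N))) \<longlonglongrightarrow> euler_mascheroni" by simp
  hence "(\<lambda>N. exp (euler_mascheroni - (?D N - ln (ln (real N))))) \<longlonglongrightarrow> exp (euler_mascheroni - euler_mascheroni)"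
    by (intro tendsto_intros)
  hence "(\<lambda>N. exp (euler_mascheroni - (?D N - ln (ln (real N))))) \<longlonglongrightarrow> 1" by simp
  thus ?thesis
  proof (rule Lim_transform_eventually)
    show "\<forall>\<^sub>F N in sequentially. exp (euler_mascheroni - (?D N - ln (ln (real N)))) =
            (\<Prod>p | prime p \<and> p \<le> N. 1 - 1 / real p) * (exp euler_mascheroni * ln (real N))"
      using eventually_gt_at_top[of 1]
    proof eventually_elim
      case (elim N)
      have "exp (- ?D N) = (\<Prod>p | prime p \<and> p \<le> N. exp (ln (1 - 1 / real p)))"
        by (subst exp_sum [symmetric]) (auto simp: sum_negf)
      also have "\<dots> = (\<Prod>p | prime p \<and> p \<le> N. 1 - 1 / real p)"
        by (intro prod.cong refl) (auto dest: prime_gt_1_nat)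
      finally have "exp (- ?D N) = \<dots>" .
      moreover have "exp (euler_mascheroni - (?D N - ln (ln (real N)))) =
          exp (- ?D N) * (exp euler_mascheroni * exp (ln (ln (real N))))"
        unfolding exp_add [symmetric] by (simp add: algebra_simps)
      ultimately show ?case using elim by simp
    qed
  qed
qed

section \<open>Mean values of almost periodic functions\<close>

lemma mean_cis:
  fixes w :: real
  defines "I \<equiv> \<lambda>T. if w = 0 then of_real T else (cis (w * (2 * T)) - cis (w * T)) / (\<i> * of_real w)"
  shows "T \<ge> 0 \<Longrightarrow> ((\<lambda>t. cis (w * t)) has_integral I T) {T..2 * T}"
    and "((\<lambda>T. I T / of_real T) \<longlongrightarrow> (if w = 0 then 1 else 0)) at_top"
proof -
  show "((\<lambda>t. cis (w * t)) has_integral I T) {T..2 * T}" if T: "T \<ge> 0"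
  proof (cases "w = 0")
    case True
    thus ?thesis using has_integral_const_real[of "1 :: complex" T "2 * T"] T
      by (simp add: I_def scaleR_conv_of_real)
  next
    case False
    have "((\<lambda>t. cis (w * t)) has_integral (cis (w * (2 * T)) / (\<i> * of_real w) - cis (w * T) / (\<i> * of_real w))) {T..2 * T}"
      using T False
      by (intro fundamental_theorem_of_calculus)
         (auto simp: cis_conv_exp field_simps intro!: derivative_eq_intros has_vector_derivative_real_field)
    thus ?thesis using False by (simp add: I_def diff_divide_distrib)
  qed
  show "((\<lambda>T. I T / of_real T) \<longlongrightarrow> (if w = 0 then 1 else 0)) at_top"
  proof (cases "w = 0")
    case True
    have "\<forall>\<^sub>F T in at_top. I T / of_real T = 1"
      using eventually_gt_at_top[of 0] by eventually_elim (simp add: I_def True)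
    thus ?thesis using True by (simp add: tendsto_eventually)
  next
    case False
    have "((\<lambda>T. I T / of_real T) \<longlongrightarrow> 0) at_top"
    proof (rule Lim_null_comparison)
      show "((\<lambda>T. 2 / \<bar>w\<bar> / T) \<longlongrightarrow> 0) at_top" using False by real_asymp
      show "\<forall>\<^sub>F T in at_top. norm (I T / of_real T) \<le> 2 / \<bar>w\<bar> / T"
        using eventually_gt_at_top[of 0]
      proof eventually_elim
        case (elim T)
        have "norm (cis (w * (2 * T)) - cis (w * T)) \<le> 2"
          using norm_triangle_ineq4[of "cis (w * (2 * T))" "cis (w * T)"] by simp
        thus ?case using elim False by (simp add: I_def norm_divide norm_mult divide_right_mono)
      qed
    qed
    thus ?thesis using False by simp
  qed
qed

text \<open>When the square is expanded, the off-diagonal terms oscillate with the non-zero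
  frequencies \<open>w a - w b\<close> and have mean 0.\<close>

lemma mean_square_trig_polynomial:
  fixes c :: "'a \<Rightarrow> complex" and w :: "'a \<Rightarrow> real"
  assumes fin: "finite B" and inj: "inj_on w B"
  shows "((\<lambda>T. 1 / T * integral {T..2 * T} (\<lambda>t. (norm (\<Sum>a\<in>B. c a * cis (w a * t)))\<^sup>2)) \<longlongrightarrow>
            (\<Sum>a\<in>B. (norm (c a))\<^sup>2)) at_top"
proof -
  define I where "I = (\<lambda>w T. if w = 0 then of_real T else (cis (w * (2 * T)) - cis (w * T)) / (\<i> * of_real w))"
  have sq: "(norm (\<Sum>a\<in>B. c a * cis (w a * t)))\<^sup>2 =
              Re (\<Sum>a\<in>B. \<Sum>b\<in>B. c a * cnj (c b) * cis ((w a - w b) * t))" for t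
  proof -
    have "of_real ((norm (\<Sum>a\<in>B. c a * cis (w a * t)))\<^sup>2) =
            (\<Sum>a\<in>B. c a * cis (w a * t)) * cnj (\<Sum>b\<in>B. c b * cis (w b * t))"
      by (rule complex_norm_square)
    also have "\<dots> = (\<Sum>a\<in>B. \<Sum>b\<in>B. (c a * cis (w a * t)) * (cnj (c b) * cis (- (w b * t))))"
      by (simp add: sum_product cis_cnj)
    also have "\<dots> = (\<Sum>a\<in>B. \<Sum>b\<in>B. c a * cnj (c b) * cis ((w a - w b) * t))"
    proof (intro sum.cong refl)
      fix a b
      have "cis ((w a - w b) * t) = cis (w a * t) * cis (- (w b * t))"
        by (simp add: cis_mult algebra_simps)
      thus "(c a * cis (w a * t)) * (cnj (c b) * cis (- (w b * t))) = c a * cnj (c b) * cis ((w a - w b) * t)"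
        by (simp add: mult_ac)
    qed
    finally show ?thesis by (metis Re_complex_of_real)
  qed
  have int: "1 / T * integral {T..2 * T} (\<lambda>t. (norm (\<Sum>a\<in>B. c a * cis (w a * t)))\<^sup>2) =
               Re (\<Sum>a\<in>B. \<Sum>b\<in>B. c a * cnj (c b) * (I (w a - w b) T / of_real T))" if T: "T > 0" for T
  proof -
    have "((\<lambda>t. \<Sum>a\<in>B. \<Sum>b\<in>B. c a * cnj (c b) * cis ((w a - w b) * t)) has_integral
            (\<Sum>a\<in>B. \<Sum>b\<in>B. c a * cnj (c b) * I (w a - w b) T)) {T..2 * T}"
      unfolding I_def by (intro has_integral_sum fin has_integral_mult_right mean_cis(1)) (use T in auto)
    from has_integral_linear[OF this bounded_linear_Re]
    have "integral {T..2 * T} (\<lambda>t. (norm (\<Sum>a\<in>B. c a * cis (w a * t)))\<^sup>2) =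
            Re (\<Sum>a\<in>B. \<Sum>b\<in>B. c a * cnj (c b) * I (w a - w b) T)"
      unfolding sq by (simp add: o_def integral_unique)
    also have "1 / T * \<dots> = Re (of_real (1 / T) * (\<Sum>a\<in>B. \<Sum>b\<in>B. c a * cnj (c b) * I (w a - w b) T))"
      by (simp del: of_real_divide)
    also have "of_real (1 / T) * (\<Sum>a\<in>B. \<Sum>b\<in>B. c a * cnj (c b) * I (w a - w b) T) =
                (\<Sum>a\<in>B. \<Sum>b\<in>B. c a * cnj (c b) * (I (w a - w b) T / of_real T))"
      by (simp add: sum_distrib_left mult_ac)
    finally show ?thesis .
  qed
  have "((\<lambda>T. Re (\<Sum>a\<in>B. \<Sum>b\<in>B. c a * cnj (c b) * (I (w a - w b) T / of_real T))) \<longlongrightarrow>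
          Re (\<Sum>a\<in>B. \<Sum>b\<in>B. c a * cnj (c b) * (if w a - w b = 0 then 1 else 0))) at_top"
    unfolding I_def by (intro tendsto_intros mean_cis(2))
  also have "(\<Sum>a\<in>B. \<Sum>b\<in>B. c a * cnj (c b) * (if w a - w b = 0 then 1 else 0)) =
             (\<Sum>a\<in>B. \<Sum>b\<in>B. if a = b then c a * cnj (c a) else 0)"
    using inj by (intro sum.cong refl) (auto dest: inj_onD)
  also have "\<dots> = of_real (\<Sum>a\<in>B. (norm (c a))\<^sup>2)"
    using fin by (simp add: complex_norm_square del: of_real_power)
  finally have lim: "((\<lambda>T. Re (\<Sum>a\<in>B. \<Sum>b\<in>B. c a * cnj (c b) * (I (w a - w b) T / of_real T))) \<longlongrightarrow>
          (\<Sum>a\<in>B. (norm (c a))\<^sup>2)) at_top" by simp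
  show ?thesis
    by (rule Lim_transform_eventually[OF lim], rule eventually_mono[OF eventually_gt_at_top[of 0]])
       (simp only: int)
qed

text \<open>By absolute convergence the finite subsums converge uniformly in \<open>t\<close>, hence
  their mean squares converge uniformly in T > 0. This allows the limits over finite subsets and
  over \<open>T\<close> to be exchanged.\<close>

lemma mean_square_trig_series:
  fixes c :: "'a \<Rightarrow> complex" and w :: "'a \<Rightarrow> real"
  assumes sm: "(\<lambda>a. norm (c a)) summable_on A" and inj: "inj_on w A"
  shows "((\<lambda>T. 1 / T * integral {T..2 * T} (\<lambda>t. (norm (\<Sum>\<^sub>\<infinity>a\<in>A. c a * cis (w a * t)))\<^sup>2)) \<longlongrightarrow>
            (\<Sum>\<^sub>\<infinity>a\<in>A. (norm (c a))\<^sup>2)) at_top"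
proof -
  define F where "F = (\<lambda>t. \<Sum>\<^sub>\<infinity>a\<in>A. c a * cis (w a * t))"
  define FB where "FB = (\<lambda>B t. \<Sum>a\<in>B. c a * cis (w a * t))"
  define C where "C = (\<Sum>\<^sub>\<infinity>a\<in>A. norm (c a))"
  let ?U = "finite_subsets_at_top A"
  have C0: "C \<ge> 0" unfolding C_def by (rule infsum_nonneg) auto
  have FBsm: "(\<lambda>a. norm (c a * cis (w a * t))) summable_on A" for t
    using sm by (simp add: norm_mult)
  have FBC: "norm (FB B t) \<le> C" if "finite B" "B \<subseteq> A" for B t
  proof -
    have "norm (FB B t) \<le> (\<Sum>a\<in>B. norm (c a))"
      unfolding FB_def by (rule sum_norm_le) (simp add: norm_mult)
    also have "\<dots> \<le> C" unfolding C_def by (rule finite_sum_le_infsum[OF sm that]) auto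
    finally show ?thesis .
  qed
  have FC: "norm (F t) \<le> C" for t
    unfolding F_def C_def using norm_infsum_bound[OF FBsm[of t]] by (simp add: norm_mult)
  have uF: "uniform_limit UNIV FB F ?U"
    unfolding FB_def F_def
    by (rule Weierstrass_m_test_general[where M = "\<lambda>a. norm (c a)"]) (use sm in \<open>auto simp: norm_mult\<close>)
  have contB: "continuous_on UNIV (FB B)" for B
    unfolding FB_def by (intro continuous_intros)
  have contF: "continuous_on UNIV F"
    by (rule uniform_limit_theorem[OF _ uF]) (auto intro!: always_eventually contB)
  have sqsm: "(\<lambda>a. (norm (c a))\<^sup>2) summable_on A"
  proof (rule summable_on_comparison_test)
    show "(\<lambda>a. C * norm (c a)) summable_on A" by (rule summable_on_cmult_right) (fact sm)
    fix a assume a: "a \<in> A"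
    have "norm (c a) \<le> C" using finite_sum_le_infsum[OF sm, of "{a}"] a by (simp add: C_def)
    thus "(norm (c a))\<^sup>2 \<le> C * norm (c a)"
      by (simp add: power2_eq_square mult_right_mono)
    show "0 \<le> (norm (c a))\<^sup>2" by simp
  qed
  have F_eq: "F t = (\<Sum>\<^sub>\<infinity>a\<in>A. c a * cis (w a * t))" for t by (simp add: F_def)
  show ?thesis
    unfolding F_eq [symmetric]
  proof (rule swap_uniform_limit'[where F = ?U and S = "{0<..}" and
      f = "\<lambda>B T. 1 / T * integral {T..2 * T} (\<lambda>t. (norm (FB B t))\<^sup>2)" and g = "\<lambda>B. \<Sum>a\<in>B. (norm (c a))\<^sup>2"])
    show "\<forall>\<^sub>F B in ?U. ((\<lambda>T. 1 / T * integral {T..2 * T} (\<lambda>t. (norm (FB B t))\<^sup>2)) \<longlongrightarrow> (\<Sum>a\<in>B. (norm (c a))\<^sup>2)) at_top"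
    proof (rule eventually_finite_subsets_at_top_weakI)
      fix B assume "finite B" "B \<subseteq> A"
      thus "((\<lambda>T. 1 / T * integral {T..2 * T} (\<lambda>t. (norm (FB B t))\<^sup>2)) \<longlongrightarrow> (\<Sum>a\<in>B. (norm (c a))\<^sup>2)) at_top"
        unfolding FB_def
        by (intro mean_square_trig_polynomial) (auto intro: inj_on_subset[OF inj])
    qed
    show "((\<lambda>B. \<Sum>a\<in>B. (norm (c a))\<^sup>2) \<longlongrightarrow> (\<Sum>\<^sub>\<infinity>a\<in>A. (norm (c a))\<^sup>2)) ?U"
      using has_sum_infsum[OF sqsm] by (simp add: has_sum_def)
    show "uniform_limit {0<..} (\<lambda>B T. 1 / T * integral {T..2 * T} (\<lambda>t. (norm (FB B t))\<^sup>2))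
           (\<lambda>T. 1 / T * integral {T..2 * T} (\<lambda>t. (norm (F t))\<^sup>2)) ?U"
    proof (rule uniform_limitI)
      fix e :: real assume e: "e > 0"
      \<comment> \<open>Chosen for the bound (a + b) |a - b| \<le> 2 C e' on the difference of two
        squares; the summand 1 covers C = 0.\<close>
      define e' where "e' = e / (2 * C + 1)"
      have e': "e' > 0" using e C0 by (simp add: e'_def)
      have "\<forall>\<^sub>F B in ?U. finite B \<and> B \<subseteq> A"
        by (rule eventually_finite_subsets_at_top_weakI) auto
      with uniform_limitD[OF uF e']
      show "\<forall>\<^sub>F B in ?U. \<forall>T\<in>{0<..}. dist (1 / T * integral {T..2 * T} (\<lambda>t. (norm (FB B t))\<^sup>2))
              (1 / T * integral {T..2 * T} (\<lambda>t. (norm (F t))\<^sup>2)) < e"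
      proof eventually_elim
        case (elim B)
        show ?case
        proof
          fix T :: real assume "T \<in> {0<..}"
          hence T: "T > 0" by simp
          have ptw: "\<bar>(norm (FB B t))\<^sup>2 - (norm (F t))\<^sup>2\<bar> \<le> e' * (2 * C)" for t
          proof -
            have "(norm (FB B t))\<^sup>2 - (norm (F t))\<^sup>2 = (norm (FB B t) - norm (F t)) * (norm (FB B t) + norm (F t))"
              by (simp add: power2_eq_square algebra_simps)
            moreover have "\<bar>norm (FB B t) - norm (F t)\<bar> \<le> e'"
              using norm_triangle_ineq3[of "FB B t" "F t"] elim(1)[rule_format, of t] by (simp add: dist_norm)
            moreover have "\<bar>norm (FB B t) + norm (F t)\<bar> \<le> 2 * C"
              using FBC[of B t] FC[of t] elim(2) by simp
            ultimately show ?thesis using e' by (simp only: abs_mult) (intro mult_mono, auto)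
          qed
          have cB: "continuous_on {T..2 * T} (\<lambda>t. (norm (FB B t))\<^sup>2)"
            by (intro continuous_intros continuous_on_subset[OF contB]) auto
          have cF: "continuous_on {T..2 * T} (\<lambda>t. (norm (F t))\<^sup>2)"
            by (intro continuous_intros continuous_on_subset[OF contF]) auto
          have "integral {T..2 * T} (\<lambda>t. (norm (FB B t))\<^sup>2) - integral {T..2 * T} (\<lambda>t. (norm (F t))\<^sup>2) =
                integral {T..2 * T} (\<lambda>t. (norm (FB B t))\<^sup>2 - (norm (F t))\<^sup>2)"
            by (rule integral_diff [symmetric]) (intro integrable_continuous_real cB cF)+
          also have "norm \<dots> \<le> e' * (2 * C) * (2 * T - T)"
            by (rule integral_bound) (use T ptw in \<open>auto intro!: continuous_on_diff cB cF\<close>)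
          finally have "\<bar>integral {T..2 * T} (\<lambda>t. (norm (FB B t))\<^sup>2) - integral {T..2 * T} (\<lambda>t. (norm (F t))\<^sup>2)\<bar>
                \<le> e' * (2 * C) * T" by simp
          hence "dist (1 / T * integral {T..2 * T} (\<lambda>t. (norm (FB B t))\<^sup>2))
              (1 / T * integral {T..2 * T} (\<lambda>t. (norm (F t))\<^sup>2)) \<le> e' * (2 * C)"
            using T by (simp add: dist_real_def diff_divide_distrib [symmetric] abs_divide divide_le_eq)
          also have "\<dots> < e' * (2 * C + 1)" using e' by simp
          also have "\<dots> = e" using C0 by (simp add: e'_def)
          finally show "dist (1 / T * integral {T..2 * T} (\<lambda>t. (norm (FB B t))\<^sup>2))
              (1 / T * integral {T..2 * T} (\<lambda>t. (norm (F t))\<^sup>2)) < e" .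
        qed
      qed
    qed
    show "\<forall>\<^sub>F T in at_top. T \<in> {0::real<..}" by (simp add: eventually_gt_at_top)
  qed auto
qed

text \<open>A finite set of exponent functions lies in a box
  \<open>S \<rightarrow>\<^sub>E {..M}\<close>, on which a product of partial sums expands exactly.
  This bounds all finite subsums of the norms by the product of the full sums.\<close>

lemma
  fixes c :: "'a \<Rightarrow> nat \<Rightarrow> 'b :: {banach, real_normed_div_algebra, comm_semiring_1}"
  assumes fin: "finite S" and sm: "\<And>p. p \<in> S \<Longrightarrow> summable (\<lambda>m. norm (c p m))"
  shows abs_summable_on_prod_PiE: "(\<lambda>f. norm (\<Prod>p\<in>S. c p (f p))) summable_on (S \<rightarrow>\<^sub>E UNIV)"
    and infsum_prod_PiE_suminf: "(\<Sum>\<^sub>\<infinity>f\<in>S \<rightarrow>\<^sub>E UNIV. \<Prod>p\<in>S. c p (f p)) = (\<Prod>p\<in>S. \<Sum>m. c p m)"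
proof -
  show "(\<lambda>f. norm (\<Prod>p\<in>S. c p (f p))) summable_on (S \<rightarrow>\<^sub>E UNIV)"
  proof (rule nonneg_bdd_above_summable_on)
    show "bdd_above (sum (\<lambda>f. norm (\<Prod>p\<in>S. c p (f p))) ` {P. P \<subseteq> S \<rightarrow>\<^sub>E UNIV \<and> finite P})"
    proof (rule bdd_aboveI2)
      fix P assume "P \<in> {P. P \<subseteq> S \<rightarrow>\<^sub>E (UNIV :: nat set) \<and> finite P}"
      hence P: "P \<subseteq> S \<rightarrow>\<^sub>E UNIV" "finite P" by auto
      have "finite (\<Union>f\<in>P. f ` S)" using P fin by auto
      then obtain M where "\<And>m. m \<in> (\<Union>f\<in>P. f ` S) \<Longrightarrow> m \<le> M"
        unfolding finite_nat_set_iff_bounded_le by blast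
      hence M: "\<And>f p. f \<in> P \<Longrightarrow> p \<in> S \<Longrightarrow> f p \<le> M" by blast
      have "(\<Sum>f\<in>P. norm (\<Prod>p\<in>S. c p (f p))) \<le> (\<Sum>f\<in>S \<rightarrow>\<^sub>E {..M}. norm (\<Prod>p\<in>S. c p (f p)))"
        using P M fin by (intro sum_mono2 finite_PiE) (auto simp: PiE_iff subset_iff)
      also have "\<dots> = (\<Prod>p\<in>S. \<Sum>m\<le>M. norm (c p m))"
        using fin by (simp add: prod_norm [symmetric] prod_sum_PiE)
      also have "\<dots> \<le> (\<Prod>p\<in>S. \<Sum>m. norm (c p m))"
        using sm by (intro prod_mono conjI sum_nonneg sum_le_suminf) auto
      finally show "(\<Sum>f\<in>P. norm (\<Prod>p\<in>S. c p (f p))) \<le> (\<Prod>p\<in>S. \<Sum>m. norm (c p m))" .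
    qed
  qed auto
  have hs: "(c p has_sum (\<Sum>m. c p m)) UNIV" if "p \<in> S" for p
    using norm_summable_imp_has_sum[OF sm[OF that]] summable_sums[OF summable_norm_cancel[OF sm[OF that]]] by blast
  have "(\<Sum>\<^sub>\<infinity>f\<in>S \<rightarrow>\<^sub>E UNIV. \<Prod>p\<in>S. c p (f p)) = (\<Prod>p\<in>S. infsum (c p) UNIV)"
    using fin sm by (intro infsum_prod_PiE_abs norm_summable_imp_summable_on) auto
  also have "\<dots> = (\<Prod>p\<in>S. \<Sum>m. c p m)"
    using hs by (intro prod.cong refl infsumI)
  finally show "(\<Sum>\<^sub>\<infinity>f\<in>S \<rightarrow>\<^sub>E UNIV. \<Prod>p\<in>S. c p (f p)) = (\<Prod>p\<in>S. \<Sum>m. c p m)" .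
qed

section \<open>Power series with prescribed logarithmic derivative\<close>

text \<open>The ratio test, as consecutive binomial coefficients have quotient (m + 1) / (m + k +
  1). This supplies convergence wherever coefficients at prime powers are bounded by binomial
  coefficients.\<close>

lemma summable_choose_power:
  fixes r :: real
  assumes "\<bar>r\<bar> < 1"
  shows "summable (\<lambda>m. real (m + k choose k) ^ j * r ^ m)"
proof (rule summable_in_conv_radius)
  have "conv_radius (\<lambda>m. real (m + k choose k) ^ j) = 1"
  proof (rule conv_radius_ratio_limit_nonzero)
    have "norm (real (m + k choose k) ^ j) / norm (real (Suc m + k choose k) ^ j) =
            ((real m + 1) / (real m + real k + 1)) ^ j" for m
    proof -
      have "Suc m * (Suc m + k choose k) = (Suc m + k) * (m + k choose k)"
        using binomial_absorb_comp[of "Suc m + k" k] by simp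
      hence "(real m + 1) * real (Suc m + k choose k) = (real m + real k + 1) * real (m + k choose k)"
        unfolding of_nat_eq_iff[where ?'a = real, symmetric] of_nat_mult by (simp add: add_ac)
      moreover have "(Suc m + k choose k) > 0" by simp
      ultimately have "real (m + k choose k) / real (Suc m + k choose k) = (real m + 1) / (real m + real k + 1)"
        by (simp add: field_simps)
      thus ?thesis by (simp add: power_divide [symmetric])
    qed
    moreover have "(\<lambda>m. ((real m + 1) / (real m + real k + 1)) ^ j) \<longlonglongrightarrow> 1 ^ j"
      by (intro tendsto_power) real_asymp
    ultimately show "(\<lambda>m. norm (real (m + k choose k) ^ j) / norm (real (Suc m + k choose k) ^ j)) \<longlonglongrightarrow> 1"
      by simp
  qed auto
  thus "ereal (norm r) < conv_radius (\<lambda>m. real (m + k choose k) ^ j)" using assms by simp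
qed

text \<open>The formal solution of F' = B F with constant term 1. The coefficients of the
  L-functions and of \<open>P_prod\<close> at prime powers are both put into this form, which makes
  them comparable.\<close>

definition fps_of_log_deriv :: "complex fps \<Rightarrow> complex fps" where
  "fps_of_log_deriv B = fps_exp 1 oo fps_integral0 B"

lemma fps_of_log_deriv_0 [simp]: "fps_of_log_deriv B $ 0 = 1"
  by (simp add: fps_of_log_deriv_def)

lemma fps_deriv_of_log_deriv: "fps_deriv (fps_of_log_deriv B) = B * fps_of_log_deriv B"
  by (simp add: fps_of_log_deriv_def fps_compose_deriv fps_deriv_fps_integral mult.commute)

lemma fps_log_deriv_nth_Suc:
  fixes F :: "complex fps"
  assumes "fps_deriv F = B * F"
  shows "of_nat (Suc m) * F $ Suc m = (\<Sum>i\<le>m. B $ i * F $ (m - i))"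
proof -
  have "of_nat (Suc m) * F $ Suc m = (B * F) $ m" by (simp flip: assms add: fps_deriv_nth)
  thus ?thesis by (simp add: fps_mult_nth atMost_atLeast0)
qed

text \<open>By the recursion, the coefficient of index \<open>m\<close> depends only on the constant
  term and on the entries of \<open>B\<close> below \<open>m\<close>. A truncation of
  \<open>B\<close> from \<open>n\<close> onwards is thus invisible up to index
  \<open>n\<close>.\<close>

lemma fps_log_deriv_agree:
  fixes F G :: "complex fps"
  assumes F: "fps_deriv F = B * F" and G: "fps_deriv G = C * G" and 0: "F $ 0 = G $ 0"
    and eq: "\<And>i. i < n \<Longrightarrow> B $ i = C $ i" and m: "m \<le> n"
  shows "F $ m = G $ m"
  using m
proof (induction m rule: less_induct)
  case (less m)
  show ?case
  proof (cases m)
    case (Suc k)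
    have "of_nat (Suc k) * F $ Suc k = of_nat (Suc k) * G $ Suc k"
      unfolding fps_log_deriv_nth_Suc[OF F] fps_log_deriv_nth_Suc[OF G]
      using less Suc eq by (intro sum.cong) auto
    thus ?thesis using Suc by (simp del: of_nat_Suc)
  qed (use 0 in auto)
qed

text \<open>The majorant is (1 - z)^-(k+1), whose logarithmic derivative (k + 1) / (1 - z) dominates
  \<open>B\<close>. The exponent k + 1 instead of k avoids the index k - 1 when k = 0.\<close>

lemma norm_fps_log_deriv_le:
  fixes F :: "complex fps"
  assumes F: "fps_deriv F = B * F" and 0: "F $ 0 = 1" and B: "\<And>i. norm (B $ i) \<le> real k"
  shows "norm (F $ m) \<le> real (m + k choose k)"
proof (induction m rule: less_induct)
  case (less m)
  show ?case
  proof (cases m)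
    case (Suc n)
    have "real (Suc n) * norm (F $ Suc n) = norm (\<Sum>i\<le>n. B $ i * F $ (n - i))"
      unfolding fps_log_deriv_nth_Suc[OF F, symmetric] by (simp add: norm_mult del: of_nat_Suc)
    also have "\<dots> \<le> (\<Sum>i\<le>n. real k * real (n - i + k choose k))"
    proof (rule sum_norm_le)
      fix i assume "i \<in> {..n}"
      have "norm (F $ (n - i)) \<le> real (n - i + k choose k)" using less[of "n - i"] Suc by simp
      thus "norm (B $ i * F $ (n - i)) \<le> real k * real (n - i + k choose k)"
        unfolding norm_mult using B[of i] by (intro mult_mono) auto
    qed
    also have "\<dots> = real k * real (\<Sum>i\<le>n. k + i choose k)"
    proof -
      have "(\<Sum>i\<le>n. n - i + k choose k) = (\<Sum>i\<le>n. k + i choose k)"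
        by (rule sum.reindex_bij_witness[of _ "\<lambda>i. n - i" "\<lambda>i. n - i"]) (auto simp: add.commute)
      thus ?thesis by (simp only: sum_distrib_left [symmetric] of_nat_sum [symmetric])
    qed
    \<comment> \<open>Here k is enlarged to k + 1, the value for which the absorption identity
      closes the induction exactly.\<close>
    also have "\<dots> \<le> real (Suc k * (n + k + 1 choose Suc k))"
      unfolding choose_rising_sum(1) by (simp add: add_ac algebra_simps)
    also have "Suc k * (n + k + 1 choose Suc k) = Suc n * (n + k + 1 choose k)"
      using binomial_absorption[of k "n + k + 1"] binomial_absorb_comp[of "n + k + 1" k] by simp
    finally have "real (Suc n) * norm (F $ Suc n) \<le> real (Suc n) * real (n + k + 1 choose k)"
      by (simp only: of_nat_mult)
    hence "norm (F $ Suc n) \<le> real (n + k + 1 choose k)"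
      by (rule mult_left_le_imp_le) simp
    thus ?thesis using Suc by simp
  qed (use 0 in auto)
qed

lemma fps_conv_radius_ge_1:
  fixes F :: "complex fps"
  assumes "\<And>m. norm (F $ m) \<le> real (m + k choose k)"
  shows "fps_conv_radius F \<ge> 1"
  unfolding fps_conv_radius_def
proof (rule conv_radius_geI_ex')
  fix r :: real assume r: "0 < r" "ereal r < 1"
  show "summable (\<lambda>m. F $ m * of_real r ^ m)"
  proof (rule summable_comparison_test')
    show "summable (\<lambda>m. real (m + k choose k) ^ 1 * r ^ m)"
      using r by (intro summable_choose_power) (auto simp: one_ereal_def)
    show "norm (F $ m * of_real r ^ m) \<le> real (m + k choose k) ^ 1 * r ^ m" for m
      using r assms[of m] by (simp add: norm_mult norm_power mult_right_mono)
  qed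
qed

text \<open>The power series and \<open>h\<close> solve the same linear differential equation with
  value 1 at 0, so their quotient is constant on the unit disc.\<close>

lemma fps_log_deriv_sums:
  fixes F :: "complex fps" and h :: "complex \<Rightarrow> complex"
  assumes F: "fps_deriv F = B * F" and 0: "F $ 0 = 1" and B: "\<And>i. norm (B $ i) \<le> real k"
    and h0: "h 0 = 1" and nz: "\<And>z. norm z < 1 \<Longrightarrow> h z \<noteq> 0"
    and h: "\<And>z. norm z < 1 \<Longrightarrow> (h has_field_derivative eval_fps B z * h z) (at z)"
    and z: "norm z < 1"
  shows "(\<lambda>m. F $ m * z ^ m) sums h z"
proof -
  have F1: "fps_conv_radius F \<ge> 1"
    by (rule fps_conv_radius_ge_1) (rule norm_fps_log_deriv_le[OF F 0 B])
  have B1: "fps_conv_radius B \<ge> 1"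
    unfolding fps_conv_radius_def
  proof (rule conv_radius_geI_ex')
    fix r :: real assume r: "0 < r" "ereal r < 1"
    show "summable (\<lambda>m. B $ m * of_real r ^ m)"
    proof (rule summable_comparison_test')
      show "summable (\<lambda>m. real k * r ^ m)" using r by (intro summable_mult summable_geometric) (auto simp: one_ereal_def)
      show "norm (B $ m * of_real r ^ m) \<le> real k * r ^ m" for m
        using r B[of m] by (simp add: norm_mult norm_power mult_right_mono)
    qed
  qed
  have in_F: "ereal (norm w) < fps_conv_radius F" "ereal (norm w) < fps_conv_radius B" if "norm w < 1" for w
  proof -
    have "ereal (norm w) < 1" using that by (simp add: one_ereal_def)
    thus "ereal (norm w) < fps_conv_radius F" "ereal (norm w) < fps_conv_radius B"
      using F1 B1 by (blast intro: less_le_trans)+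
  qed
  define g where "g = (\<lambda>w. eval_fps F w / h w)"
  have "(g has_field_derivative 0) (at w within ball 0 1)" if "w \<in> ball 0 1" for w
  proof -
    have w: "norm w < 1" using that by simp
    have "(eval_fps F has_field_derivative eval_fps B w * eval_fps F w) (at w)"
      using has_field_derivative_eval_fps[of w F UNIV] in_F[OF w] w by (simp add: F eval_fps_mult)
    from DERIV_divide[OF this h[OF w] nz[OF w]]
    have "(g has_field_derivative 0) (at w)" by (simp add: g_def mult_ac)
    thus ?thesis by (rule has_field_derivative_at_within)
  qed
  from has_field_derivative_zero_constant[OF convex_ball this]
  obtain c where c: "\<And>w. w \<in> ball 0 1 \<Longrightarrow> g w = c" by auto
  have "c = 1" using c[of 0] h0 0 by (simp add: g_def eval_fps_at_0)
  hence "eval_fps F z = h z" using c[of z] z nz[OF z] by (simp add: g_def field_simps)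
  thus ?thesis using sums_eval_fps[of z F] in_F(1)[OF z] by simp
qed

lemma has_field_derivative_prod_power:
  fixes f :: "'i \<Rightarrow> complex \<Rightarrow> complex"
  assumes "finite I" "\<And>i. i \<in> I \<Longrightarrow> (f i has_field_derivative g i * f i z) (at z)"
  shows "((\<lambda>z. \<Prod>i\<in>I. f i z ^ n i) has_field_derivative
           (\<Sum>i\<in>I. of_nat (n i) * g i) * (\<Prod>i\<in>I. f i z ^ n i)) (at z)"
  using assms
proof (induction I rule: finite_induct)
  case (insert i I)
  have "((\<lambda>z. f i z ^ m) has_field_derivative of_nat m * g i * f i z ^ m) (at z)" for m
  proof (induction m)
    case (Suc m)
    from DERIV_mult[OF insert.prems[of i] this] show ?case by (simp add: algebra_simps)
  qed auto
  from DERIV_mult[OF this[of "n i"] insert.IH] insert show ?case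
    by (simp add: algebra_simps)
qed auto

lemma fps_deriv_prod_log_deriv:
  fixes F :: "'i \<Rightarrow> complex fps"
  assumes "finite I" "\<And>i. i \<in> I \<Longrightarrow> fps_deriv (F i) = B i * F i"
  shows "fps_deriv (\<Prod>i\<in>I. F i) = (\<Sum>i\<in>I. B i) * (\<Prod>i\<in>I. F i)"
  using assms by (induction I rule: finite_induct) (auto simp: algebra_simps)

section \<open>Dirichlet characters\<close>

context
  fixes q :: nat and chi :: "nat \<Rightarrow> complex"
  assumes chi: "dirichlet_character q chi"
begin

lemma dirichlet_character_power: "chi (n ^ j) = chi n ^ j"
  using chi by (induction j) (auto simp: dirichlet_character_def)

lemma dirichlet_character_add_mult: "chi (a + k * q) = chi a"
proof (induction k)
  case (Suc k)
  have "chi (a + Suc k * q) = chi ((a + k * q) + q)" by (simp add: algebra_simps)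
  with Suc chi show ?case by (simp add: dirichlet_character_def)
qed simp

lemma norm_dirichlet_character_le: "q > 0 \<Longrightarrow> norm (chi n) \<le> 1"
proof (cases "coprime n q")
  case True
  assume "q > 0"
  have md: "chi a = chi (a mod q)" for a
    using dirichlet_character_add_mult[of "a mod q" "a div q"] by simp
  have "[n ^ totient q = 1] (mod q)" by (rule euler_theorem[OF True])
  hence "chi (n ^ totient q) = chi 1"
    using md[of "n ^ totient q"] md[of 1] by (simp add: cong_def)
  hence "norm (chi n) ^ totient q = 1"
    using chi by (simp add: dirichlet_character_def dirichlet_character_power flip: norm_power)
  moreover have "totient q > 0" using \<open>q > 0\<close> by simp
  ultimately show ?thesis using one_less_power[of "norm (chi n)" "totient q"] by linarith
next
  case False
  hence "chi n = 0" using chi unfolding dirichlet_character_def by blast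
  thus ?thesis by simp
qed

end

text \<open>Represents a residue coprime to \<open>d\<close> by an integer coprime to
  \<open>q\<close>, where an inducing character must agree with the induced one.\<close>

lemma exists_coprime_shift:
  assumes "q > 0" "coprime n d"
  shows "\<exists>t. coprime (n + t * d) (q :: nat)"
proof
  \<comment> \<open>A prime factor of \<open>q\<close> that divides \<open>n\<close> divides neither
    \<open>t\<close> nor \<open>d\<close>; every other one divides \<open>t\<close> but not
    \<open>n\<close>. So none of them divides \<open>n + t * d\<close>.\<close>
  define t where "t = \<Prod>{p \<in> prime_factors q. \<not> p dvd n}"
  show "coprime (n + t * d) q"
  proof (rule ccontr)
    assume "\<not> coprime (n + t * d) q"
    hence "gcd (n + t * d) q \<noteq> 1" using coprime_iff_gcd_eq_1 by blast
    then obtain p where "prime p" "p dvd gcd (n + t * d) q" using prime_factor_nat by blast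
    hence p: "prime p" "p dvd n + t * d" "p dvd q" by auto
    show False
    proof (cases "p dvd n")
      case True
      hence "p dvd t * d" using p(2) by (simp add: dvd_add_right_iff)
      moreover have "\<not> p dvd d" using assms(2) True p(1) by (meson coprime_common_divisor not_prime_unit)
      ultimately have "p dvd t" using p(1) by (simp add: prime_dvd_mult_iff)
      then obtain r where "r \<in> prime_factors q" "\<not> r dvd n" "p dvd r"
        unfolding t_def using p(1) by (auto simp: prime_dvd_prod_iff)
      thus False using True p(1) by (metis in_prime_factors_imp_prime primes_dvd_imp_eq)
    next
      case False
      have "p \<in> {p \<in> prime_factors q. \<not> p dvd n}" using p False assms(1) by (simp add: in_prime_factors_iff)
      hence "p dvd t" unfolding t_def by (intro dvd_prodI) auto
      hence "p dvd n" using p(2) by (metis dvd_add_left_iff dvd_mult2)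
      with False show False by simp
    qed
  qed
qed

text \<open>Justifies the definite description. An inducing character of least modulus is primitive
  because inducing is transitive. It is unique because two such characters agree on integers coprime
  to \<open>q\<close>, and by \<open>exists_coprime_shift\<close> and periodicity these reach every
  residue coprime to the conductor.\<close>

lemma primitive_inducing:
  assumes q: "q > 0" and chi: "dirichlet_character q chi"
  shows "conductor q chi dvd q"
    and "induces (conductor q chi) (primitive_inducing q chi) q chi"
proof -
  define d where "d = conductor q chi"
  have "induces q chi q chi" using chi by (simp add: induces_def)
  hence "\<exists>psi. induces d psi q chi"
    unfolding d_def conductor_def by (rule LeastI[of "\<lambda>d. \<exists>psi. induces d psi q chi", OF exI])
  then obtain psi where psi: "induces d psi q chi" by blast
  thus "conductor q chi dvd q" by (simp add: induces_def d_def)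
  have "primitive_character d psi"
  proof -
    define e where "e = conductor d psi"
    have dpsi: "dirichlet_character d psi" using psi by (simp add: induces_def)
    hence self: "induces d psi d psi" by (simp add: induces_def)
    hence "\<exists>psi'. induces e psi' d psi"
      unfolding e_def conductor_def by (rule LeastI[of "\<lambda>e. \<exists>psi'. induces e psi' d psi", OF exI])
    then obtain psi' where psi': "induces e psi' d psi" by blast
    have "induces e psi' q chi"
      using psi psi' unfolding induces_def by (metis coprime_divisors dvd_refl dvd_trans)
    hence "d \<le> e" unfolding d_def conductor_def by (intro Least_le) blast
    moreover have "e \<le> d" unfolding e_def conductor_def by (rule Least_le) (use self in blast)
    ultimately show ?thesis using dpsi by (simp add: primitive_character_def e_def)
  qed
  moreover have "psi' = psi" if psi': "induces d psi' q chi" for psi'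
  proof
    fix n
    show "psi' n = psi n"
    proof (cases "coprime n d")
      case True
      then obtain t where t: "coprime (n + t * d) q" using exists_coprime_shift[OF q] by blast
      have "psi' (n + t * d) = psi (n + t * d)" using t psi psi' by (metis induces_def)
      thus ?thesis using psi psi' dirichlet_character_add_mult by (metis induces_def)
    next
      case False
      hence "psi n = 0" "psi' n = 0" using psi psi' unfolding induces_def dirichlet_character_def by blast+
      thus ?thesis by simp
    qed
  qed
  ultimately have "\<exists>!psi. primitive_character d psi \<and> induces d psi q chi" using psi by blast
  from theI'[OF this] show "induces (conductor q chi) (primitive_inducing q chi) q chi"
    by (simp add: primitive_inducing_def d_def)
qed

lemma conductor_pos: "q > 0 \<Longrightarrow> dirichlet_character q chi \<Longrightarrow> conductor q chi > 0"
  using primitive_inducing(1) by (metis dvd_0_left_iff neq0_conv)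

lemma primitive_inducing_eq:
  "q > 0 \<Longrightarrow> dirichlet_character q chi \<Longrightarrow> coprime n q \<Longrightarrow> primitive_inducing q chi n = chi n"
  using primitive_inducing(2) by (simp add: induces_def)

lemma dirichlet_character_primitive_inducing:
  "q > 0 \<Longrightarrow> dirichlet_character q chi \<Longrightarrow>
     dirichlet_character (conductor q chi) (primitive_inducing q chi)"
  using primitive_inducing(2) by (simp add: induces_def)

lemma norm_primitive_inducing_le:
  "q > 0 \<Longrightarrow> dirichlet_character q chi \<Longrightarrow> norm (primitive_inducing q chi n) \<le> 1"
  by (rule norm_dirichlet_character_le[OF dirichlet_character_primitive_inducing conductor_pos])

section \<open>Coefficients at prime powers\<close>

text \<open>Divisors with product p^M distribute the exponent M over the factors, so the coefficient
  is that of a product of geometric series, one for each index in \<open>I\<close>. The geometric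
  series in c z has the logarithmic derivative with entries c^(i+1), and summing over
  \<open>I\<close> collects the multiplicities \<open>l chi\<close>.\<close>

lemma dirichlet_coeff_prime_power:
  assumes q: "q > 0" and p: "prime p"
  shows "dirichlet_coeff q l (p ^ M) =
           fps_of_log_deriv (Abs_fps (\<lambda>i. \<Sum>chi\<in>dirichlet_characters q. of_nat (l chi) * chi p ^ Suc i)) $ M"
proof -
  define I where "I = (SIGMA chi:dirichlet_characters q. {..<l chi})"
  have I: "finite I" unfolding I_def using finite_dirichlet_characters[OF q] by auto
  define G where "G = (\<Prod>i\<in>I. Abs_fps (\<lambda>n. fst i p ^ n))"
  have pinj: "p ^ a = p ^ b \<longleftrightarrow> a = b" for a b
    using p prime_gt_1_nat[OF p] by (simp add: power_inject_exp)
  let ?W = "{m. m \<in> I \<rightarrow>\<^sub>E {d. d dvd p ^ M} \<and> (\<Prod>i\<in>I. m i) = p ^ M}"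
  \<comment> \<open>Multisets of size M encode the exponents, because \<open>fps_prod_nth'\<close>
    expresses the coefficients of a finite product through them.\<close>
  let ?r = "\<lambda>X. restrict (\<lambda>i. p ^ count X i) I"
  have sz: "size X = (\<Sum>i\<in>I. count X i)" if "set_mset X \<subseteq> I" for X
    unfolding size_multiset_overloaded_eq using that I
    by (intro sum.mono_neutral_left) (auto simp: not_in_iff)
  have "bij_betw ?r (multisets_of_size I M) ?W"
  proof (rule bij_betw_imageI)
    show "inj_on ?r (multisets_of_size I M)"
    proof (rule inj_onI)
      fix X Y assume XY: "X \<in> multisets_of_size I M" "Y \<in> multisets_of_size I M" "?r X = ?r Y"
      have "count X i = count Y i" for i
      proof (cases "i \<in> I")
        case True
        thus ?thesis using fun_cong[OF XY(3), of i] pinj by simp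
      next
        case False
        hence "i \<notin># X" "i \<notin># Y" using XY(1,2) by (auto simp: multisets_of_size_def)
        thus ?thesis by (simp add: not_in_iff)
      qed
      thus "X = Y" by (rule multiset_eqI)
    qed
    show "?r ` multisets_of_size I M = ?W"
    proof (intro equalityI subsetI)
      fix m assume "m \<in> ?r ` multisets_of_size I M"
      then obtain X where X: "set_mset X \<subseteq> I" "size X = M" "m = ?r X" by (auto simp: multisets_of_size_def)
      have "(\<Prod>i\<in>I. m i) = p ^ M" using X sz[OF X(1)] by (simp add: power_sum [symmetric])
      moreover have "m i dvd p ^ M" if "i \<in> I" for i
        using that I calculation by (metis dvd_prodI)
      ultimately show "m \<in> ?W" using X(3) by auto
    next
      fix m assume m: "m \<in> ?W"
      have "\<exists>e. m i = p ^ e" if "i \<in> I" for i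
        using m that divides_primepow_nat[OF p, of "m i" M] by (auto simp: PiE_iff)
      then obtain e where e: "\<And>i. i \<in> I \<Longrightarrow> m i = p ^ e i" by metis
      have "p ^ (\<Sum>i\<in>I. e i) = p ^ M" using m e by (simp add: power_sum)
      hence eM: "(\<Sum>i\<in>I. e i) = M" by (simp add: pinj)
      define X where "X = (\<Sum>i\<in>I. replicate_mset (e i) i)"
      have cX: "count X i = (if i \<in> I then e i else 0)" for i
        using I by (simp add: X_def count_sum)
      have "set_mset X \<subseteq> I" using cX by (auto simp: set_mset_def split: if_splits)
      moreover have "size X = M" using sz[OF calculation] cX eM by simp
      moreover have "m = ?r X"
        using m e cX by (auto simp: PiE_iff extensional_def fun_eq_iff)
      ultimately show "m \<in> ?r ` multisets_of_size I M" by (auto simp: multisets_of_size_def)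
    qed
  qed
  moreover have "(\<Prod>i\<in>I. fst i (?r X i)) = (\<Prod>i\<in>I. fst i p ^ count X i)" for X
  proof (intro prod.cong refl)
    fix i assume i: "i \<in> I"
    hence "dirichlet_character q (fst i)" by (auto simp: I_def dirichlet_characters_def)
    thus "fst i (?r X i) = fst i p ^ count X i" using i by (simp add: dirichlet_character_power)
  qed
  ultimately have "dirichlet_coeff q l (p ^ M) = (\<Sum>X\<in>multisets_of_size I M. \<Prod>i\<in>I. fst i p ^ count X i)"
    unfolding dirichlet_coeff_def Let_def I_def [symmetric]
    by (subst sum.reindex_bij_betw [symmetric, of ?r "multisets_of_size I M" ?W]) simp_all
  also have "\<dots> = G $ M" using I by (simp add: G_def fps_prod_nth')
  also have "\<dots> = fps_of_log_deriv (Abs_fps (\<lambda>i. \<Sum>chi\<in>dirichlet_characters q. of_nat (l chi) * chi p ^ Suc i)) $ M"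
  proof (rule fps_log_deriv_agree[OF _ fps_deriv_of_log_deriv, of G "\<Sum>i\<in>I. Abs_fps (\<lambda>n. fst i p ^ Suc n)" _ M])
    have "fps_deriv (Abs_fps (\<lambda>n. c ^ n)) = Abs_fps (\<lambda>n. c ^ Suc n) * Abs_fps (\<lambda>n. c ^ n)" for c :: complex
    proof (rule fps_ext)
      fix n
      have "(Abs_fps (\<lambda>n. c ^ Suc n) * Abs_fps (\<lambda>n. c ^ n)) $ n = (\<Sum>i=0..n. c ^ Suc n)"
        unfolding fps_mult_nth by (intro sum.cong refl) (simp flip: power_add power_Suc)
      thus "fps_deriv (Abs_fps (\<lambda>n. c ^ n)) $ n = (Abs_fps (\<lambda>n. c ^ Suc n) * Abs_fps (\<lambda>n. c ^ n)) $ n"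
        by simp
    qed
    thus "fps_deriv G = (\<Sum>i\<in>I. Abs_fps (\<lambda>n. fst i p ^ Suc n)) * G"
      unfolding G_def by (intro fps_deriv_prod_log_deriv I)
    show "G $ 0 = fps_of_log_deriv (Abs_fps (\<lambda>i. \<Sum>chi\<in>dirichlet_characters q. of_nat (l chi) * chi p ^ Suc i)) $ 0"
    proof -
      have "(\<Prod>i\<in>J. Abs_fps (\<lambda>n. fst i p ^ n)) $ 0 = 1" if "finite J" for J :: "((nat \<Rightarrow> complex) \<times> nat) set"
        using that by (induction J rule: finite_induct) auto
      thus ?thesis using I by (simp add: G_def)
    qed
    fix n
    have "(\<Sum>i\<in>I. Abs_fps (\<lambda>n. fst i p ^ Suc n)) $ n = (\<Sum>(chi, j)\<in>I. chi p ^ Suc n)"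
      by (simp add: fps_sum_nth case_prod_unfold)
    also have "\<dots> = (\<Sum>chi\<in>dirichlet_characters q. \<Sum>j<l chi. chi p ^ Suc n)"
      unfolding I_def by (rule sum.Sigma [symmetric]) (use finite_dirichlet_characters[OF q] in auto)
    finally show "(\<Sum>i\<in>I. Abs_fps (\<lambda>n. fst i p ^ Suc n)) $ n =
        Abs_fps (\<lambda>i. \<Sum>chi\<in>dirichlet_characters q. of_nat (l chi) * chi p ^ Suc i) $ n"
      by simp
  qed auto
  finally show ?thesis .
qed

section \<open>The local factors of the mean square\<close>

text \<open>
  The logarithmic derivative of the factor of \<open>P_prod q l N\<close> at \<open>p\<close>, as a power series in \<open>p\<^sup>-\<^sup>s\<close>.
  The truncated exponential contributes the indicator of \<open>p\<^sup>i\<^sup>+\<^sup>1 \<le> N\<close>, and the finite Euler product over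
  the divisors of \<open>q\<close> contributes the indicator of \<open>p dvd q\<close>.
\<close>
definition local_log_deriv :: "nat \<Rightarrow> ((nat \<Rightarrow> complex) \<Rightarrow> nat) \<Rightarrow> nat \<Rightarrow> nat \<Rightarrow> complex fps" where
  "local_log_deriv q l N p = Abs_fps (\<lambda>i.
     (\<Sum>chi\<in>dirichlet_characters q. of_nat (l chi) * primitive_inducing q chi p ^ Suc i) *
     ((if p ^ Suc i \<le> N then 1 else 0) - (if p dvd q then 1 else 0)))"

definition local_coeff :: "nat \<Rightarrow> ((nat \<Rightarrow> complex) \<Rightarrow> nat) \<Rightarrow> nat \<Rightarrow> nat \<Rightarrow> nat \<Rightarrow> complex" where
  "local_coeff q l N p m = fps_of_log_deriv (local_log_deriv q l N p) $ m"

text \<open>Here \<open>z\<close> stands for p^-s; the logarithmic derivative in \<open>z\<close> is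
  \<open>local_log_deriv\<close>.\<close>

definition local_factor :: "nat \<Rightarrow> ((nat \<Rightarrow> complex) \<Rightarrow> nat) \<Rightarrow> nat \<Rightarrow> nat \<Rightarrow> complex \<Rightarrow> complex" where
  "local_factor q l N p z = (\<Prod>chi\<in>dirichlet_characters q.
     ((if p dvd q then 1 - primitive_inducing q chi p * z else 1) *
      exp (\<Sum>j | j \<in> {1..N} \<and> p ^ j \<le> N. (primitive_inducing q chi p * z) ^ j / of_nat j)) ^ l chi)"

context
  fixes q k :: nat and l :: "(nat \<Rightarrow> complex) \<Rightarrow> nat"
  assumes q: "q > 0" and k: "(\<Sum>chi\<in>dirichlet_characters q. l chi) = k"
begin

lemma norm_sum_character_powers_le:
  assumes "\<And>chi. chi \<in> dirichlet_characters q \<Longrightarrow> norm (c chi) \<le> 1"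
  shows "norm (\<Sum>chi\<in>dirichlet_characters q. of_nat (l chi) * c chi ^ i :: complex) \<le> real k"
proof -
  have "norm (\<Sum>chi\<in>dirichlet_characters q. of_nat (l chi) * c chi ^ i :: complex) \<le>
          (\<Sum>chi\<in>dirichlet_characters q. real (l chi))"
    by (rule sum_norm_le) (auto simp: norm_mult norm_power intro!: mult_left_le power_le_one assms)
  thus ?thesis by (simp add: k [symmetric])
qed

lemma norm_local_log_deriv_le: "norm (local_log_deriv q l N p $ i) \<le> real k"
proof -
  have "norm (local_log_deriv q l N p $ i) \<le> real k * 1"
    unfolding local_log_deriv_def fps_nth_Abs_fps norm_mult
    by (intro mult_mono norm_sum_character_powers_le norm_primitive_inducing_le q)
       (auto simp: dirichlet_characters_def)
  thus ?thesis by simp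
qed

lemma norm_local_coeff_le: "norm (local_coeff q l N p m) \<le> real (m + k choose k)"
  unfolding local_coeff_def
  by (rule norm_fps_log_deriv_le[OF fps_deriv_of_log_deriv]) (simp_all add: norm_local_log_deriv_le)

lemma norm_dirichlet_coeff_le:
  assumes "prime p"
  shows "norm (dirichlet_coeff q l (p ^ m)) \<le> real (m + k choose k)"
  unfolding dirichlet_coeff_prime_power[OF q assms]
proof (rule norm_fps_log_deriv_le[OF fps_deriv_of_log_deriv])
  fix i
  show "norm (Abs_fps (\<lambda>i. \<Sum>chi\<in>dirichlet_characters q. of_nat (l chi) * chi p ^ Suc i) $ i) \<le> real k"
    unfolding fps_nth_Abs_fps
    by (rule norm_sum_character_powers_le) (auto simp: dirichlet_characters_def intro: norm_dirichlet_character_le q)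
qed simp

text \<open>Only the entries i < m of the logarithmic derivatives matter, and there p^(i+1) \<le> N.
  If p divides \<open>q\<close>, the two indicators cancel and the characters modulo
  \<open>q\<close> vanish at p; otherwise each character agrees at p with its primitive
  character.\<close>

lemma local_coeff_eq:
  assumes p: "prime p" and m: "p ^ m \<le> N"
  shows "local_coeff q l N p m = dirichlet_coeff q l (p ^ m)"
  unfolding dirichlet_coeff_prime_power[OF q p] local_coeff_def
proof (rule fps_log_deriv_agree[OF fps_deriv_of_log_deriv fps_deriv_of_log_deriv])
  fix i assume "i < m"
  hence "p ^ Suc i \<le> p ^ m" using prime_ge_1_nat[OF p] by (intro power_increasing) auto
  hence pN: "p ^ Suc i \<le> N" using m by linarith
  show "local_log_deriv q l N p $ i =
          Abs_fps (\<lambda>i. \<Sum>chi\<in>dirichlet_characters q. of_nat (l chi) * chi p ^ Suc i) $ i"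
  proof (cases "p dvd q")
    case True
    hence "\<not> coprime p q" using p by (metis coprime_absorb_left not_prime_unit)
    hence "chi p = 0" if "chi \<in> dirichlet_characters q" for chi
      using that unfolding dirichlet_characters_def dirichlet_character_def by blast
    thus ?thesis using True pN by (auto simp: local_log_deriv_def intro!: sum.neutral)
  next
    case False
    hence "coprime p q" using p by (simp add: prime_imp_coprime)
    hence "primitive_inducing q chi p = chi p" if "chi \<in> dirichlet_characters q" for chi
      using that primitive_inducing_eq[OF q] by (simp add: dirichlet_characters_def)
    thus ?thesis using False pN by (simp add: local_log_deriv_def)
  qed
qed auto

text \<open>The analytic factor has no zero in the unit disc and has the prescribed logarithmic
  derivative, so \<open>fps_log_deriv_sums\<close> identifies its Taylor coefficients.\<close>

lemma local_factor_sums: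
  assumes p: "prime p" and z: "norm z < 1"
  shows "(\<lambda>m. local_coeff q l N p m * z ^ m) sums local_factor q l N p z"
  unfolding local_coeff_def
proof (rule fps_log_deriv_sums[OF fps_deriv_of_log_deriv _ norm_local_log_deriv_le _ _ _ z])
  have fin: "finite (dirichlet_characters q)" by (rule finite_dirichlet_characters[OF q])
  have c1: "norm (primitive_inducing q chi p) \<le> 1" if "chi \<in> dirichlet_characters q" for chi
    using that norm_primitive_inducing_le[OF q] by (simp add: dirichlet_characters_def)
  have lt: "norm (primitive_inducing q chi p * z) < 1" if "chi \<in> dirichlet_characters q" "norm z < 1" for chi z
  proof -
    have "norm (primitive_inducing q chi p * z) \<le> 1 * norm z"
      unfolding norm_mult using c1[OF that(1)] by (intro mult_right_mono) auto
    thus ?thesis using that by simp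
  qed
  have nz: "1 - primitive_inducing q chi p * z \<noteq> 0" if "chi \<in> dirichlet_characters q" "norm z < 1" for chi z
    using lt[OF that] by (metis norm_one less_irrefl right_minus_eq)
  have J: "{j. j \<in> {1..N} \<and> p ^ j \<le> N} = Suc ` {i. i < N \<and> p ^ Suc i \<le> N}"
  proof (intro equalityI subsetI)
    fix j assume j: "j \<in> {j. j \<in> {1..N} \<and> p ^ j \<le> N}"
    then obtain i where "j = Suc i" by (cases j) auto
    with j show "j \<in> Suc ` {i. i < N \<and> p ^ Suc i \<le> N}" by auto
  qed auto
  show "local_factor q l N p 0 = 1"
  proof -
    have "(\<Sum>j | j \<in> {1..N} \<and> p ^ j \<le> N. (primitive_inducing q chi p * 0) ^ j / of_nat j) = 0" for chi
      by (rule sum.neutral) auto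
    thus ?thesis by (auto simp: local_factor_def intro!: prod.neutral)
  qed
  show "local_factor q l N p z \<noteq> 0" if "norm z < 1" for z
    using fin nz[OF _ that] by (auto simp: local_factor_def)
  show "(local_factor q l N p has_field_derivative eval_fps (local_log_deriv q l N p) z * local_factor q l N p z) (at z)"
    if z: "norm z < 1" for z
  proof -
    \<comment> \<open>The logarithmic derivative of the contribution of \<open>chi\<close>: a
      polynomial from the truncated exponential, minus a geometric series from the linear factor at
      primes dividing \<open>q\<close>.\<close>
    define g where "g = (\<lambda>chi. (\<Sum>i | i < N \<and> p ^ Suc i \<le> N. primitive_inducing q chi p ^ Suc i * z ^ i) -
         (if p dvd q then primitive_inducing q chi p / (1 - primitive_inducing q chi p * z) else 0))"
    have sums: "(\<lambda>i. primitive_inducing q chi p ^ Suc i *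
           ((if p ^ Suc i \<le> N then 1 else 0) - (if p dvd q then 1 else 0)) * z ^ i) sums g chi"
      if chi: "chi \<in> dirichlet_characters q" for chi
    proof -
      let ?c = "primitive_inducing q chi p"
      have "(\<lambda>i. if i \<in> {i. i < N \<and> p ^ Suc i \<le> N} then ?c ^ Suc i * z ^ i else 0) sums
              (\<Sum>i | i < N \<and> p ^ Suc i \<le> N. ?c ^ Suc i * z ^ i)"
        by (rule sums_If_finite_set) auto
      also have "(\<lambda>i. if i \<in> {i. i < N \<and> p ^ Suc i \<le> N} then ?c ^ Suc i * z ^ i else 0) =
                 (\<lambda>i. ?c ^ Suc i * (if p ^ Suc i \<le> N then 1 else 0) * z ^ i)"
      proof
        fix i
        have "i < N" if "p ^ Suc i \<le> N"
          using power_gt_expt[OF prime_gt_Suc_0_nat[OF p], of "Suc i"] that by linarith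
        thus "(if i \<in> {i. i < N \<and> p ^ Suc i \<le> N} then ?c ^ Suc i * z ^ i else 0) =
              ?c ^ Suc i * (if p ^ Suc i \<le> N then 1 else 0) * z ^ i"
          by (cases "p ^ Suc i \<le> N") (simp_all del: power_Suc)
      qed
      finally have 1: "(\<lambda>i. ?c ^ Suc i * (if p ^ Suc i \<le> N then 1 else 0) * z ^ i) sums
              (\<Sum>i | i < N \<and> p ^ Suc i \<le> N. ?c ^ Suc i * z ^ i)" .
      have 2: "(\<lambda>i. ?c ^ Suc i * (if p dvd q then 1 else 0) * z ^ i) sums
                 (if p dvd q then ?c / (1 - ?c * z) else 0)"
      proof (cases "p dvd q")
        case True
        have "(\<lambda>i. ?c * (?c * z) ^ i) sums (?c * (1 / (1 - ?c * z)))"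
          using lt[OF chi z] by (intro sums_mult geometric_sums)
        thus ?thesis using True by (simp add: power_mult_distrib mult_ac)
      qed simp
      show ?thesis using sums_diff[OF 1 2] by (simp add: g_def algebra_simps)
    qed
    have "(\<lambda>i. \<Sum>chi\<in>dirichlet_characters q. of_nat (l chi) * (primitive_inducing q chi p ^ Suc i *
           ((if p ^ Suc i \<le> N then 1 else 0) - (if p dvd q then 1 else 0)) * z ^ i)) sums
          (\<Sum>chi\<in>dirichlet_characters q. of_nat (l chi) * g chi)"
      by (rule sums_sum) (rule sums_mult, rule sums)
    also have "(\<lambda>i. \<Sum>chi\<in>dirichlet_characters q. of_nat (l chi) * (primitive_inducing q chi p ^ Suc i *
           ((if p ^ Suc i \<le> N then 1 else 0) - (if p dvd q then 1 else 0)) * z ^ i)) =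
           (\<lambda>i. local_log_deriv q l N p $ i * z ^ i)"
      by (rule ext) (simp only: local_log_deriv_def fps_nth_Abs_fps sum_distrib_right mult.assoc)
    finally have eval: "eval_fps (local_log_deriv q l N p) z = (\<Sum>chi\<in>dirichlet_characters q. of_nat (l chi) * g chi)"
      by (simp add: eval_fps_def sums_iff)
    show ?thesis
      unfolding eval local_factor_def [abs_def]
    proof (rule has_field_derivative_prod_power[OF fin])
      fix chi assume chi: "chi \<in> dirichlet_characters q"
      let ?c = "primitive_inducing q chi p"
      let ?Q = "\<lambda>z. \<Sum>j | j \<in> {1..N} \<and> p ^ j \<le> N. (?c * z) ^ j / of_nat j"
      have "((\<lambda>z. (?c * z) ^ j / of_nat j) has_field_derivative ?c ^ j * z ^ (j - 1)) (at z)" if "j > 0" for j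
      proof -
        from that obtain i where j: "j = Suc i" by (cases j) auto
        have "((\<lambda>z. (?c * z) ^ Suc i) has_field_derivative of_nat (Suc i) * (?c * z) ^ i * ?c) (at z)"
          using DERIV_power[OF DERIV_cmult_Id[of ?c z UNIV], of "Suc i"] by (simp add: mult_ac)
        from DERIV_cdivide[OF this, of "of_nat (Suc i)"]
        show ?thesis unfolding j by (simp add: power_mult_distrib mult_ac del: of_nat_Suc)
      qed
      hence Q: "(?Q has_field_derivative (\<Sum>j | j \<in> {1..N} \<and> p ^ j \<le> N. ?c ^ j * z ^ (j - 1))) (at z)"
        by (intro DERIV_sum) auto
      have "(\<Sum>j | j \<in> {1..N} \<and> p ^ j \<le> N. ?c ^ j * z ^ (j - 1)) = (\<Sum>i | i < N \<and> p ^ Suc i \<le> N. ?c ^ Suc i * z ^ i)"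
        unfolding J by (subst sum.reindex) auto
      with Q have Q: "(?Q has_field_derivative (\<Sum>i | i < N \<and> p ^ Suc i \<le> N. ?c ^ Suc i * z ^ i)) (at z)" by simp
      show "((\<lambda>z. (if p dvd q then 1 - ?c * z else 1) * exp (?Q z)) has_field_derivative
              g chi * ((if p dvd q then 1 - ?c * z else 1) * exp (?Q z))) (at z)"
      proof (cases "p dvd q")
        case True
        have "((\<lambda>z. (1 - ?c * z) * exp (?Q z)) has_field_derivative
                (- ?c * exp (?Q z) + exp (?Q z) * (\<Sum>i | i < N \<and> p ^ Suc i \<le> N. ?c ^ Suc i * z ^ i) * (1 - ?c * z))) (at z)"
          by (rule DERIV_mult[OF _ DERIV_fun_exp[OF Q]]) (auto intro!: derivative_eq_intros)
        moreover have "g chi * ((1 - ?c * z) * exp (?Q z)) =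
             - ?c * exp (?Q z) + exp (?Q z) * (\<Sum>i | i < N \<and> p ^ Suc i \<le> N. ?c ^ Suc i * z ^ i) * (1 - ?c * z)"
          using True nz[OF chi z] by (simp add: g_def field_simps)
        ultimately show ?thesis using True by simp
      next
        case False
        thus ?thesis using DERIV_fun_exp[OF Q] by (simp add: g_def mult_ac)
      qed
    qed
  qed
qed simp

text \<open>Sorting the exponent by primes is exact, because it runs over precisely the powers p^j
  \<le> N. The condition \<open>q \<le> N\<close> brings all prime factors of \<open>q\<close> into
  the range p \<le> N.\<close>

lemma P_prod_eq_local_factors:
  assumes N: "q \<le> N"
  shows "P_prod q l (real N) s = (\<Prod>p | prime p \<and> p \<le> N. local_factor q l N p (1 / of_nat p powr s))"
proof -
  have P: "P_X q (real N) chi s = (\<Prod>p | prime p \<and> p \<le> N.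
      (if p dvd q then 1 - primitive_inducing q chi p * (1 / of_nat p powr s) else 1) *
      exp (\<Sum>j | j \<in> {1..N} \<and> p ^ j \<le> N. (primitive_inducing q chi p * (1 / of_nat p powr s)) ^ j / of_nat j))"
    if chi: "chi \<in> dirichlet_characters q" for chi
  proof -
    let ?psi = "primitive_inducing q chi"
    have psi: "dirichlet_character (conductor q chi) ?psi"
      using chi dirichlet_character_primitive_inducing[OF q] by (simp add: dirichlet_characters_def)
    have "{n. 1 \<le> n \<and> real n \<le> real N} = {1..N}" by auto
    hence "(\<Sum>n | 1 \<le> n \<and> real n \<le> real N. ?psi n * mangoldt n / (of_nat n powr s * of_real (ln (real n)))) =
            (\<Sum>n=1..N. ?psi n / of_nat n powr s * mangoldt n / of_real (ln (real n)))"
      by simp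
    also have "\<dots> = (\<Sum>p | prime p \<and> p \<le> N. \<Sum>j | j \<in> {1..N} \<and> p ^ j \<le> N. ?psi (p ^ j) / of_nat (p ^ j) powr s / of_nat j)"
      by (rule sum_mangoldt_eq_sum_prime_powers)
    also have "\<dots> = (\<Sum>p | prime p \<and> p \<le> N. \<Sum>j | j \<in> {1..N} \<and> p ^ j \<le> N. (?psi p * (1 / of_nat p powr s)) ^ j / of_nat j)"
    proof (intro sum.cong refl)
      fix p j assume "p \<in> {p. prime p \<and> p \<le> N}"
      hence "p > 0" by (auto intro: prime_gt_0_nat)
      hence "of_nat (p ^ j) powr s = (of_nat p powr s :: complex) ^ j"
        by (induction j) (auto simp: powr_times_real)
      thus "?psi (p ^ j) / of_nat (p ^ j) powr s / of_nat j = (?psi p * (1 / of_nat p powr s)) ^ j / of_nat j"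
        by (simp only: dirichlet_character_power[OF psi] power_mult_distrib power_one_over) simp
    qed
    finally have 1: "exp (\<Sum>n | 1 \<le> n \<and> real n \<le> real N. ?psi n * mangoldt n / (of_nat n powr s * of_real (ln (real n)))) =
        (\<Prod>p | prime p \<and> p \<le> N. exp (\<Sum>j | j \<in> {1..N} \<and> p ^ j \<le> N. (?psi p * (1 / of_nat p powr s)) ^ j / of_nat j))"
      by (simp add: exp_sum)
    have "(\<Prod>p\<in>prime_factors q. 1 - ?psi p / of_nat p powr s) =
          (\<Prod>p\<in>prime_factors q. if p dvd q then 1 - ?psi p * (1 / of_nat p powr s) else 1)"
      by (intro prod.cong refl) (auto dest: in_prime_factors_imp_dvd)
    also have "\<dots> = (\<Prod>p | prime p \<and> p \<le> N. if p dvd q then 1 - ?psi p * (1 / of_nat p powr s) else 1)"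
    proof (rule prod.mono_neutral_left)
      show "prime_factors q \<subseteq> {p. prime p \<and> p \<le> N}"
        using N q by (auto simp: in_prime_factors_iff dest!: dvd_imp_le)
      show "\<forall>p\<in>{p. prime p \<and> p \<le> N} - prime_factors q. (if p dvd q then 1 - ?psi p * (1 / of_nat p powr s) else 1) = 1"
        using q by (auto simp: in_prime_factors_iff)
    qed auto
    finally show ?thesis unfolding P_X_def 1 by (simp only: prod.distrib)
  qed
  have "P_prod q l (real N) s = (\<Prod>chi\<in>dirichlet_characters q. \<Prod>p | prime p \<and> p \<le> N.
      ((if p dvd q then 1 - primitive_inducing q chi p * (1 / of_nat p powr s) else 1) *
      exp (\<Sum>j | j \<in> {1..N} \<and> p ^ j \<le> N. (primitive_inducing q chi p * (1 / of_nat p powr s)) ^ j / of_nat j)) ^ l chi)"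
    unfolding P_prod_def by (intro prod.cong refl) (simp only: P prod_power_distrib)
  also have "\<dots> = (\<Prod>p | prime p \<and> p \<le> N. local_factor q l N p (1 / of_nat p powr s))"
    unfolding local_factor_def by (rule prod.swap)
  finally show ?thesis .
qed

lemma summable_norm_local_coeff:
  assumes "prime p"
  shows "summable (\<lambda>m. norm (local_coeff q l N p m * of_real ((real p powr (- 1 / 2)) ^ m)))"
proof (rule summable_comparison_test')
  have "real p powr (- 1 / 2) < 1" using prime_gt_1_nat[OF assms] by (simp add: powr_less_one)
  thus "summable (\<lambda>m. real (m + k choose k) ^ 1 * (real p powr (- 1 / 2)) ^ m)"
    by (intro summable_choose_power) auto
  show "norm (norm (local_coeff q l N p m * of_real ((real p powr (- 1 / 2)) ^ m)))
          \<le> real (m + k choose k) ^ 1 * (real p powr (- 1 / 2)) ^ m" for m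
    using norm_local_coeff_le[of N p m] by (simp add: norm_mult norm_power mult_right_mono)
qed

lemma summable_coeff_square:
  assumes p: "prime p" and c: "\<And>m. norm (c m) \<le> real (m + k choose k)"
  shows "summable (\<lambda>m. (norm (c m))\<^sup>2 / real p ^ m)"
proof (rule summable_comparison_test')
  show "summable (\<lambda>m. real (m + k choose k) ^ 2 * (1 / real p) ^ m)"
    using prime_gt_1_nat[OF p] by (intro summable_choose_power) auto
  show "norm ((norm (c m))\<^sup>2 / real p ^ m) \<le> real (m + k choose k) ^ 2 * (1 / real p) ^ m" for m
    using c[of m] by (simp add: power_one_over divide_inverse power_inverse) (intro mult_right_mono power_mono, auto)
qed

lemmas summable_local_coeff_square = summable_coeff_square[OF _ norm_local_coeff_le]

text \<open>Exponent functions on the primes up to N stand for the integers without larger prime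
  factors. By unique factorisation the frequencies log n are distinct, so no cross terms survive,
  and the sum of squares factors again over the primes.\<close>

lemma mean_square_P_prod:
  assumes N: "q \<le> N"
  shows "((\<lambda>T. mean_square (P_prod q l (real N)) T) \<longlongrightarrow>
           (\<Prod>p | prime p \<and> p \<le> N. \<Sum>m. (norm (local_coeff q l N p m))\<^sup>2 / real p ^ m)) at_top"
proof -
  let ?S = "{p. prime p \<and> p \<le> N}"
  \<comment> \<open>On the critical line p^(-ms) = p^(-m/2) p^(-imt); the modulus goes into
    \<open>c\<close> and the phase into \<open>w\<close>.\<close>
  define c where "c = (\<lambda>p m. local_coeff q l N p m * of_real ((real p powr (- 1 / 2)) ^ m))"
  define w where "w = (\<lambda>f. - ln (real (\<Prod>p\<in>?S. p ^ f p)))"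
  have S: "finite ?S" "\<And>p. p \<in> ?S \<Longrightarrow> prime p" by auto
  have csm: "summable (\<lambda>m. norm (c p m))" if "p \<in> ?S" for p
    using that summable_norm_local_coeff unfolding c_def by blast
  have pos: "(\<Prod>p\<in>?S. p ^ f p) > 0" for f by (intro prod_pos) (auto simp: prime_gt_0_nat)
  have inj: "inj_on w (?S \<rightarrow>\<^sub>E UNIV)"
  proof (rule inj_onI)
    fix f g assume fg: "f \<in> ?S \<rightarrow>\<^sub>E UNIV" "g \<in> ?S \<rightarrow>\<^sub>E UNIV" "w f = w g"
    have "real (\<Prod>p\<in>?S. p ^ f p) = real (\<Prod>p\<in>?S. p ^ g p)"
      using fg(3) pos[of f] pos[of g] unfolding w_def by (metis neg_equal_iff_equal ln_inj_iff of_nat_0_less_iff)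
    hence "(\<Prod>p\<in>?S. p ^ f p) = (\<Prod>p\<in>?S. p ^ g p)" by (simp only: of_nat_eq_iff)
    thus "f = g" using inj_on_prod_prime_powers[OF S, of UNIV] fg by (auto dest: inj_onD)
  qed
  have wsum: "w f = (\<Sum>p\<in>?S. - (real (f p) * ln (real p)))" for f
  proof -
    have "ln (real (\<Prod>p\<in>?S. p ^ f p)) = (\<Sum>p\<in>?S. ln (real (p ^ f p)))"
      unfolding of_nat_prod by (rule ln_prod) (auto simp: prime_gt_0_nat)
    also have "\<dots> = (\<Sum>p\<in>?S. real (f p) * ln (real p))"
      by (intro sum.cong refl) (auto simp: ln_realpow prime_gt_0_nat)
    finally show ?thesis by (simp add: w_def sum_negf)
  qed
  have P: "P_prod q l (real N) (Complex (1 / 2) t) = (\<Sum>\<^sub>\<infinity>f\<in>?S \<rightarrow>\<^sub>E UNIV. (\<Prod>p\<in>?S. c p (f p)) * cis (w f * t))" for t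
  proof -
    let ?e = "\<lambda>p m. cis (- (real m * ln (real p)) * t)"
    have fac: "local_factor q l N p (1 / of_nat p powr Complex (1 / 2) t) = (\<Sum>m. c p m * ?e p m)" if p: "p \<in> ?S" for p
    proof -
      have p1: "p > 1" using p prime_gt_1_nat by auto
      have "of_nat p powr Complex (1 / 2) t = exp (Complex (1 / 2) t * of_real (ln (real p)))"
        using p1 by (simp add: powr_def Ln_of_nat)
      hence "1 / of_nat p powr Complex (1 / 2) t = exp (- (Complex (1 / 2) t * of_real (ln (real p))))"
        by (simp add: exp_minus field_simps)
      also have "\<dots> = of_real (real p powr (- 1 / 2)) * cis (- ln (real p) * t)"
        using p1 by (simp add: powr_def exp_eq_polar field_simps)
      finally have z: "1 / of_nat p powr Complex (1 / 2) t = of_real (real p powr (- 1 / 2)) * cis (- ln (real p) * t)" .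
      have "real p powr (- 1 / 2) < 1" using p1 by (simp add: powr_less_one)
      hence "norm (1 / of_nat p powr Complex (1 / 2) t) < 1" unfolding z by (simp add: norm_mult)
      from local_factor_sums[OF _ this, of p N]
      have "(\<lambda>m. local_coeff q l N p m * (of_real (real p powr (- 1 / 2)) * cis (- ln (real p) * t)) ^ m) sums
              local_factor q l N p (1 / of_nat p powr Complex (1 / 2) t)"
        using p unfolding z by simp
      moreover have "local_coeff q l N p m * (of_real (real p powr (- 1 / 2)) * cis (- ln (real p) * t)) ^ m = c p m * ?e p m" for m
      proof -
        have "cis (- ln (real p) * t) ^ m = ?e p m"
          by (rule trans[OF Complex.DeMoivre arg_cong[where f = cis]]) (simp add: algebra_simps)
        thus ?thesis by (simp only: c_def power_mult_distrib of_real_power mult.assoc)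
      qed
      ultimately show ?thesis by (simp add: sums_iff)
    qed
    have "P_prod q l (real N) (Complex (1 / 2) t) = (\<Prod>p\<in>?S. \<Sum>m. c p m * ?e p m)"
      unfolding P_prod_eq_local_factors[OF N] by (intro prod.cong refl fac)
    also have "\<dots> = (\<Sum>\<^sub>\<infinity>f\<in>?S \<rightarrow>\<^sub>E UNIV. \<Prod>p\<in>?S. c p (f p) * ?e p (f p))"
      by (rule infsum_prod_PiE_suminf [symmetric]) (use csm in \<open>auto simp: norm_mult\<close>)
    also have "\<dots> = (\<Sum>\<^sub>\<infinity>f\<in>?S \<rightarrow>\<^sub>E UNIV. (\<Prod>p\<in>?S. c p (f p)) * cis (w f * t))"
    proof (rule infsum_cong)
      fix f
      have "(\<Prod>p\<in>?S. ?e p (f p)) = cis (\<Sum>p\<in>?S. - (real (f p) * ln (real p)) * t)"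
        using S(1) by (induction rule: finite_induct) (auto simp: cis_mult)
      also have "\<dots> = cis (w f * t)" by (simp only: wsum sum_distrib_right)
      finally show "(\<Prod>p\<in>?S. c p (f p) * ?e p (f p)) = (\<Prod>p\<in>?S. c p (f p)) * cis (w f * t)"
        by (simp only: prod.distrib)
    qed
    finally show ?thesis .
  qed
  have sq: "(norm (c p m))\<^sup>2 = (norm (local_coeff q l N p m))\<^sup>2 / real p ^ m" if "prime p" for p m
  proof -
    have "((real p powr (- 1 / 2)) ^ m)\<^sup>2 = ((real p powr (- 1 / 2)) ^ 2) ^ m"
      by (simp only: power_mult [symmetric] mult.commute)
    also have "(real p powr (- 1 / 2)) ^ 2 = 1 / real p"
      using prime_gt_0_nat[OF that] by (simp add: power2_eq_square powr_add [symmetric] powr_minus_divide)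
    finally show ?thesis by (simp add: c_def norm_mult norm_power power_mult_distrib power_one_over)
  qed
  have "((\<lambda>T. mean_square (P_prod q l (real N)) T) \<longlongrightarrow> (\<Sum>\<^sub>\<infinity>f\<in>?S \<rightarrow>\<^sub>E UNIV. (norm (\<Prod>p\<in>?S. c p (f p)))\<^sup>2)) at_top"
    unfolding mean_square_def P
    by (rule mean_square_trig_series[OF _ inj]) (rule abs_summable_on_prod_PiE, use S(1) csm in auto)
  also have "(\<Sum>\<^sub>\<infinity>f\<in>?S \<rightarrow>\<^sub>E UNIV. (norm (\<Prod>p\<in>?S. c p (f p)))\<^sup>2) =
             (\<Sum>\<^sub>\<infinity>f\<in>?S \<rightarrow>\<^sub>E UNIV. \<Prod>p\<in>?S. (norm (c p (f p)))\<^sup>2)"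
    by (simp only: prod_norm [symmetric] prod_power_distrib)
  also have "\<dots> = (\<Prod>p\<in>?S. \<Sum>m. (norm (c p m))\<^sup>2)"
  proof (rule infsum_prod_PiE_suminf[OF S(1)])
    fix p assume "p \<in> ?S"
    hence "prime p" by simp
    show "summable (\<lambda>m. norm ((norm (c p m))\<^sup>2))"
      unfolding sq[OF \<open>prime p\<close>] using summable_local_coeff_square[OF \<open>prime p\<close>] by simp
  qed
  also have "\<dots> = (\<Prod>p\<in>?S. \<Sum>m. (norm (local_coeff q l N p m))\<^sup>2 / real p ^ m)"
    by (intro prod.cong refl arg_cong[where f = suminf] ext) (simp add: sq)
  finally show ?thesis .
qed

end

section \<open>The Euler product\<close>

lemma suminf_ge_1:
  fixes c :: "nat \<Rightarrow> complex"
  assumes "c 0 = 1" "summable (\<lambda>m. (norm (c m))\<^sup>2 / real p ^ m)"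
  shows "(\<Sum>m. (norm (c m))\<^sup>2 / real p ^ m) \<ge> 1"
  using sum_le_suminf[OF assms(2), of "{0}"] assms(1) by simp

lemma abs_ln_diff_le:
  fixes a b :: real
  assumes "a \<ge> 1" "b \<ge> 1"
  shows "\<bar>ln a - ln b\<bar> \<le> \<bar>a - b\<bar>"
proof -
  have *: "ln x - ln y \<le> \<bar>x - y\<bar>" if "x \<ge> 1" "y \<ge> 1" for x y :: real
  proof -
    have "ln x - ln y = ln (x / y)" using that by (simp add: ln_divide_pos)
    also have "\<dots> \<le> x / y - 1" using that by (intro ln_le_minus_one) auto
    also have "\<dots> = (x - y) / y" using that by (simp add: field_simps)
    also have "\<dots> \<le> \<bar>x - y\<bar> / y" using that by (intro divide_right_mono) auto
    also have "\<dots> \<le> \<bar>x - y\<bar> / 1" using that by (intro divide_left_mono) auto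
    finally show ?thesis by simp
  qed
  from *[OF assms] *[OF assms(2,1)] show ?thesis by (simp add: abs_le_iff)
qed

text \<open>The two factors at p differ only in terms with p^m > N, where both squares are at most
  \<open>w m\<close>; the difference is bounded by a prime power tail. Both factors are at least 1
  by their term m = 0, and ln is 1-Lipschitz there, so the logarithms of the two products differ by
  o(1).\<close>

lemma euler_product_comparison:
  assumes q: "q > 0"
  shows "(\<lambda>N. (\<Prod>p | prime p \<and> p \<le> N. \<Sum>m. (norm (local_coeff q l N p m))\<^sup>2 / real p ^ m) /
              (\<Prod>p | prime p \<and> p \<le> N. \<Sum>m. (norm (dirichlet_coeff q l (p ^ m)))\<^sup>2 / real p ^ m)) \<longlonglongrightarrow> 1"
proof -
  define k where "k = (\<Sum>chi\<in>dirichlet_characters q. l chi)"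
  define F where "F = (\<lambda>N p. \<Sum>m. (norm (local_coeff q l N p m))\<^sup>2 / real p ^ m)"
  define D where "D = (\<lambda>p. \<Sum>m. (norm (dirichlet_coeff q l (p ^ m)))\<^sup>2 / real p ^ m)"
  define w where "w = (\<lambda>m. real (m + k choose k) ^ 2)"
  note bounds = norm_local_coeff_le[OF q k_def[symmetric]] norm_dirichlet_coeff_le[OF q k_def[symmetric]]
  have smF: "summable (\<lambda>m. (norm (local_coeff q l N p m))\<^sup>2 / real p ^ m)" if "prime p" for N p
    by (rule summable_coeff_square[OF q k_def[symmetric] that]) (rule bounds)
  have smD: "summable (\<lambda>m. (norm (dirichlet_coeff q l (p ^ m)))\<^sup>2 / real p ^ m)" if "prime p" for p
    by (rule summable_coeff_square[OF q k_def[symmetric] that]) (rule bounds(2)[OF that])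
  have F1: "F N p \<ge> 1" if "prime p" for N p
    unfolding F_def by (rule suminf_ge_1[OF _ smF[OF that]]) (simp add: local_coeff_def)
  have D1: "D p \<ge> 1" if "prime p" for p
    unfolding D_def by (rule suminf_ge_1[OF _ smD[OF that]]) (subst dirichlet_coeff_prime_power[OF q that], simp)
  have w: "w m \<ge> 0" for m by (simp add: w_def)
  have smw: "summable (\<lambda>m. w m * (2 powr (- 3 / 4)) ^ m)"
    unfolding w_def by (rule summable_choose_power) (simp add: powr_less_one)
  have diff: "\<bar>F N p - D p\<bar> \<le> prime_power_tail w N p" if p: "prime p" "p \<le> N" for N p
  proof -
    let ?d = "\<lambda>m. (norm (local_coeff q l N p m))\<^sup>2 / real p ^ m - (norm (dirichlet_coeff q l (p ^ m)))\<^sup>2 / real p ^ m"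
    have "F N p - D p = (\<Sum>m. ?d m)"
      unfolding F_def D_def by (rule suminf_diff[OF smF smD]) (use p in auto)
    also have "norm \<dots> \<le> prime_power_tail w N p"
      unfolding prime_power_tail_def
    proof (rule norm_suminf_le[OF _ summable_prime_power_tail[OF w smw p]])
      fix m
      show "norm (?d m) \<le> (if N < p ^ m then w m / real (p ^ m) else 0)"
      proof (cases "N < p ^ m")
        case True
        have "(norm (local_coeff q l N p m))\<^sup>2 \<le> w m" "(norm (dirichlet_coeff q l (p ^ m)))\<^sup>2 \<le> w m"
          unfolding w_def by (intro power_mono bounds p norm_ge_zero)+
        hence "\<bar>(norm (local_coeff q l N p m))\<^sup>2 - (norm (dirichlet_coeff q l (p ^ m)))\<^sup>2\<bar> \<le> w m"
          using zero_le_power2[of "norm (local_coeff q l N p m)"]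
            zero_le_power2[of "norm (dirichlet_coeff q l (p ^ m))"] by linarith
        hence "\<bar>(norm (local_coeff q l N p m))\<^sup>2 - (norm (dirichlet_coeff q l (p ^ m)))\<^sup>2\<bar> / real p ^ m \<le> w m / real p ^ m"
          by (rule divide_right_mono) simp
        thus ?thesis using True by (simp add: diff_divide_distrib [symmetric])
      next
        case False
        thus ?thesis using local_coeff_eq[OF q k_def[symmetric] p(1), of m N] by simp
      qed
    qed
    finally show ?thesis by simp
  qed
  have "(\<lambda>N. \<Sum>p | prime p \<and> p \<le> N. ln (F N p) - ln (D p)) \<longlonglongrightarrow> 0"
  proof (rule Lim_null_comparison)
    show "(\<lambda>N. \<Sum>p | prime p \<and> p \<le> N. prime_power_tail w N p) \<longlonglongrightarrow> 0"
      by (rule prime_power_tail_tendsto_0[OF w smw])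
    have "norm (\<Sum>p | prime p \<and> p \<le> N. ln (F N p) - ln (D p)) \<le> (\<Sum>p | prime p \<and> p \<le> N. prime_power_tail w N p)" for N
    proof (rule sum_norm_le)
      fix p assume "p \<in> {p. prime p \<and> p \<le> N}"
      hence p: "prime p" "p \<le> N" by auto
      show "norm (ln (F N p) - ln (D p)) \<le> prime_power_tail w N p"
        using abs_ln_diff_le[OF F1[OF p(1), of N] D1[OF p(1)]] diff[OF p] by simp
    qed
    thus "\<forall>\<^sub>F N in sequentially. norm (\<Sum>p | prime p \<and> p \<le> N. ln (F N p) - ln (D p)) \<le>
            (\<Sum>p | prime p \<and> p \<le> N. prime_power_tail w N p)" by simp
  qed
  from tendsto_exp[OF this]
  have "(\<lambda>N. exp (\<Sum>p | prime p \<and> p \<le> N. ln (F N p) - ln (D p))) \<longlonglongrightarrow> 1" by simp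
  also have "(\<lambda>N. exp (\<Sum>p | prime p \<and> p \<le> N. ln (F N p) - ln (D p))) =
             (\<lambda>N. (\<Prod>p | prime p \<and> p \<le> N. F N p) / (\<Prod>p | prime p \<and> p \<le> N. D p))"
  proof
    fix N
    have "exp (\<Sum>p | prime p \<and> p \<le> N. ln (F N p) - ln (D p)) = (\<Prod>p | prime p \<and> p \<le> N. F N p / D p)"
      unfolding exp_sum[OF finite_Collect_conjI[OF disjI2[OF finite_Collect_le_nat]]]
    proof (intro prod.cong refl)
      fix p assume "p \<in> {p. prime p \<and> p \<le> N}"
      hence "F N p > 0" "D p > 0" using F1[of p N] D1[of p] by auto
      thus "exp (ln (F N p) - ln (D p)) = F N p / D p" by (simp add: exp_diff)
    qed
    thus "exp (\<Sum>p | prime p \<and> p \<le> N. ln (F N p) - ln (D p)) =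
            (\<Prod>p | prime p \<and> p \<le> N. F N p) / (\<Prod>p | prime p \<and> p \<le> N. D p)"
      by (simp only: prod_dividef)
  qed
  finally show ?thesis unfolding F_def D_def .
qed

text \<open>\<open>raw_has_prod\<close> asks for a non-zero limit of the partial products, hence the
  assumption \<open>h \<noteq> 0\<close>.\<close>

lemma prime_product_tendsto_imp_prodinf:
  fixes g :: "nat \<Rightarrow> real"
  assumes lim: "(\<lambda>N. \<Prod>p | prime p \<and> p \<le> N. g p) \<longlonglongrightarrow> h" and h: "h \<noteq> 0"
  shows "(\<Prod>p. if prime p then g p else 1) = h"
proof -
  have "(\<Prod>p\<le>N. if prime p then g p else 1) = (\<Prod>p | prime p \<and> p \<le> N. g p)" for N
    by (simp add: prod.inter_filter [symmetric] conj_commute)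
  hence "(\<lambda>p. if prime p then g p else 1) has_prod h"
    using lim h unfolding has_prod_def raw_has_prod_def add_0_right by simp
  thus ?thesis by (rule has_prod_unique [symmetric])
qed

section \<open>Combining the two hypotheses\<close>

text \<open>With both parameters equal to 1 the range becomes X \<le> ln T, so a fixed
  \<open>X\<close> is admissible for all T \<ge> exp X.\<close>

lemma eventually_XT_range:
  assumes "eventually Q (XT_range 1 1)"
  obtains X0 T0 where "\<And>X T. X \<ge> X0 \<Longrightarrow> T \<ge> T0 \<Longrightarrow> X \<le> ln T \<Longrightarrow> Q (X, T)"
proof -
  have "\<forall>\<^sub>F x in at_top \<times>\<^sub>F at_top. x \<in> {(X, T). X \<le> 1 * ln T powr (2 - 1)} \<longrightarrow> Q x"
    using assms by (simp only: XT_range_def eventually_inf_principal)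
  then obtain P1 P2 where P: "eventually P1 at_top" "eventually P2 at_top"
    "\<And>X T. P1 X \<Longrightarrow> P2 T \<Longrightarrow> X \<le> ln T powr 1 \<longrightarrow> Q (X, T)"
    unfolding eventually_prod_filter by auto
  from P(1) obtain X0 where X0: "\<And>X. X \<ge> X0 \<Longrightarrow> P1 X" by (auto simp: eventually_at_top_linorder)
  from P(2) obtain T0 where T0: "\<And>T. T \<ge> T0 \<Longrightarrow> P2 T" by (auto simp: eventually_at_top_linorder)
  show thesis
  \<comment> \<open>The bound T \<ge> 1 makes \<open>ln T\<close> non-negative, as required for
    \<open>ln T powr 1 = ln T\<close>.\<close>
  proof (rule that[of X0 "max T0 1"])
    fix X T assume *: "X \<ge> X0" "T \<ge> max T0 1" "X \<le> ln T"
    hence "ln T powr 1 = ln T" by (intro powr_one) auto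
    thus "Q (X, T)" using P(3)[OF X0 T0] * by simp
  qed
qed

text \<open>
  Since \<open>u T\<close> does not involve \<open>X\<close>, letting \<open>T\<close> tend to
  infinity for two different fixed values of \<open>X\<close> shows that the normalised limits \<open>S N / g N\<close> form a
  Cauchy sequence. In this way the convergence of the Euler product is a consequence of the
  hypotheses.
\<close>
lemma separated_limit:
  fixes u g :: "real \<Rightarrow> real" and P :: "real \<Rightarrow> real \<Rightarrow> real" and S :: "nat \<Rightarrow> real"
  assumes asym: "\<And>e. e > 0 \<Longrightarrow> \<exists>X0. \<forall>N\<ge>X0. \<forall>\<^sub>F T in at_top. P (real N) T > 0 \<longrightarrow>
                    u T * g (real N) / P (real N) T > 0 \<and> \<bar>ln (u T * g (real N) / P (real N) T)\<bar> < e"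
    and lim: "\<forall>\<^sub>F N in sequentially. ((\<lambda>T. P (real N) T) \<longlongrightarrow> S N) at_top"
    and S: "\<forall>\<^sub>F N in sequentially. S N > 0" and g: "\<forall>\<^sub>F N in sequentially. g (real N) > 0"
  obtains h where "h > 0" "(u \<longlongrightarrow> h) at_top" "(\<lambda>N. S N / g (real N)) \<longlonglongrightarrow> h"
proof -
  define v where "v = (\<lambda>N. ln (S N / g (real N)))"
  \<comment> \<open>For fixed \<open>N\<close>, one half of \<open>e\<close> pays for
    \<open>asym\<close> and the other for replacing \<open>P (real N) T\<close> by its limit
    \<open>S N\<close>.\<close>
  have key: "\<exists>N0. \<forall>N\<ge>N0. S N / g (real N) > 0 \<and> (\<forall>\<^sub>F T in at_top. u T > 0 \<and> \<bar>ln (u T) - v N\<bar> < e)"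
    if e: "e > 0" for e
  proof -
    from e have "e / 2 > 0" by simp
    from asym[OF this] obtain X0 where X0: "\<And>N. N \<ge> X0 \<Longrightarrow> \<forall>\<^sub>F T in at_top. P (real N) T > 0 \<longrightarrow>
          u T * g (real N) / P (real N) T > 0 \<and> \<bar>ln (u T * g (real N) / P (real N) T)\<bar> < e / 2" by blast
    have "\<forall>\<^sub>F N in sequentially. S N / g (real N) > 0 \<and> (\<forall>\<^sub>F T in at_top. u T > 0 \<and> \<bar>ln (u T) - v N\<bar> < e)"
      using lim S g eventually_ge_at_top[of X0]
    proof eventually_elim
      case (elim N)
      note lim = elim(1) and S = elim(2) and g = elim(3) and NX = elim(4)
      have P0: "\<forall>\<^sub>F T in at_top. P (real N) T > 0"
        using order_tendstoD(1)[OF lim S] .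
      have "((\<lambda>T. ln (P (real N) T)) \<longlongrightarrow> ln (S N)) at_top"
        using lim S by (intro tendsto_ln) auto
      hence "\<forall>\<^sub>F T in at_top. dist (ln (P (real N) T)) (ln (S N)) < e / 2"
        using e by (intro tendstoD) auto
      with P0 X0[OF NX] have "\<forall>\<^sub>F T in at_top. u T > 0 \<and> \<bar>ln (u T) - v N\<bar> < e"
      proof eventually_elim
        case (elim T)
        have a: "u T * g (real N) / P (real N) T > 0" "\<bar>ln (u T * g (real N) / P (real N) T)\<bar> < e / 2"
          using elim by auto
        from a(1) elim(1) g have u: "u T > 0" by (simp add: zero_less_divide_iff zero_less_mult_iff)
        have "ln (u T * g (real N) / P (real N) T) = ln (u T) + ln (g (real N)) - ln (P (real N) T)"
          using u g elim(1) by (simp add: ln_divide_pos ln_mult)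
        moreover have "v N = ln (S N) - ln (g (real N))" using S g by (simp add: v_def ln_divide_pos)
        ultimately have "\<bar>ln (u T) - v N\<bar> < e"
          using a(2) elim(3) unfolding dist_real_def abs_less_iff by linarith
        with u show ?case by blast
      qed
      thus ?case using S g by simp
    qed
    thus ?thesis by (simp add: eventually_sequentially)
  qed
  have "Cauchy v"
  proof (rule metric_CauchyI)
    fix e :: real assume e: "e > 0"
    then obtain N0 where N0: "\<And>N. N \<ge> N0 \<Longrightarrow> \<forall>\<^sub>F T in at_top. u T > 0 \<and> \<bar>ln (u T) - v N\<bar> < e / 2"
      using key[of "e / 2"] by auto
    have "dist (v m) (v n) < e" if "m \<ge> N0" "n \<ge> N0" for m n
    proof -
      \<comment> \<open>The conclusion does not involve \<open>T\<close>; it suffices that both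
        estimates hold at one common \<open>T\<close>.\<close>
      have "\<forall>\<^sub>F T :: real in at_top. dist (v m) (v n) < e"
        using N0[OF that(1)] N0[OF that(2)]
        by eventually_elim (unfold dist_real_def abs_less_iff, linarith)
      thus ?thesis by simp
    qed
    thus "\<exists>N0. \<forall>m\<ge>N0. \<forall>n\<ge>N0. dist (v m) (v n) < e" by blast
  qed
  then obtain c where c: "v \<longlonglongrightarrow> c" using Cauchy_convergent by (auto simp: convergent_def)
  have "((\<lambda>T. ln (u T)) \<longlongrightarrow> c) at_top"
  proof (rule tendstoI)
    fix e :: real assume e: "e > 0"
    from key[of "e / 2"] e obtain N0 where
      N0: "\<And>N. N \<ge> N0 \<Longrightarrow> \<forall>\<^sub>F T in at_top. u T > 0 \<and> \<bar>ln (u T) - v N\<bar> < e / 2" by auto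
    have "\<forall>\<^sub>F N in sequentially. dist (v N) c < e / 2" using tendstoD[OF c, of "e / 2"] e by simp
    then obtain N1 where N1: "\<And>N. N \<ge> N1 \<Longrightarrow> dist (v N) c < e / 2" by (auto simp: eventually_sequentially)
    have 1: "\<forall>\<^sub>F T in at_top. u T > 0 \<and> \<bar>ln (u T) - v (max N0 N1)\<bar> < e / 2" by (rule N0) simp
    have 2: "dist (v (max N0 N1)) c < e / 2" by (rule N1) simp
    from 1 show "\<forall>\<^sub>F T in at_top. dist (ln (u T)) c < e"
      by eventually_elim (use 2 in \<open>unfold dist_real_def abs_less_iff, linarith\<close>)
  qed
  from tendsto_exp[OF this] have "((\<lambda>T. exp (ln (u T))) \<longlongrightarrow> exp c) at_top" .
  moreover from key[of 1] obtain N0 where "\<forall>\<^sub>F T in at_top. u T > 0 \<and> \<bar>ln (u T) - v N0\<bar> < 1" by auto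
  hence "\<forall>\<^sub>F T in at_top. exp (ln (u T)) = u T" by eventually_elim simp
  ultimately have u: "(u \<longlongrightarrow> exp c) at_top" by (rule Lim_transform_eventually)
  have "\<forall>\<^sub>F N in sequentially. exp (v N) = S N / g (real N)"
    using S g by eventually_elim (simp add: v_def)
  with tendsto_exp[OF c] have "(\<lambda>N. S N / g (real N)) \<longlonglongrightarrow> exp c" by (rule Lim_transform_eventually)
  with u show thesis by (intro that[of "exp c"]) auto
qed

lemma prod_ln_conductor_pos:
  assumes "q > 0" "T > (1 :: real)"
  shows "(\<Prod>chi\<in>dirichlet_characters q. ln (real (conductor q chi) * T) ^ n chi) > 0"
proof (intro prod_pos zero_less_power ln_gt_zero)
  fix chi assume "chi \<in> dirichlet_characters q"
  hence "conductor q chi > 0" using conductor_pos[OF assms(1)] by (simp add: dirichlet_characters_def)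
  hence "1 * T \<le> real (conductor q chi) * T" using assms by (intro mult_right_mono) auto
  thus "1 < real (conductor q chi) * T" using assms by linarith
qed

lemma mean_square_L_prod_tendsto:
  assumes q: "q > 0" and split: "splitting_hypothesis f q l" and rmt: "random_matrix_hypothesis f q l"
  shows "((\<lambda>T. mean_square (L_prod q l) T /
             (\<Prod>chi\<in>dirichlet_characters q. ln (real (conductor q chi) * T) ^ ((l chi)\<^sup>2)))
           \<longlongrightarrow> leading_constant q l) at_top"
proof -
  let ?D = "dirichlet_characters q"
  define lam where "lam = (\<Sum>chi\<in>?D. (l chi)\<^sup>2)"
  define b where "b = (\<Prod>chi\<in>?D. (barnes_G (real (l chi) + 1))\<^sup>2 / barnes_G (2 * real (l chi) + 1))"
  define W where "W = (\<lambda>T. \<Prod>chi\<in>?D. ln (real (conductor q chi) * T) ^ ((l chi)\<^sup>2))"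
  define g where "g = (\<lambda>X::real. (exp euler_mascheroni * ln X) ^ lam)"
  define M where "M = (\<lambda>T. mean_square (L_prod q l) T)"
  define P where "P = (\<lambda>X T. mean_square (P_prod q l X) T)"
  define S where "S = (\<lambda>N. \<Prod>p | prime p \<and> p \<le> N. \<Sum>m. (norm (local_coeff q l N p m))\<^sup>2 / real p ^ m)"
  \<comment> \<open>The variables separate: \<open>T\<close> occurs only in \<open>W\<close> and
    \<open>X\<close> only in \<open>g\<close>, where the exponents add up to
    \<open>lam\<close>.\<close>
  have R: "(\<Prod>chi\<in>?D. (barnes_G (real (l chi) + 1))\<^sup>2 / barnes_G (2 * real (l chi) + 1) *
           (ln (real (conductor q chi) * T) / (exp euler_mascheroni * ln X)) ^ ((l chi)\<^sup>2)) = b * (W T / g X)" for X T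
    unfolding b_def W_def g_def lam_def prod.distrib power_divide prod_dividef power_sum ..
  \<comment> \<open>The quotient from the definition of \<open>asymp_equiv\<close>, with its
    convention that 0 / 0 counts as 1.\<close>
  define \<rho> where "\<rho> = (\<lambda>(X, T). if M T = 0 \<and> P X T * (b * (W T / g X)) = 0 then 1 else M T / (P X T * (b * (W T / g X))))"
  have rho: "(\<rho> \<longlongrightarrow> 1) (XT_range 1 1)"
  proof -
    have Z: "(\<lambda>x. mean_square (Z_prod f q l (fst x)) (snd x)) \<sim>[XT_range 1 1] (\<lambda>x. b * (W (snd x) / g (fst x)))"
      using rmt unfolding random_matrix_hypothesis_def R by (simp add: case_prod_unfold)
    have "(\<lambda>x. M (snd x)) \<sim>[XT_range 1 1] (\<lambda>x. P (fst x) (snd x) * mean_square (Z_prod f q l (fst x)) (snd x))"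
      using split unfolding splitting_hypothesis_def M_def P_def by (simp add: case_prod_unfold)
    also have "\<dots> \<sim>[XT_range 1 1] (\<lambda>x. P (fst x) (snd x) * (b * (W (snd x) / g (fst x))))"
      by (intro asymp_equiv_mult asymp_equiv_refl Z)
    finally show ?thesis
      by (simp only: asymp_equiv_def \<rho>_def case_prod_unfold)
  qed
  have W0: "W T > 0" if "T > 1" for T
    unfolding W_def by (rule prod_ln_conductor_pos[OF q that])
  have g0: "g X > 0" if "X > 1" for X using that by (simp add: g_def)
  have lc: "leading_constant q l =
    (\<Prod>p. if prime p then (1 - 1 / real p) ^ lam * (\<Sum>m. (norm (dirichlet_coeff q l (p ^ m)))\<^sup>2 / real p ^ m) else 1) * b"
    unfolding leading_constant_def lam_def b_def ..
  have eqs: "mean_square (L_prod q l) T = M T"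
    "(\<Prod>chi\<in>?D. ln (real (conductor q chi) * T) ^ ((l chi)\<^sup>2)) = W T" for T
    by (simp_all add: M_def W_def)
  show ?thesis
    unfolding eqs
  proof (cases "b = 0")
    \<comment> \<open>The predicted side now vanishes, so \<open>\<rho>\<close> is 0 by
      \<open>x / 0 = 0\<close> unless \<open>M T = 0\<close>. Hence \<open>M T = 0\<close> for all
      large \<open>T\<close>, and the leading constant is 0 as well. In this way no non-vanishing of
      \<open>barnes_G\<close> has to be proved.\<close>
    case True
    have "\<forall>\<^sub>F x in XT_range 1 1. \<rho> x > 0" using rho by (rule order_tendstoD) simp
    then obtain X0 T0 where X0: "\<And>X T. X \<ge> X0 \<Longrightarrow> T \<ge> T0 \<Longrightarrow> X \<le> ln T \<Longrightarrow> \<rho> (X, T) > 0"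
      using eventually_XT_range by blast
    have "\<forall>\<^sub>F T in at_top. M T / W T = 0"
      using eventually_ge_at_top[of T0] eventually_ge_at_top[of "exp X0"]
    proof eventually_elim
      case (elim T)
      have "X0 \<le> ln T" using elim(2) by (metis exp_gt_zero less_le_trans ln_ge_iff)
      hence "\<rho> (X0, T) > 0" using elim by (intro X0) auto
      thus ?case by (auto simp: \<rho>_def True split: if_splits)
    qed
    thus "((\<lambda>T. M T / W T) \<longlongrightarrow> leading_constant q l) at_top"
      unfolding lc True by (simp add: tendsto_eventually)
  next
    case b: False
    \<comment> \<open>With the \<open>T\<close>-dependent part of the prediction divided out,
      \<open>\<rho>\<close> takes the form \<open>u T * g (real N) / P (real N) T\<close> required
      by \<open>separated_limit\<close>.\<close>
    define u where "u = (\<lambda>T. M T / (b * W T))"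
    have lnrho: "((\<lambda>x. ln (\<rho> x)) \<longlongrightarrow> 0) (XT_range 1 1)"
      using tendsto_ln[OF rho] by simp
    obtain h where h: "h > 0" "(u \<longlongrightarrow> h) at_top" "(\<lambda>N. S N / g (real N)) \<longlonglongrightarrow> h"
    proof (rule separated_limit[of P u g S])
      fix e :: real assume e: "e > 0"
      have "\<forall>\<^sub>F x in XT_range 1 1. \<rho> x > 0 \<and> dist (ln (\<rho> x)) 0 < e"
        using order_tendstoD(1)[OF rho, of 0] tendstoD[OF lnrho e] by (simp add: eventually_conj)
      then obtain X0 T0 where X0: "\<And>X T. X \<ge> X0 \<Longrightarrow> T \<ge> T0 \<Longrightarrow> X \<le> ln T \<Longrightarrow> \<rho> (X, T) > 0 \<and> dist (ln (\<rho> (X, T))) 0 < e"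
        using eventually_XT_range by blast
      show "\<exists>X0. \<forall>N\<ge>X0. \<forall>\<^sub>F T in at_top. P (real N) T > 0 \<longrightarrow>
              u T * g (real N) / P (real N) T > 0 \<and> \<bar>ln (u T * g (real N) / P (real N) T)\<bar> < e"
      proof (intro exI allI impI)
        \<comment> \<open>The value 2 ensures ln N > 0, and hence
          \<open>g (real N) > 0\<close>.\<close>
        fix N assume N: "N \<ge> nat \<lceil>max X0 2\<rceil>"
        hence N: "real N \<ge> X0" "real N > 1" by linarith+
        show "\<forall>\<^sub>F T in at_top. P (real N) T > 0 \<longrightarrow>
              u T * g (real N) / P (real N) T > 0 \<and> \<bar>ln (u T * g (real N) / P (real N) T)\<bar> < e"
          using eventually_ge_at_top[of T0] eventually_ge_at_top[of "exp (real N)"] eventually_gt_at_top[of 1]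
        proof eventually_elim
          case (elim T)
          show ?case
          proof
            assume P: "P (real N) T > 0"
            have "real N \<le> ln T" using elim(2,3) by (simp add: ln_ge_iff)
            with X0[OF N(1) elim(1)] have rho: "\<rho> (real N, T) > 0" "\<bar>ln (\<rho> (real N, T))\<bar> < e" by auto
            have "\<rho> (real N, T) = M T / (P (real N) T * (b * (W T / g (real N))))"
              using P b W0[OF elim(3)] g0[OF N(2)] by (simp add: \<rho>_def)
            also have "\<dots> = u T * g (real N) / P (real N) T" by (simp add: u_def)
            finally show "u T * g (real N) / P (real N) T > 0 \<and> \<bar>ln (u T * g (real N) / P (real N) T)\<bar> < e"
              using rho by simp
          qed
        qed
      qed
    next
      show "\<forall>\<^sub>F N in sequentially. ((\<lambda>T. P (real N) T) \<longlongrightarrow> S N) at_top"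
        using eventually_ge_at_top[of q] unfolding P_def S_def
        by eventually_elim (rule mean_square_P_prod[OF q refl])
      show "\<forall>\<^sub>F N in sequentially. S N > 0"
      proof (intro always_eventually allI)
        fix N
        have "1 \<le> (\<Sum>m. (norm (local_coeff q l N p m))\<^sup>2 / real p ^ m)" if "prime p" for p
          by (rule suminf_ge_1[OF _ summable_local_coeff_square[OF q refl that]]) (simp add: local_coeff_def)
        thus "S N > 0" unfolding S_def by (intro prod_pos) (fastforce intro: less_le_trans[OF zero_less_one])
      qed
      show "\<forall>\<^sub>F N in sequentially. g (real N) > 0"
        using eventually_gt_at_top[of 1] by eventually_elim (rule g0, simp)
    qed
    let ?F = "\<lambda>p. \<Sum>m. (norm (dirichlet_coeff q l (p ^ m)))\<^sup>2 / real p ^ m"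
    \<comment> \<open>The power of the Mertens quantity cancels \<open>g\<close>, and dividing by
      the quotient of the two Euler products replaces \<open>S N\<close> by the product formed with
      \<open>dirichlet_coeff\<close>.\<close>
    have "(\<lambda>N. (S N / g (real N)) * ((\<Prod>p | prime p \<and> p \<le> N. 1 - 1 / real p) * (exp euler_mascheroni * ln (real N))) ^ lam
              / (S N / (\<Prod>p | prime p \<and> p \<le> N. ?F p))) \<longlonglongrightarrow> h * 1 ^ lam / 1"
      unfolding S_def by (intro tendsto_intros h(3)[unfolded S_def] mertens_product euler_product_comparison q) simp
    moreover have "\<forall>\<^sub>F N in sequentially. (S N / g (real N)) * ((\<Prod>p | prime p \<and> p \<le> N. 1 - 1 / real p) * (exp euler_mascheroni * ln (real N))) ^ lam
              / (S N / (\<Prod>p | prime p \<and> p \<le> N. ?F p)) = (\<Prod>p | prime p \<and> p \<le> N. (1 - 1 / real p) ^ lam * ?F p)"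
    proof -
      have "\<forall>\<^sub>F N in sequentially. S N / g (real N) > 0" using order_tendstoD(1)[OF h(3) h(1)] .
      thus ?thesis using eventually_gt_at_top[of 1]
      proof eventually_elim
        case (elim N)
        have "g (real N) > 0" using elim(2) by (intro g0) simp
        moreover from this have "S N > 0" using elim(1) by (simp add: zero_less_divide_iff)
        moreover have "((\<Prod>p | prime p \<and> p \<le> N. 1 - 1 / real p) * (exp euler_mascheroni * ln (real N))) ^ lam =
                (\<Prod>p | prime p \<and> p \<le> N. (1 - 1 / real p) ^ lam) * g (real N)"
          unfolding g_def power_mult_distrib[of "prod _ _"] by (simp only: prod_power_distrib)
        ultimately show ?case by (simp add: prod.distrib field_simps)
      qed
    qed
    ultimately have "(\<lambda>N. \<Prod>p | prime p \<and> p \<le> N. (1 - 1 / real p) ^ lam * ?F p) \<longlonglongrightarrow> h"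
      using Lim_transform_eventually by fastforce
    hence "leading_constant q l = h * b"
      unfolding lc using h(1) by (subst prime_product_tendsto_imp_prodinf) auto
    moreover have "((\<lambda>T. u T * b) \<longlongrightarrow> h * b) at_top" by (intro tendsto_intros h(2))
    moreover have "u T * b = M T / W T" for T using b by (simp add: u_def)
    ultimately show "((\<lambda>T. M T / W T) \<longlongrightarrow> leading_constant q l) at_top" by simp
  qed
qed

theorem theorem4:
  fixes q k :: nat and f :: "real \<Rightarrow> real" and A :: "((nat \<Rightarrow> complex) \<Rightarrow> nat) set"
  assumes "q > 0"
    and "smooth_bump f"
    and "A = {l. (\<Sum>chi\<in>dirichlet_characters q. l chi) = k \<and>
                 splitting_hypothesis f q l \<and> random_matrix_hypothesis f q l}"
  shows "\<exists>r :: real \<Rightarrow> ((nat \<Rightarrow> complex) \<Rightarrow> nat) \<Rightarrow> real.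
           uniform_limit A r (\<lambda>l. 0) at_top \<and>
           (\<forall>\<^sub>F T in at_top. \<forall>l\<in>A.
              mean_square (L_prod q l) T =
              (leading_constant q l + r T l) *
              (\<Prod>chi\<in>dirichlet_characters q.
                 ln (real (conductor q chi) * T) ^ ((l chi)\<^sup>2)))"
proof (intro exI conjI)
  let ?D = "dirichlet_characters q"
  note q = \<open>q > 0\<close>
  define W where "W = (\<lambda>l T. \<Prod>chi\<in>?D. ln (real (conductor q chi) * T) ^ ((l chi)\<^sup>2))"
  define r where "r = (\<lambda>T l. mean_square (L_prod q l) T / W l T - leading_constant q l)"
  have W0: "W l T > 0" if "T > 1" for l T
    unfolding W_def by (rule prod_ln_conductor_pos[OF q that])
  show "\<forall>\<^sub>F T in at_top. \<forall>l\<in>A. mean_square (L_prod q l) T =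
              (leading_constant q l + r T l) * (\<Prod>chi\<in>?D. ln (real (conductor q chi) * T) ^ ((l chi)\<^sup>2))"
    using eventually_gt_at_top[of 1]
  proof eventually_elim
    case (elim T)
    show ?case
    proof
      fix l
      show "mean_square (L_prod q l) T =
              (leading_constant q l + r T l) * (\<Prod>chi\<in>?D. ln (real (conductor q chi) * T) ^ ((l chi)\<^sup>2))"
        using W0[OF elim, of l] by (simp add: r_def W_def)
    qed
  qed
  have lim: "((\<lambda>T. r T l) \<longlongrightarrow> 0) at_top" if "l \<in> A" for l
  proof -
    have "((\<lambda>T. mean_square (L_prod q l) T / W l T) \<longlongrightarrow> leading_constant q l) at_top"
      unfolding W_def using that assms(3) by (intro mean_square_L_prod_tendsto[OF q]) auto
    from tendsto_diff[OF this tendsto_const[of "leading_constant q l"]] show ?thesis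
      by (simp add: r_def)
  qed
  \<comment> \<open>Tuples are total functions with arbitrary values outside \<open>?D\<close>, so
    \<open>A\<close> may be infinite. As \<open>r\<close> depends only on the restriction to
    \<open>?D\<close>, uniformity reduces to finitely many restrictions, whose entries are at most
    \<open>k\<close>.\<close>
  have cong: "r T l = r T l'" if eq: "restrict l ?D = restrict l' ?D" for l l' T
  proof -
    have l: "l chi = l' chi" if "chi \<in> ?D" for chi using fun_cong[OF eq, of chi] that by simp
    have coeff: "dirichlet_coeff q l = dirichlet_coeff q l'"
    proof -
      have "(SIGMA chi:?D. {..<l chi}) = (SIGMA chi:?D. {..<l' chi})" using l by (intro Sigma_cong) auto
      thus ?thesis by (simp only: dirichlet_coeff_def [abs_def])
    qed
    have "L_prod q l = L_prod q l'" unfolding L_prod_def [abs_def] by (intro ext prod.cong) (auto simp: l)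
    moreover have "W l T = W l' T" unfolding W_def by (intro prod.cong) (auto simp: l)
    moreover have "leading_constant q l = leading_constant q l'"
    proof -
      have s: "(\<Sum>chi\<in>?D. (l chi)\<^sup>2) = (\<Sum>chi\<in>?D. (l' chi)\<^sup>2)" by (intro sum.cong) (auto simp: l)
      show ?thesis
        unfolding leading_constant_def coeff s by (intro arg_cong2[of _ _ _ _ "(*)"] prod.cong) (auto simp: l)
    qed
    ultimately show ?thesis by (simp add: r_def)
  qed
  show "uniform_limit A r (\<lambda>l. 0) at_top"
  proof (rule uniform_limitI)
    fix e :: real assume e: "e > 0"
    have fin: "finite ?D" by (rule finite_dirichlet_characters[OF q])
    have "(\<lambda>l. restrict l ?D) ` A \<subseteq> ?D \<rightarrow>\<^sub>E {..k}"
    proof clarify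
      fix l assume "l \<in> A"
      hence "(\<Sum>chi\<in>?D. l chi) = k" using assms(3) by auto
      hence "l chi \<le> k" if "chi \<in> ?D" for chi using member_le_sum[OF that, of l] fin by auto
      thus "restrict l ?D \<in> ?D \<rightarrow>\<^sub>E {..k}" by auto
    qed
    hence finA: "finite ((\<lambda>l. restrict l ?D) ` A)"
      by (rule finite_subset) (intro finite_PiE fin finite_atMost)
    have "\<forall>\<^sub>F T in at_top. \<forall>c\<in>(\<lambda>l. restrict l ?D) ` A. \<forall>l\<in>A. restrict l ?D = c \<longrightarrow> dist (r T l) 0 < e"
    proof (rule eventually_ball_finite[OF finA], safe)
      fix l assume "l \<in> A"
      from tendstoD[OF lim[OF this] e]
      show "\<forall>\<^sub>F T in at_top. \<forall>l'\<in>A. restrict l' ?D = restrict l ?D \<longrightarrow> dist (r T l') 0 < e"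
        by eventually_elim (metis cong)
    qed
    thus "\<forall>\<^sub>F T in at_top. \<forall>l\<in>A. dist (r T l) 0 < e" by eventually_elim auto
  qed
qed

end
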